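(* Let $L>0$, $\nu_1,\nu_2\in\mathbb{R}\setminus\{0\}$, $0\le a<b\le L$, and $T>0$ be such that $$T>2(L-b)\max\left(\frac1{|\nu_1|},\frac1{|\nu_2|}\right),\qquad T>2a\max\left(\frac1{|\nu_1|},\frac1{|\nu_2|}\right).$$ There exists a constant $C>0$ depending on $T$ such that, for any given initial and final conditions $$((u_0,u_1),(v_0,v_1),(u_0^f,u_1^f),(v_0^f,v_1^f))\in\left(C^{11}([0,L])\times C^{10}([0,L])\right)^4$$ satisfying the compatibility conditions at order $11$ (defined in the context), there exists $h\in C^6([0,T]\times[0,L])$ with $$\operatorname{supp} h\subset[0,T]\times[a,b]$$ such that the corresponding solution $(u,v)\in C^6([0,T]\times[0,L])^2$ of $$\begin{cases}u_{tt}-\nu_1^2u_{xx}=h, & x\in[0,L],\\ v_{tt}-\nu_2^2v_{xx}=u^3, & x\in[0,L],\\ u=0,\ v=0\text{ on }\{0,L\},\end{cases}$$ with initial values $(u,u_t)(0,\cdot)=(u_0,u_1)$, $(v,v_t)(0,\cdot)=(v_0,v_1)$, satisfies $$u(T,\cdot)=u_0^f,\quad u_t(T,\cdot)=u_1^f,\quad v(T,\cdot)=v_0^f,\quad v_t(T,\cdot)=v_1^f,$$ and $$\|h\|_{C^6}\le C\left(\|(u_0,u_1,u_0^f,u_1^f)\|_{(C^{11}\times C^{10})^2}+\|(v_0,v_1,v_0^f,v_1^f)\|_{(C^{11}\times C^{10})^2}^{1/3}\right).$$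
   Context: Norms on product spaces are the usual product norms of the $C^k$ norms. Compatibility conditions at order $k$: put $f_1=0$ and $f_2(u,v)=u^3$. Given $(u_0,u_1,v_0,v_1)$ with $u_0,v_0\in C^k([0,L])$ and $u_1,v_1\in C^{k-1}([0,L])$, define $U_0=u_0$, $U_1=u_1$, $V_0=v_0$, $V_1=v_1$ and, for $2\le n\le k$, $$U_n=\nu_1^2U_{n-2}''+F_{1,n-2},\qquad V_n=\nu_2^2V_{n-2}''+F_{2,n-2},$$ where $$F_{i,m}(x)=\frac{d^m}{ds^m}\Big|_{s=0} f_i\Big(\sum_{j=0}^m U_j(x)\frac{s^j}{j!},\ \sum_{j=0}^m V_j(x)\frac{s^j}{j!}\Big).$$ (These are the time derivatives $\partial_t^nu,\partial_t^nv$ computed formally from the uncontrolled equations.) The initial and final conditions satisfy the compatibility conditions at order $k$ if $U_n(c)=V_n(c)=0$ for all $0\le n\le k$ and $c\in\{0,L\}$, and if the same holds for the functions constructed in the same way from $(u_0^f,u_1^f,v_0^f,v_1^f)$. *)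

theory Defs
  imports "HOL-Analysis.Analysis"
begin

text \<open>
  A function on an interval \<open>S\<close> is represented by a function on all of \<open>real\<close> whose values
  outside \<open>S\<close> are irrelevant. Derivatives are taken within \<open>S\<close>, hence they are
  one-sided at the end points.
\<close>

definition deriv_within :: "real set \<Rightarrow> (real \<Rightarrow> real) \<Rightarrow> real \<Rightarrow> real" where
  "deriv_within S f = (\<lambda>x. vector_derivative f (at x within S))"

fun C_on :: "nat \<Rightarrow> real set \<Rightarrow> (real \<Rightarrow> real) \<Rightarrow> bool" where
  "C_on 0 S f \<longleftrightarrow> continuous_on S f"
| "C_on (Suc k) S f \<longleftrightarrow> f differentiable_on S \<and> C_on k S (deriv_within S f)"

definition C_norm :: "nat \<Rightarrow> real set \<Rightarrow> (real \<Rightarrow> real) \<Rightarrow> real" where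
  "C_norm k S f = (\<Sum>n\<le>k. SUP x\<in>S. \<bar>(deriv_within S ^^ n) f x\<bar>)"

text \<open>
  Functions of \<open>(t, x)\<close> in the rectangle \<open>I \<times> S\<close>, in curried form; partial derivatives are again
  one-sided on the boundary.
\<close>

definition dt :: "real set \<Rightarrow> (real \<Rightarrow> real \<Rightarrow> real) \<Rightarrow> real \<Rightarrow> real \<Rightarrow> real" where
  "dt I w = (\<lambda>t x. deriv_within I (\<lambda>s. w s x) t)"

definition dx :: "real set \<Rightarrow> (real \<Rightarrow> real \<Rightarrow> real) \<Rightarrow> real \<Rightarrow> real \<Rightarrow> real" where
  "dx S w = (\<lambda>t. deriv_within S (w t))"

fun C_on_rect :: "nat \<Rightarrow> real set \<Rightarrow> real set \<Rightarrow> (real \<Rightarrow> real \<Rightarrow> real) \<Rightarrow> bool" where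
  "C_on_rect 0 I S w \<longleftrightarrow> continuous_on (I \<times> S) (\<lambda>(t, x). w t x)"
| "C_on_rect (Suc k) I S w \<longleftrightarrow>
     continuous_on (I \<times> S) (\<lambda>(t, x). w t x) \<and>
     (\<forall>x\<in>S. (\<lambda>t. w t x) differentiable_on I) \<and>
     (\<forall>t\<in>I. w t differentiable_on S) \<and>
     C_on_rect k I S (dt I w) \<and> C_on_rect k I S (dx S w)"

text \<open>Mixed partial derivatives of \<open>C\<^sup>k\<close> functions commute, so one order per multi-index suffices.\<close>

definition C_norm_rect :: "nat \<Rightarrow> real set \<Rightarrow> real set \<Rightarrow> (real \<Rightarrow> real \<Rightarrow> real) \<Rightarrow> real" where
  "C_norm_rect k I S w =
     (\<Sum>(i, j) \<in> {(i, j). i + j \<le> k}. SUP (t, x) \<in> I \<times> S. \<bar>((dt I ^^ i) ((dx S ^^ j) w)) t x\<bar>)"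

definition supp_rect :: "real set \<Rightarrow> real set \<Rightarrow> (real \<Rightarrow> real \<Rightarrow> real) \<Rightarrow> (real \<times> real) set" where
  "supp_rect I S w = closure {(t, x). t \<in> I \<and> x \<in> S \<and> w t x \<noteq> 0}"

definition f1 :: "real \<Rightarrow> real \<Rightarrow> real" where
  "f1 u v = 0"

definition f2 :: "real \<Rightarrow> real \<Rightarrow> real" where
  "f2 u v = u ^ 3"

definition source_deriv ::
  "(real \<Rightarrow> real \<Rightarrow> real) \<Rightarrow> nat \<Rightarrow> (nat \<Rightarrow> real \<Rightarrow> real) \<Rightarrow> (nat \<Rightarrow> real \<Rightarrow> real) \<Rightarrow> real \<Rightarrow> real" where
  "source_deriv f m U V x =
     (deriv ^^ m) (\<lambda>s. f (\<Sum>j\<le>m. U j x * s ^ j / fact j) (\<Sum>j\<le>m. V j x * s ^ j / fact j)) 0"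

text \<open>Needed for the termination proof of the recursion below: only indices \<open>j \<le> m\<close> are used.\<close>

lemma source_deriv_cong [fundef_cong]:
  assumes "f = f'" "m = m'" "x = x'" "\<And>j. j \<le> m' \<Longrightarrow> U j = U' j" "\<And>j. j \<le> m' \<Longrightarrow> V j = V' j"
  shows "source_deriv f m U V x = source_deriv f' m' U' V' x'"
  unfolding source_deriv_def using assms by (simp cong: sum.cong_simp)

text \<open>
  The time derivatives at the initial time of \<open>u\<close> and \<open>v\<close>, computed formally from the uncontrolled
  equations \<open>u\<^sub>t\<^sub>t = \<nu>1\<^sup>2 u\<^sub>x\<^sub>x + f1 u v\<close>, \<open>v\<^sub>t\<^sub>t = \<nu>2\<^sup>2 v\<^sub>x\<^sub>x + f2 u v\<close>.
\<close>

fun formal_U and formal_V ::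
  "real set \<Rightarrow> real \<Rightarrow> real \<Rightarrow> (real \<Rightarrow> real) \<Rightarrow> (real \<Rightarrow> real) \<Rightarrow> (real \<Rightarrow> real) \<Rightarrow> (real \<Rightarrow> real) \<Rightarrow>
   nat \<Rightarrow> real \<Rightarrow> real"
where
  "formal_U S \<nu>1 \<nu>2 u0 u1 v0 v1 0 = u0"
| "formal_U S \<nu>1 \<nu>2 u0 u1 v0 v1 (Suc 0) = u1"
| "formal_U S \<nu>1 \<nu>2 u0 u1 v0 v1 (Suc (Suc n)) =
     (\<lambda>x. \<nu>1\<^sup>2 * (deriv_within S ^^ 2) (formal_U S \<nu>1 \<nu>2 u0 u1 v0 v1 n) x +
        source_deriv f1 n (\<lambda>j. formal_U S \<nu>1 \<nu>2 u0 u1 v0 v1 j) (\<lambda>j. formal_V S \<nu>1 \<nu>2 u0 u1 v0 v1 j) x)"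
| "formal_V S \<nu>1 \<nu>2 u0 u1 v0 v1 0 = v0"
| "formal_V S \<nu>1 \<nu>2 u0 u1 v0 v1 (Suc 0) = v1"
| "formal_V S \<nu>1 \<nu>2 u0 u1 v0 v1 (Suc (Suc n)) =
     (\<lambda>x. \<nu>2\<^sup>2 * (deriv_within S ^^ 2) (formal_V S \<nu>1 \<nu>2 u0 u1 v0 v1 n) x +
        source_deriv f2 n (\<lambda>j. formal_U S \<nu>1 \<nu>2 u0 u1 v0 v1 j) (\<lambda>j. formal_V S \<nu>1 \<nu>2 u0 u1 v0 v1 j) x)"

definition compatible ::
  "nat \<Rightarrow> real \<Rightarrow> real \<Rightarrow> real \<Rightarrow> (real \<Rightarrow> real) \<Rightarrow> (real \<Rightarrow> real) \<Rightarrow> (real \<Rightarrow> real) \<Rightarrow> (real \<Rightarrow> real) \<Rightarrow> bool"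
where
  "compatible k L \<nu>1 \<nu>2 u0 u1 v0 v1 \<longleftrightarrow>
     (\<forall>n\<le>k. \<forall>c\<in>{0, L}. formal_U {0..L} \<nu>1 \<nu>2 u0 u1 v0 v1 n c = 0 \<and>
                          formal_V {0..L} \<nu>1 \<nu>2 u0 u1 v0 v1 n c = 0)"

definition is_solution ::
  "real \<Rightarrow> real \<Rightarrow> real \<Rightarrow> real \<Rightarrow> (real \<Rightarrow> real \<Rightarrow> real) \<Rightarrow>
   (real \<Rightarrow> real) \<Rightarrow> (real \<Rightarrow> real) \<Rightarrow> (real \<Rightarrow> real) \<Rightarrow> (real \<Rightarrow> real) \<Rightarrow>
   (real \<Rightarrow> real \<Rightarrow> real) \<Rightarrow> (real \<Rightarrow> real \<Rightarrow> real) \<Rightarrow> bool"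
where
  "is_solution L T \<nu>1 \<nu>2 h u0 u1 v0 v1 u v \<longleftrightarrow>
     C_on_rect 6 {0..T} {0..L} u \<and> C_on_rect 6 {0..T} {0..L} v \<and>
     (\<forall>t\<in>{0..T}. \<forall>x\<in>{0..L}.
        (dt {0..T} ^^ 2) u t x - \<nu>1\<^sup>2 * (dx {0..L} ^^ 2) u t x = h t x \<and>
        (dt {0..T} ^^ 2) v t x - \<nu>2\<^sup>2 * (dx {0..L} ^^ 2) v t x = u t x ^ 3) \<and>
     (\<forall>t\<in>{0..T}. \<forall>x\<in>{0, L}. u t x = 0 \<and> v t x = 0) \<and>
     (\<forall>x\<in>{0..L}. u 0 x = u0 x \<and> dt {0..T} u 0 x = u1 x \<and>
                  v 0 x = v0 x \<and> dt {0..T} v 0 x = v1 x)"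

end

theory Submission
  imports Defs "HOL-Computational_Algebra.Polynomial"
begin

text \<open>
  The compatibility conditions say exactly that the odd \<open>2L\<close>-periodic extensions of the data are smooth,
  so the free evolutions are given by d'Alembert's formula on the whole plane. The equation for \<open>u\<close> may be
  violated inside \<open>[a, b]\<close> at will, since \<open>h\<close> is defined as the residual. Hence only \<open>v\<close> has to be controlled,
  and its control must be a cube \<open>u\<^sup>3\<close> of a smooth function.

  First a controlled free wave \<open>w\<close> joins the initial to the final data of \<open>u\<close> and vanishes in the middle of
  the control region, where \<open>u - w\<close> is then free. With \<open>\<xi> = \<nu>t + x\<close> and \<open>\<eta> = \<nu>t - x\<close>, the difference \<open>F(\<xi>) - F(\<eta>)\<close> of two
  free waves is switched on by sums of products \<open>f(\<xi>) g(\<eta>)\<close>, whose d'Alembertian is a multiple of \<open>f' g'\<close>. If \<open>f'\<close>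
  and \<open>g'\<close> are cubes, so is the source, and sources with disjoint supports add up to a cube. To make the factor
  \<open>f'\<close> a cube, a large multiple \<open>M\<alpha>\<^sup>3\<close> is added to it and subtracted again in a neighbouring cell, the
  cube root of \<open>M + f'\<close> being smooth. Each characteristic line meets such a cell inside the control
  region because of the two lower bounds on \<open>T\<close>.

  The estimate comes from a uniform bound for normalised data, because the system is invariant under
  \<open>(u, v, h) \<mapsto> (\<lambda>u, \<lambda>\<^sup>3v, \<lambda>h)\<close>.
\<close>

section \<open>Families of functions with uniformly bounded derivatives\<close>

text \<open>At rest the second equation, linearised, sees no control at all, because u^3 has zero
  derivative at u = 0; hence nothing can be perturbed from a linear control problem and the control
  is built exactly. A linear control could be any smooth function, but its cube root need not be
  differentiable where it vanishes. Cubes remain usable for two reasons: the exponent is odd, so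
  both signs occur, and \<open>(x + y)^3 = x^3 + y^3\<close> whenever \<open>x * y = 0\<close>, so
  superposition survives for pieces with disjoint supports. Most of the geometry serves to keep
  pieces apart. The numbers 2a/|\<nu>| and 2(L - b)/|\<nu>| are the times in which a ray leaves
  [a, b], is reflected at 0 or L, and returns. The control of v is centred at time T/2: every ray
  present then is in [a, b] at some moment less than T/2 away. The orders leave room: passing to the
  factor f' and its cube root costs one derivative, forming h two more, so data of order 11 give a
  residual of class C^8. Since finite smoothness suffices, the cut-offs are mere repeated
  antiderivatives.\<close>

definition locally_bdd :: "'i set \<Rightarrow> ('i \<Rightarrow> 'a::euclidean_space \<Rightarrow> real) \<Rightarrow> bool" where
  "locally_bdd I w \<longleftrightarrow> (\<forall>R. \<exists>M. \<forall>i\<in>I. \<forall>p. norm p \<le> R \<longrightarrow> \<bar>w i p\<bar> \<le> M)"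

text \<open>
  A family \<open>w i\<close>, \<open>i \<in> I\<close>, of \<open>C\<^sup>k\<close> functions whose derivatives up to order \<open>k\<close> are bounded on bounded sets
  uniformly in \<open>i\<close>. Taking the data as index \<open>i\<close>, the final estimate requires no explicit constants.
\<close>

fun CF :: "nat \<Rightarrow> 'i set \<Rightarrow> ('i \<Rightarrow> 'a::euclidean_space \<Rightarrow> real) \<Rightarrow> bool" where
  "CF 0 I w \<longleftrightarrow> (\<forall>i\<in>I. continuous_on UNIV (w i)) \<and> locally_bdd I w"
| "CF (Suc k) I w \<longleftrightarrow> locally_bdd I w \<and>
     (\<exists>w'. (\<forall>i\<in>I. \<forall>p. (w i has_derivative (\<lambda>h. \<Sum>b\<in>Basis. (h \<bullet> b) * w' b i p)) (at p)) \<and>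
           (\<forall>b\<in>Basis. CF k I (w' b)))"

lemma locally_bddD:
  assumes "locally_bdd I w"
  obtains M where "M > 0" "\<And>i p. i \<in> I \<Longrightarrow> norm p \<le> R \<Longrightarrow> \<bar>w i p\<bar> \<le> M"
proof -
  obtain M where M: "\<forall>i\<in>I. \<forall>p. norm p \<le> R \<longrightarrow> \<bar>w i p\<bar> \<le> M"
    using assms unfolding locally_bdd_def by blast
  show ?thesis
    by (rule that[of "\<bar>M\<bar> + 1"]) (use M in force)+
qed

lemma CF_SucE:
  assumes "CF (Suc k) I w"
  obtains w' where "\<And>i p. i \<in> I \<Longrightarrow> (w i has_derivative (\<lambda>h. \<Sum>b\<in>Basis. (h \<bullet> b) * w' b i p)) (at p)"
    "\<And>b. b \<in> Basis \<Longrightarrow> CF k I (w' b)" "locally_bdd I w"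
  using assms unfolding CF.simps by blast

lemma CF_locally_bdd: "CF k I w \<Longrightarrow> locally_bdd I w"
  by (cases k) auto

lemma CF_continuous: "CF k I w \<Longrightarrow> i \<in> I \<Longrightarrow> continuous_on A (w i)"
proof (cases k)
  case 0
  then show "CF k I w \<Longrightarrow> i \<in> I \<Longrightarrow> ?thesis"
    by (auto intro: continuous_on_subset)
next
  case (Suc n)
  show "CF k I w \<Longrightarrow> i \<in> I \<Longrightarrow> ?thesis"
    unfolding Suc CF.simps
    by (meson continuous_at_imp_continuous_on has_derivative_continuous)
qed

lemma CF_Suc_D: "CF (Suc k) I w \<Longrightarrow> CF k I w"
proof (induction k arbitrary: w)
  case 0
  then show ?case
    using CF_continuous[of "Suc 0" I w] by (auto simp del: CF.simps(2) simp: CF_locally_bdd)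
next
  case (Suc k)
  from Suc.prems obtain w' where
    w: "\<And>i p. i \<in> I \<Longrightarrow> (w i has_derivative (\<lambda>h. \<Sum>b\<in>Basis. (h \<bullet> b) * w' b i p)) (at p)"
    "\<And>b. b \<in> Basis \<Longrightarrow> CF (Suc k) I (w' b)" "locally_bdd I w"
    by (rule CF_SucE) blast
  show ?case
    unfolding CF.simps(2)[of k]
    by (intro conjI exI[of _ w'] ballI allI w Suc.IH)
qed

lemma CF_mono: "CF k I w \<Longrightarrow> j \<le> k \<Longrightarrow> CF j I w"
proof (induction k)
  case (Suc k)
  then show ?case
    using CF_Suc_D le_Suc_eq by blast
qed simp

lemma CF_const_index:
  assumes "locally_bdd I (\<lambda>i p. c i :: real)" shows "CF k I (\<lambda>i p::'a::euclidean_space. c i)"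
proof -
  have lb: "locally_bdd I (\<lambda>i (p::'a). c i)"
  proof -
    obtain M where "\<forall>i\<in>I. \<forall>p. norm p \<le> 0 \<longrightarrow> \<bar>c i\<bar> \<le> M"
      using assms unfolding locally_bdd_def by blast
    then have "\<forall>i\<in>I. \<bar>c i\<bar> \<le> M"
      by (metis norm_zero order_refl)
    then show ?thesis
      unfolding locally_bdd_def by blast
  qed
  have z: "CF k I (\<lambda>i (p::'a). 0)" for k
  proof (induction k)
    case (Suc k)
    show ?case
      unfolding CF.simps
      by (intro conjI exI[of _ "\<lambda>b i p. 0"]) (use Suc in \<open>auto simp: locally_bdd_def\<close>)
  qed (auto simp: locally_bdd_def)
  show ?thesis
  proof (cases k)
    case 0
    then show ?thesis using lb by simp
  next
    case (Suc n)
    show ?thesis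
      unfolding Suc CF.simps
      by (intro conjI exI[of _ "\<lambda>b i p. 0"]) (use z lb in auto)
  qed
qed

lemma CF_const: "CF k I (\<lambda>i p. c)"
  by (rule CF_const_index) (auto simp: locally_bdd_def)

lemma locally_bdd_const:
  assumes "continuous_on UNIV f" shows "locally_bdd I (\<lambda>i. f)"
  unfolding locally_bdd_def
proof
  fix R
  have "compact ((\<lambda>p. f p) ` cball 0 R)"
    by (rule compact_continuous_image[OF continuous_on_subset[OF assms]]) auto
  then obtain M where "\<forall>x\<in>f ` cball 0 R. norm x \<le> M"
    using compact_imp_bounded bounded_iff by metis
  then show "\<exists>M. \<forall>i\<in>I. \<forall>p. norm p \<le> R \<longrightarrow> \<bar>f p\<bar> \<le> M"
    by (intro exI[of _ M]) auto
qed

lemma CF_linear: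
  assumes "bounded_linear f" shows "CF k I (\<lambda>i. f)"
proof -
  have c: "continuous_on UNIV f"
    by (simp add: assms linear_continuous_on)
  show ?thesis
  proof (cases k)
    case 0
    then show ?thesis using c locally_bdd_const by auto
  next
    case (Suc n)
    have rep: "f h = (\<Sum>b\<in>Basis. (h \<bullet> b) * f b)" for h
    proof -
      have "f h = f (\<Sum>b\<in>Basis. (h \<bullet> b) *\<^sub>R b)"
        by (simp add: euclidean_representation)
      also have "\<dots> = (\<Sum>b\<in>Basis. (h \<bullet> b) * f b)"
        using assms by (simp add: linear_sum linear_scale bounded_linear.linear)
      finally show ?thesis .
    qed
    have e: "(\<lambda>h. \<Sum>b\<in>Basis. (h \<bullet> b) * f b) = f"
      by (rule ext) (rule rep[symmetric])
    show ?thesis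
      unfolding Suc CF.simps
      by (intro conjI exI[of _ "\<lambda>b i p. f b"])
        (use c in \<open>auto simp only: e intro!: bounded_linear_imp_has_derivative assms locally_bdd_const CF_const\<close>)
  qed
qed

lemma CF_ident: "CF k I (\<lambda>i x::real. x)"
  by (rule CF_linear) (rule bounded_linear_ident)

lemma CF_fst: "CF k I (\<lambda>i p::real\<times>real. fst p)"
  by (rule CF_linear) (rule bounded_linear_fst)

lemma CF_snd: "CF k I (\<lambda>i p::real\<times>real. snd p)"
  by (rule CF_linear) (rule bounded_linear_snd)

lemma locally_bdd_add:
  fixes w z :: "'i \<Rightarrow> 'a::euclidean_space \<Rightarrow> real"
  assumes "locally_bdd I w" "locally_bdd I z" shows "locally_bdd I (\<lambda>i p. w i p + z i p)"
  unfolding locally_bdd_def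
proof
  fix R
  from assms obtain M where M: "\<And>i p. i \<in> I \<Longrightarrow> norm p \<le> R \<Longrightarrow> \<bar>w i p\<bar> \<le> M"
    by (metis locally_bddD)
  from assms obtain N where N: "\<And>i p. i \<in> I \<Longrightarrow> norm p \<le> R \<Longrightarrow> \<bar>z i p\<bar> \<le> N"
    by (metis locally_bddD)
  show "\<exists>M. \<forall>i\<in>I. \<forall>p. norm p \<le> R \<longrightarrow> \<bar>w i p + z i p\<bar> \<le> M"
  proof (intro exI[of _ "M + N"] ballI allI impI)
    fix i and p :: 'a assume "i \<in> I" "norm p \<le> R"
    then show "\<bar>w i p + z i p\<bar> \<le> M + N"
      using M[of i p] N[of i p] by linarith
  qed
qed

lemma locally_bdd_mult:
  assumes "locally_bdd I w" "locally_bdd I z" shows "locally_bdd I (\<lambda>i p. w i p * z i p)"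
  unfolding locally_bdd_def
proof
  fix R
  from assms obtain M where M: "M > 0" "\<And>i p. i \<in> I \<Longrightarrow> norm p \<le> R \<Longrightarrow> \<bar>w i p\<bar> \<le> M"
    by (metis locally_bddD)
  from assms obtain N where N: "\<And>i p. i \<in> I \<Longrightarrow> norm p \<le> R \<Longrightarrow> \<bar>z i p\<bar> \<le> N"
    by (metis locally_bddD)
  show "\<exists>M. \<forall>i\<in>I. \<forall>p. norm p \<le> R \<longrightarrow> \<bar>w i p * z i p\<bar> \<le> M"
    by (intro exI[of _ "M * N"]) (use M N in \<open>auto simp: abs_mult intro!: mult_mono\<close>)
qed

lemma CF_add: "CF k I w \<Longrightarrow> CF k I z \<Longrightarrow> CF k I (\<lambda>i p. w i p + z i p)"
proof (induction k arbitrary: w z)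
  case 0
  then show ?case
    by (auto intro: continuous_intros locally_bdd_add)
next
  case (Suc k)
  from Suc.prems(1) obtain w' where
    w: "\<And>i p. i \<in> I \<Longrightarrow> (w i has_derivative (\<lambda>h. \<Sum>b\<in>Basis. (h \<bullet> b) * w' b i p)) (at p)"
    "\<And>b. b \<in> Basis \<Longrightarrow> CF k I (w' b)"
    by (rule CF_SucE) blast
  from Suc.prems(2) obtain z' where
    z: "\<And>i p. i \<in> I \<Longrightarrow> (z i has_derivative (\<lambda>h. \<Sum>b\<in>Basis. (h \<bullet> b) * z' b i p)) (at p)"
    "\<And>b. b \<in> Basis \<Longrightarrow> CF k I (z' b)"
    by (rule CF_SucE) blast
  show ?case
    unfolding CF.simps
  proof (intro conjI exI[of _ "\<lambda>b i p. w' b i p + z' b i p"] ballI allI)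
    show "locally_bdd I (\<lambda>i p. w i p + z i p)"
      using Suc.prems by (auto intro: locally_bdd_add)
  next
    fix i p assume "i \<in> I"
    show "((\<lambda>p. w i p + z i p) has_derivative (\<lambda>h. \<Sum>b\<in>Basis. (h \<bullet> b) * (w' b i p + z' b i p))) (at p)"
      using has_derivative_add[OF w(1)[OF \<open>i\<in>I\<close>, of p] z(1)[OF \<open>i\<in>I\<close>, of p]]
      by (simp add: distrib_left sum.distrib)
  qed (intro Suc.IH w(2) z(2); assumption)
qed

lemma CF_mult: "CF k I w \<Longrightarrow> CF k I z \<Longrightarrow> CF k I (\<lambda>i p. w i p * z i p)"
proof (induction k arbitrary: w z)
  case 0
  then show ?case
    by (auto intro: continuous_intros locally_bdd_mult)
next
  case (Suc k)
  from Suc.prems(1) obtain w' where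
    w: "\<And>i p. i \<in> I \<Longrightarrow> (w i has_derivative (\<lambda>h. \<Sum>b\<in>Basis. (h \<bullet> b) * w' b i p)) (at p)"
    "\<And>b. b \<in> Basis \<Longrightarrow> CF k I (w' b)"
    by (rule CF_SucE) blast
  from Suc.prems(2) obtain z' where
    z: "\<And>i p. i \<in> I \<Longrightarrow> (z i has_derivative (\<lambda>h. \<Sum>b\<in>Basis. (h \<bullet> b) * z' b i p)) (at p)"
    "\<And>b. b \<in> Basis \<Longrightarrow> CF k I (z' b)"
    by (rule CF_SucE) blast
  have k: "CF k I w" "CF k I z"
    using Suc.prems CF_Suc_D by blast+
  show ?case
    unfolding CF.simps
  proof (intro conjI exI[of _ "\<lambda>b i p. w i p * z' b i p + w' b i p * z i p"] ballI allI)
    show "locally_bdd I (\<lambda>i p. w i p * z i p)"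
      using Suc.prems by (auto intro: locally_bdd_mult)
  next
    fix i p assume "i \<in> I"
    have e: "(\<lambda>h. w i p * (\<Sum>b\<in>Basis. h \<bullet> b * z' b i p) + (\<Sum>b\<in>Basis. h \<bullet> b * w' b i p) * z i p)
      = (\<lambda>h. \<Sum>b\<in>Basis. (h \<bullet> b) * (w i p * z' b i p + w' b i p * z i p))"
      by (auto simp: sum_distrib_left sum_distrib_right distrib_left sum.distrib algebra_simps)
    show "((\<lambda>p. w i p * z i p) has_derivative (\<lambda>h. \<Sum>b\<in>Basis. (h \<bullet> b) * (w i p * z' b i p + w' b i p * z i p))) (at p)"
      using has_derivative_mult[OF w(1)[OF \<open>i\<in>I\<close>, of p] z(1)[OF \<open>i\<in>I\<close>, of p]]
      unfolding e .
  qed (intro CF_add Suc.IH k w(2) z(2); assumption)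
qed

lemma CF_cmult: "CF k I w \<Longrightarrow> CF k I (\<lambda>i p. c * w i p)"
  by (rule CF_mult[OF CF_const])

lemma CF_minus: "CF k I w \<Longrightarrow> CF k I (\<lambda>i p. - w i p)"
  using CF_cmult[of k I w "-1"] by simp

lemma CF_diff: "CF k I w \<Longrightarrow> CF k I z \<Longrightarrow> CF k I (\<lambda>i p. w i p - z i p)"
  using CF_add[OF _ CF_minus, of k I w z] by simp

lemma CF_power: "CF k I w \<Longrightarrow> CF k I (\<lambda>i p. w i p ^ n)"
  by (induction n) (auto intro: CF_mult CF_const)

lemma CF_sum: "(\<And>j. j \<in> J \<Longrightarrow> CF k I (w j)) \<Longrightarrow> CF k I (\<lambda>i p. \<Sum>j\<in>J. w j i p)"
  by (induction J rule: infinite_finite_induct) (auto intro: CF_add CF_const)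

text \<open>Chain rule by induction on k: a partial derivative of the composition is a sum of
  products of \<open>w' c\<close> composed with q and of partial derivatives of q, and the induction
  hypothesis applies to the former.\<close>

lemma CF_compose:
  fixes w :: "'i \<Rightarrow> 'b::euclidean_space \<Rightarrow> real" and q :: "'i \<Rightarrow> 'a::euclidean_space \<Rightarrow> 'b"
  assumes "CF k I w" "\<And>c. c \<in> Basis \<Longrightarrow> CF k I (\<lambda>i p. q i p \<bullet> c)"
  shows "CF k I (\<lambda>i p. w i (q i p))"
  using assms
proof (induction k arbitrary: w)
  have lb: "locally_bdd I (\<lambda>i p. w i (q i p))"
    if q: "\<And>c. c \<in> Basis \<Longrightarrow> locally_bdd I (\<lambda>i p. q i p \<bullet> c)" and w: "locally_bdd I w" for w
    unfolding locally_bdd_def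
  proof
    fix R
    have "\<forall>c\<in>Basis. \<exists>M. \<forall>i\<in>I. \<forall>p. norm p \<le> R \<longrightarrow> \<bar>q i p \<bullet> c\<bar> \<le> M"
      using q unfolding locally_bdd_def by blast
    then obtain M where M: "\<And>c i p. c \<in> Basis \<Longrightarrow> i \<in> I \<Longrightarrow> norm p \<le> R \<Longrightarrow> \<bar>q i p \<bullet> c\<bar> \<le> M c"
      by metis
    \<comment> \<open>The components of q being bounded on the ball of radius R, all
      \<open>q i\<close> map it into one fixed ball, on which w is uniformly bounded.\<close>
    have "norm (q i p) \<le> (\<Sum>c\<in>Basis. M c)" if "i \<in> I" "norm p \<le> R" for i p
      using norm_le_l1[of "q i p"] sum_mono[of "Basis" "\<lambda>c. \<bar>q i p \<bullet> c\<bar>" M] M that by fastforce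
    moreover obtain N where "\<And>i p. i \<in> I \<Longrightarrow> norm p \<le> (\<Sum>c\<in>Basis. M c) \<Longrightarrow> \<bar>w i p\<bar> \<le> N"
      using w by (metis locally_bddD)
    ultimately show "\<exists>M. \<forall>i\<in>I. \<forall>p. norm p \<le> R \<longrightarrow> \<bar>w i (q i p)\<bar> \<le> M"
      by blast
  qed
  {
    case 0
    have "continuous_on UNIV (\<lambda>p. w i (q i p))" if "i \<in> I" for i
    proof -
      have "continuous_on UNIV (q i)"
        using 0 that by (subst continuous_on_componentwise) auto
      moreover have "continuous_on UNIV (w i)"
        using 0 that by auto
      ultimately show ?thesis
        using continuous_on_compose2 by blast
    qed
    then show ?case
      using lb 0 by auto
  next
    case (Suc k)
    from Suc.prems(1) obtain w' where
      w: "\<And>i p. i \<in> I \<Longrightarrow> (w i has_derivative (\<lambda>h. \<Sum>b\<in>Basis. (h \<bullet> b) * w' b i p)) (at p)"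
      "\<And>b. b \<in> Basis \<Longrightarrow> CF k I (w' b)"
      by (rule CF_SucE) blast
    have "\<forall>c\<in>Basis. \<exists>q'. (\<forall>i\<in>I. \<forall>p. ((\<lambda>p. q i p \<bullet> c) has_derivative (\<lambda>h. \<Sum>b\<in>Basis. (h \<bullet> b) * q' b i p)) (at p)) \<and>
           (\<forall>b\<in>Basis. CF k I (q' b))"
      using Suc.prems(2) by auto
    from bchoice[OF this] obtain q' where
      q': "\<forall>c\<in>Basis. (\<forall>i\<in>I. \<forall>p. ((\<lambda>p. q i p \<bullet> c) has_derivative (\<lambda>h. \<Sum>b\<in>Basis. (h \<bullet> b) * q' c b i p)) (at p)) \<and>
           (\<forall>b\<in>Basis. CF k I (q' c b))" ..
    have q: "\<And>c i p. c \<in> Basis \<Longrightarrow> i \<in> I \<Longrightarrow> ((\<lambda>p. q i p \<bullet> c) has_derivative (\<lambda>h. \<Sum>b\<in>Basis. (h \<bullet> b) * q' c b i p)) (at p)"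
      "\<And>c b. c \<in> Basis \<Longrightarrow> b \<in> Basis \<Longrightarrow> CF k I (q' c b)"
      using q' by blast+
    have k: "CF k I (\<lambda>i p. q i p \<bullet> c)" if "c \<in> Basis" for c
      using Suc.prems that CF_Suc_D by blast
    show ?case
      unfolding CF.simps
    proof (intro conjI exI[of _ "\<lambda>b i p. \<Sum>c\<in>Basis. w' c i (q i p) * q' c b i p"] ballI allI)
      show "locally_bdd I (\<lambda>i p. w i (q i p))"
        using Suc.prems by (auto intro: lb)
    next
      fix i p assume i: "i \<in> I"
      have 1: "(q i has_derivative (\<lambda>h. \<Sum>c\<in>Basis. (\<Sum>b\<in>Basis. (h \<bullet> b) * q' c b i p) *\<^sub>R c)) (at p)"
        using q i by (subst has_derivative_componentwise_within) simp
      have 2: "(\<lambda>h. \<Sum>c\<in>Basis. ((\<Sum>c\<in>Basis. (\<Sum>b\<in>Basis. (h \<bullet> b) * q' c b i p) *\<^sub>R c) \<bullet> c) * w' c i (q i p))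
         = (\<lambda>h. \<Sum>b\<in>Basis. (h \<bullet> b) * (\<Sum>c\<in>Basis. w' c i (q i p) * q' c b i p))"
        by (auto simp: sum_distrib_left sum_distrib_right algebra_simps intro!: ext sum.swap[THEN trans])
      show "((\<lambda>p. w i (q i p)) has_derivative (\<lambda>h. \<Sum>b\<in>Basis. (h \<bullet> b) * (\<Sum>c\<in>Basis. w' c i (q i p) * q' c b i p))) (at p)"
        using has_derivative_compose[OF 1 w(1)[OF i]] unfolding 2 .
    next
      fix b :: 'a assume "b \<in> Basis"
      then show "CF k I (\<lambda>i p. \<Sum>c\<in>Basis. w' c i (q i p) * q' c b i p)"
        using Suc.IH[OF w(2)] k q(2) by (auto intro!: CF_sum CF_mult)
    qed
  }
qed

section \<open>Functions of one and of two real variables\<close>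

lemma Basis_real_prod: "(Basis :: (real \<times> real) set) = {(1, 0), (0, 1)}"
  by (auto simp: Basis_prod_def)

lemma CF_real_SucI:
  fixes f :: "'i \<Rightarrow> real \<Rightarrow> real"
  assumes "locally_bdd I f" "\<And>i x. i \<in> I \<Longrightarrow> (f i has_real_derivative f' i x) (at x)" "CF k I f'"
  shows "CF (Suc k) I f"
  unfolding CF.simps
  by (intro conjI exI[of _ "\<lambda>b. f'"] assms(1))
    (use assms in \<open>auto simp: has_field_derivative_def mult.commute[of _ "f' _ _"]\<close>)

lemma CF_real_SucE:
  fixes f :: "'i \<Rightarrow> real \<Rightarrow> real"
  assumes "CF (Suc k) I f"
  obtains f' where "\<And>i x. i \<in> I \<Longrightarrow> (f i has_real_derivative f' i x) (at x)" "CF k I f'"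
proof -
  obtain w' where
    w: "\<And>i p. i \<in> I \<Longrightarrow> (f i has_derivative (\<lambda>h. \<Sum>b\<in>Basis. (h \<bullet> b) * w' b i p)) (at p)"
    "\<And>b. b \<in> Basis \<Longrightarrow> CF k I (w' b)"
    using assms by (rule CF_SucE) blast
  show ?thesis
  proof (rule that[of "w' 1"])
    show "(f i has_real_derivative w' 1 i x) (at x)" if "i \<in> I" for i x
      using w(1)[OF that, of x] by (simp add: has_field_derivative_def mult_commute_abs)
  qed (use w(2) in auto)
qed

text \<open>Continuity of one partial derivative turns the existence of both into a total
  derivative. The derivative in the second variable is packaged as a bounded linear map because
  \<open>has_derivative_partialsI\<close> asks for continuity in that form.\<close>

lemma has_derivative_prod_partials:
  fixes w :: "real \<times> real \<Rightarrow> real"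
  assumes "\<And>t x. ((\<lambda>r. w (r, x)) has_real_derivative wt (t, x)) (at t)"
    "\<And>t x. ((\<lambda>r. w (t, r)) has_real_derivative wx (t, x)) (at x)"
    and c: "continuous_on UNIV wx"
  shows "(w has_derivative (\<lambda>h. \<Sum>b\<in>Basis. (h \<bullet> b) * (if b = (1, 0) then wt p else wx p))) (at p)"
proof -
  obtain t x where p: "p = (t, x)" by (cases p)
  define fy where "fy = (\<lambda>a b. blinfun_scaleR_left (wx (a, b)) :: real \<Rightarrow>\<^sub>L real)"
  have ev: "blinfun_apply (fy a b) = (\<lambda>h. h * wx (a, b))" for a b
    unfolding fy_def by auto
  have "((\<lambda>(x, y). w (x, y)) has_derivative (\<lambda>(tx, ty). tx * wt (t, x) + blinfun_apply (fy t x) ty)) (at (t, x) within UNIV \<times> UNIV)"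
  proof (rule has_derivative_partialsI)
    show "((\<lambda>y. w (y, x)) has_derivative (\<lambda>tx. tx * wt (t, x))) (at t)"
      using assms(1)[of x t] by (simp add: has_field_derivative_def mult_commute_abs)
    show "((\<lambda>y. w (a, y)) has_derivative blinfun_apply (fy a b)) (at b)" for a b
      using assms(2)[of a b] by (simp add: has_field_derivative_def ev mult_commute_abs)
    have "continuous_on UNIV (\<lambda>(a, b). fy a b)"
      unfolding fy_def split_beta by (intro continuous_intros c[THEN continuous_on_compose2]) auto
    then show "continuous (at (t, x) within UNIV \<times> UNIV) (\<lambda>(x, y). fy x y)"
      by (simp add: continuous_on_eq_continuous_within)
  qed auto
  moreover have "(\<lambda>(tx, ty). tx * wt (t, x) + blinfun_apply (fy t x) ty) =
     (\<lambda>h. \<Sum>b\<in>Basis. (h \<bullet> b) * (if b = (1, 0) then wt p else wx p))"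
    by (auto simp: Basis_real_prod ev p)
  ultimately show ?thesis
    by (simp add: p case_prod_eta)
qed

lemma CF_prod_SucI:
  fixes w :: "'i \<Rightarrow> real \<times> real \<Rightarrow> real"
  assumes "locally_bdd I w"
    "\<And>i t x. i \<in> I \<Longrightarrow> ((\<lambda>r. w i (r, x)) has_real_derivative wt i (t, x)) (at t)"
    "\<And>i t x. i \<in> I \<Longrightarrow> ((\<lambda>r. w i (t, r)) has_real_derivative wx i (t, x)) (at x)"
    "CF k I wt" "CF k I wx"
  shows "CF (Suc k) I w"
  unfolding CF.simps
proof (intro conjI exI[of _ "\<lambda>b. if b = (1, 0) then wt else wx"] assms(1) ballI allI)
  fix i p assume "i \<in> I"
  then show "(w i has_derivative (\<lambda>h. \<Sum>b\<in>Basis. h \<bullet> b * (if b = (1, 0) then wt else wx) i p)) (at p)"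
    using has_derivative_prod_partials[of "w i" "wt i" "wx i" p] assms CF_continuous[OF assms(5)]
    by (simp add: if_distribR cong: if_cong)
qed (use assms in auto)

lemma CF_prod_SucE:
  fixes w :: "'i \<Rightarrow> real \<times> real \<Rightarrow> real"
  assumes "CF (Suc k) I w"
  obtains wt wx where
    "\<And>i t x. i \<in> I \<Longrightarrow> ((\<lambda>r. w i (r, x)) has_real_derivative wt i (t, x)) (at t)"
    "\<And>i t x. i \<in> I \<Longrightarrow> ((\<lambda>r. w i (t, r)) has_real_derivative wx i (t, x)) (at x)"
    "CF k I wt" "CF k I wx"
proof -
  obtain w' where
    w: "\<And>i p. i \<in> I \<Longrightarrow> (w i has_derivative (\<lambda>h. \<Sum>b\<in>Basis. (h \<bullet> b) * w' b i p)) (at p)"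
    "\<And>b. b \<in> Basis \<Longrightarrow> CF k I (w' b)"
    using assms by (rule CF_SucE) blast
  show ?thesis
  proof (rule that[of "w' (1, 0)" "w' (0, 1)"])
    fix i and t x :: real assume i: "i \<in> I"
    have "((\<lambda>r. (r, x)) has_derivative (\<lambda>h. (h, 0))) (at t)"
      by (auto intro!: derivative_eq_intros)
    from has_derivative_compose[OF this w(1)[OF i, of "(t, x)"]]
    show "((\<lambda>r. w i (r, x)) has_real_derivative w' (1, 0) i (t, x)) (at t)"
      by (simp add: has_field_derivative_def Basis_real_prod mult_commute_abs)
    have "((\<lambda>r. (t, r)) has_derivative (\<lambda>h. (0, h))) (at x)"
      by (auto intro!: derivative_eq_intros)
    from has_derivative_compose[OF this w(1)[OF i, of "(t, x)"]]
    show "((\<lambda>r. w i (t, r)) has_real_derivative w' (0, 1) i (t, x)) (at x)"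
      by (simp add: has_field_derivative_def Basis_real_prod mult_commute_abs)
  qed (auto intro!: w(2) simp: Basis_prod_def)
qed

lemma CF_comp1:
  fixes f :: "'i \<Rightarrow> real \<Rightarrow> real"
  shows "CF k I f \<Longrightarrow> CF k I z \<Longrightarrow> CF k I (\<lambda>i p. f i (z i p))"
  by (rule CF_compose) auto

lemma CF_comp2:
  fixes w :: "'i \<Rightarrow> real \<times> real \<Rightarrow> real"
  shows "CF k I w \<Longrightarrow> CF k I y \<Longrightarrow> CF k I z \<Longrightarrow> CF k I (\<lambda>i p. w i (y i p, z i p))"
  by (rule CF_compose) (auto simp: Basis_prod_def)

lemma has_derivative_real_comp:
  assumes "(w has_derivative (\<lambda>h. \<Sum>b\<in>Basis. (h \<bullet> b) * w' b)) (at p)"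
    "(f has_real_derivative d) (at (w p))"
  shows "((\<lambda>p. f (w p)) has_derivative (\<lambda>h. \<Sum>b\<in>Basis. (h \<bullet> b) * (d * w' b))) (at p)"
  using has_derivative_compose[OF assms(1) assms(2)[unfolded has_field_derivative_def]]
  by (simp add: sum_distrib_left algebra_simps)

text \<open>The lower bound 1 keeps the values away from the pole uniformly over the family. The
  derivative is again built from \<open>inverse w\<close>, so the induction hypothesis bounds
  it.\<close>

lemma CF_inverse:
  assumes "CF k I w" "\<And>i p. i \<in> I \<Longrightarrow> w i p \<ge> 1"
  shows "CF k I (\<lambda>i p. inverse (w i p))"
  using assms
proof (induction k)
  have lb: "locally_bdd I (\<lambda>i p. inverse (w i p))"
    unfolding locally_bdd_def
  proof (intro allI exI[of _ 1] ballI impI)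
    fix i p assume "i \<in> I"
    from assms(2)[OF this, of p] show "\<bar>inverse (w i p)\<bar> \<le> 1"
      by (simp add: inverse_le_1_iff)
  qed
  {
    case 0
    have "w i p \<noteq> 0" if "i \<in> I" for i p
      using 0(2)[OF that, of p] by auto
    then show ?case
      using lb 0(1) by (auto intro!: continuous_intros)
  next
    case (Suc k)
    from Suc.prems(1) obtain w' where
      w: "\<And>i p. i \<in> I \<Longrightarrow> (w i has_derivative (\<lambda>h. \<Sum>b\<in>Basis. (h \<bullet> b) * w' b i p)) (at p)"
      "\<And>b. b \<in> Basis \<Longrightarrow> CF k I (w' b)"
      by (rule CF_SucE) blast
    have IH: "CF k I (\<lambda>i p. inverse (w i p))"
      using Suc.prems CF_Suc_D by (intro Suc.IH) blast+
    show ?case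
      unfolding CF.simps
    proof (intro conjI exI[of _ "\<lambda>b i p. (- (inverse (w i p) * inverse (w i p))) * w' b i p"] lb ballI allI)
      fix i p assume i: "i \<in> I"
      have "w i p \<noteq> 0"
        using Suc.prems(2)[OF i, of p] by auto
      then have "(inverse has_real_derivative - (inverse (w i p) * inverse (w i p))) (at (w i p))"
        by (auto intro!: derivative_eq_intros)
      from has_derivative_real_comp[OF w(1)[OF i] this]
      show "((\<lambda>p. inverse (w i p)) has_derivative (\<lambda>h. \<Sum>b\<in>Basis. (h \<bullet> b) * (- (inverse (w i p) * inverse (w i p)) * w' b i p))) (at p)" .
    qed (intro CF_mult CF_minus IH w)
  }
qed

text \<open>The cube root is smooth only away from 0, whence the lower bound. Its derivative is
  written as a third of \<open>root 3 w * inverse w\<close>, a product of functions that are already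
  controlled at order k.\<close>

lemma CF_cbrt:
  assumes "CF k I w" "\<And>i p. i \<in> I \<Longrightarrow> w i p \<ge> 1"
  shows "CF k I (\<lambda>i p. root 3 (w i p))"
  using assms
proof (induction k)
  have lb: "locally_bdd I (\<lambda>i p. root 3 (w i p))"
    unfolding locally_bdd_def
  proof
    fix R
    from CF_locally_bdd[OF assms(1)] obtain M where M: "\<And>i p. i \<in> I \<Longrightarrow> norm p \<le> R \<Longrightarrow> \<bar>w i p\<bar> \<le> M"
      by (metis locally_bddD)
    have "\<bar>root 3 (w i p)\<bar> \<le> root 3 M" if "i \<in> I" "norm p \<le> R" for i p
      using M[OF that] by (simp flip: real_root_abs)
    then show "\<exists>M. \<forall>i\<in>I. \<forall>p. norm p \<le> R \<longrightarrow> \<bar>root 3 (w i p)\<bar> \<le> M"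
      by blast
  qed
  {
    case 0
    have "w i p \<noteq> 0" if "i \<in> I" for i p
      using 0(2)[OF that, of p] by auto
    then show ?case
      using lb 0(1) by (auto intro!: continuous_intros)
  next
    case (Suc k)
    from Suc.prems(1) obtain w' where
      w: "\<And>i p. i \<in> I \<Longrightarrow> (w i has_derivative (\<lambda>h. \<Sum>b\<in>Basis. (h \<bullet> b) * w' b i p)) (at p)"
      "\<And>b. b \<in> Basis \<Longrightarrow> CF k I (w' b)"
      by (rule CF_SucE) blast
    have k: "CF k I w"
      using Suc.prems CF_Suc_D by blast
    have IH: "CF k I (\<lambda>i p. root 3 (w i p))"
      using Suc.prems k by (intro Suc.IH)
    show ?case
      unfolding CF.simps
    proof (intro conjI exI[of _ "\<lambda>b i p. (1/3 * (root 3 (w i p) * inverse (w i p))) * w' b i p"] lb ballI allI)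
      fix i p assume i: "i \<in> I"
      have pos: "w i p > 0"
        using Suc.prems(2)[OF i, of p] by auto
      have "root 3 (w i p) ^ 3 = w i p"
        by (rule odd_real_root_pow) auto
      then have "inverse (3 * root 3 (w i p) ^ 2) = 1/3 * (root 3 (w i p) * inverse (w i p))"
        using pos by (simp add: field_simps power2_eq_square power3_eq_cube)
      then have "(root 3 has_real_derivative 1/3 * (root 3 (w i p) * inverse (w i p))) (at (w i p))"
        using DERIV_real_root[of 3 "w i p"] pos by simp
      from has_derivative_real_comp[OF w(1)[OF i] this]
      show "((\<lambda>p. root 3 (w i p)) has_derivative (\<lambda>h. \<Sum>b\<in>Basis. (h \<bullet> b) * (1/3 * (root 3 (w i p) * inverse (w i p)) * w' b i p))) (at p)" .
    qed (intro CF_mult CF_const IH w CF_inverse k Suc.prems(2); assumption)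
  }
qed

section \<open>Antiderivatives and their dependence on parameters\<close>

text \<open>The integral of f from 0 to t, for t of either sign, rescaled to the fixed interval
  [0, 1]. No oriented integrals are needed, and parameters can be differentiated under the integral
  sign.\<close>

definition anti :: "(real \<Rightarrow> real) \<Rightarrow> real \<Rightarrow> real" where
  "anti f t = t * integral {0..1} (\<lambda>r. f (t * r))"

lemma anti_0 [simp]: "anti f 0 = 0"
  by (simp add: anti_def)

text \<open>The fundamental theorem of calculus for \<open>r \<mapsto> F (t * r)\<close> on [0, 1].
  The window is symmetric so that it contains \<open>t * r\<close> for all these r.\<close>

lemma anti_local_unique:
  assumes "\<And>t. t \<in> {-K..K} \<Longrightarrow> (F has_real_derivative f t) (at t within {-K..K})" "t \<in> {-K..K}"
  shows "anti f t = F t - F 0"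
proof -
  have "((\<lambda>r. t * f (t * r)) has_integral F (t * 1) - F (t * 0)) {0..1}"
  proof (rule fundamental_theorem_of_calculus)
    fix r :: real assume r: "r \<in> {0..1}"
    have im: "(\<lambda>r. t * r) ` {0..1} \<subseteq> {-K..K}"
    proof clarsimp
      fix r :: real assume "0 \<le> r" "r \<le> 1"
      then have "\<bar>t * r\<bar> \<le> \<bar>t\<bar>" by (simp add: abs_mult mult_left_le)
      then show "- K \<le> t * r \<and> t * r \<le> K" using assms(2) by auto
    qed
    have "((\<lambda>r. F (t * r)) has_real_derivative f (t * r) * t) (at r within {0..1})"
    proof -
      have "(F has_real_derivative f (t * r)) (at (t * r) within (*) t ` {0..1})"
        by (rule DERIV_subset[OF assms(1)[OF subsetD[OF im imageI[OF r]]] im])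
      moreover have "((\<lambda>r. t * r) has_real_derivative t) (at r within {0..1})"
        by (auto intro!: derivative_eq_intros)
      ultimately show ?thesis
        using DERIV_image_chain[of F "f (t * r)" "(*) t" r "{0..1}" t] by (simp add: o_def)
    qed
    then show "((\<lambda>r. F (t * r)) has_vector_derivative t * f (t * r)) (at r within {0..1})"
      by (simp add: has_real_derivative_iff_has_vector_derivative mult.commute)
  qed auto
  then show ?thesis
    unfolding anti_def by (simp flip: integral_mult_right add: integral_unique)
qed

lemma anti_has_derivative:
  assumes "continuous_on UNIV f"
  shows "(anti f has_real_derivative f t) (at t)"
proof -
  define K where "K = \<bar>t\<bar> + 1"
  obtain F where F: "\<And>s. s \<in> {-K..K} \<Longrightarrow> (F has_real_derivative f s) (at s within {-K..K})"
    using antiderivative_continuous[OF continuous_on_subset[OF assms, of "{-K..K}"]]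
    by (auto simp: has_real_derivative_iff_has_vector_derivative)
  have t: "t \<in> {-K<..<K}"
    unfolding K_def by auto
  have "((\<lambda>s. F s - F 0) has_real_derivative f t) (at t within {-K..K})"
    using F[of t] t by (auto intro!: derivative_eq_intros)
  moreover have "anti f s = F s - F 0" if "s \<in> {-K..K}" for s
    by (rule anti_local_unique[OF F that])
  ultimately have "(anti f has_real_derivative f t) (at t within {-K..K})"
    using t by (subst has_field_derivative_cong_eventually[where g = "\<lambda>s. F s - F 0"])
      (auto simp: eventually_at_filter)
  then show ?thesis
    using t at_within_Icc_at[of "-K" t K] by simp
qed

lemma anti_bound:
  assumes "continuous_on UNIV f" "\<And>s. \<bar>s\<bar> \<le> \<bar>t\<bar> \<Longrightarrow> \<bar>f s\<bar> \<le> M"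
  shows "\<bar>anti f t\<bar> \<le> \<bar>t\<bar> * M"
proof -
  have "norm (integral {0..1} (\<lambda>r. f (t * r))) \<le> M * (1 - 0)"
  proof (rule integral_bound)
    show "continuous_on {0..1} (\<lambda>r. f (t * r))"
      by (intro continuous_intros continuous_on_compose2[OF assms(1)]) auto
    show "norm (f (t * r)) \<le> M" if "r \<in> {0..1}" for r
      using assms(2)[of "t * r"] that by (simp add: abs_mult mult_left_le)
  qed auto
  then show ?thesis
    by (simp add: anti_def abs_mult mult_left_mono)
qed

lemma CF_anti:
  fixes f :: "'i \<Rightarrow> real \<Rightarrow> real"
  assumes "CF k I f" shows "CF (Suc k) I (\<lambda>i. anti (f i))"
proof (rule CF_real_SucI[OF _ _ assms])
  show "(anti (f i) has_real_derivative f i x) (at x)" if "i \<in> I" for i x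
    using anti_has_derivative CF_continuous[OF assms that] by blast
  show "locally_bdd I (\<lambda>i. anti (f i))"
    unfolding locally_bdd_def
  proof
    fix R
    from CF_locally_bdd[OF assms] obtain M where M: "M > 0" "\<And>i p. i \<in> I \<Longrightarrow> norm p \<le> R \<Longrightarrow> \<bar>f i p\<bar> \<le> M"
      by (metis locally_bddD)
    have "\<bar>anti (f i) p\<bar> \<le> R * M" if "i \<in> I" "norm p \<le> R" for i p
    proof -
      have "\<bar>anti (f i) p\<bar> \<le> \<bar>p\<bar> * M"
        by (rule anti_bound[OF CF_continuous[OF assms that(1)]]) (use M that in auto)
      also have "\<dots> \<le> R * M"
        using that M by (auto intro: mult_right_mono)
      finally show ?thesis .
    qed
    then show "\<exists>M. \<forall>i\<in>I. \<forall>p. norm p \<le> R \<longrightarrow> \<bar>anti (f i) p\<bar> \<le> M"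
      by blast
  qed
qed

lemma anti_param_has_derivative:
  fixes w :: "real \<times> real \<Rightarrow> real"
  assumes "continuous_on UNIV w" "continuous_on UNIV wx"
    "\<And>t x. ((\<lambda>r. w (t, r)) has_real_derivative wx (t, x)) (at x)"
  shows "((\<lambda>y. anti (\<lambda>r. w (r, y)) t) has_real_derivative anti (\<lambda>r. wx (r, x)) t) (at x)"
proof -
  have "((\<lambda>y. integral (cbox 0 1) (\<lambda>r. w (t * r, y))) has_real_derivative
      integral (cbox 0 1) (\<lambda>r. wx (t * r, x))) (at x within UNIV)"
  proof (rule leibniz_rule_field_derivative)
    show "(\<lambda>r. w (t * r, y)) integrable_on cbox 0 1" for y
      by (intro integrable_continuous continuous_intros continuous_on_compose2[OF assms(1)]) auto
    show "continuous_on (UNIV \<times> cbox 0 1) (\<lambda>(y, r). wx (t * r, y))"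
      unfolding split_beta
      by (intro continuous_intros continuous_on_compose2[OF assms(2)]) auto
  qed (use assms(3) in auto)
  from DERIV_cmult[OF this, of t] show ?thesis
    by (simp add: anti_def)
qed

text \<open>Integration in one variable gains nothing in the other, so the order stays k. The
  derivative in the first variable is w itself, and the one in the second is the same operation
  applied to the second partial derivative of w.\<close>

lemma CF_anti_fst:
  fixes w :: "'i \<Rightarrow> real \<times> real \<Rightarrow> real"
  assumes "CF k I w" shows "CF k I (\<lambda>i p. anti (\<lambda>r. w i (r, snd p)) (fst p))"
  using assms
proof (induction k arbitrary: w)
  have lb: "locally_bdd I (\<lambda>i p. anti (\<lambda>r. w i (r, snd p)) (fst p))" if w: "CF 0 I w" for w :: "'i \<Rightarrow> real \<times> real \<Rightarrow> real"
    unfolding locally_bdd_def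
  proof
    fix R
    from CF_locally_bdd[OF w] obtain M where M: "M > 0" "\<And>i p. i \<in> I \<Longrightarrow> norm p \<le> R \<Longrightarrow> \<bar>w i p\<bar> \<le> M"
      by (metis locally_bddD)
    have "\<bar>anti (\<lambda>r. w i (r, snd p)) (fst p)\<bar> \<le> R * M" if "i \<in> I" "norm p \<le> R" for i p
    proof -
      have "\<bar>anti (\<lambda>r. w i (r, snd p)) (fst p)\<bar> \<le> \<bar>fst p\<bar> * M"
      proof (rule anti_bound)
        show "continuous_on UNIV (\<lambda>r. w i (r, snd p))"
          by (intro continuous_intros continuous_on_compose2[OF CF_continuous[OF w that(1)]]) auto
        fix s assume "\<bar>s\<bar> \<le> \<bar>fst p\<bar>"
        then have "norm (s, snd p) \<le> norm p"
          by (cases p) (auto simp: norm_Pair abs_le_square_iff)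
        then show "\<bar>w i (s, snd p)\<bar> \<le> M"
          using M that by auto
      qed
      also have "\<dots> \<le> R * M"
        using norm_fst_le[of "fst p" "snd p"] that M by (auto intro!: mult_right_mono)
      finally show ?thesis .
    qed
    then show "\<exists>M. \<forall>i\<in>I. \<forall>p. norm p \<le> R \<longrightarrow> \<bar>anti (\<lambda>r. w i (r, snd p)) (fst p)\<bar> \<le> M"
      by blast
  qed
  {
    case 0
    have "continuous_on UNIV (\<lambda>p. anti (\<lambda>r. w i (r, snd p)) (fst p))" if "i \<in> I" for i
    proof -
      have "continuous_on (UNIV \<times> cbox 0 1) (\<lambda>(p, r). w i (fst p * r, snd p))"
        unfolding split_beta
        by (intro continuous_intros continuous_on_compose2[OF CF_continuous[OF 0 that, of UNIV]]) auto
      from integral_continuous_on_param[OF this] show ?thesis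
        unfolding anti_def by (auto intro!: continuous_intros)
    qed
    then show ?case
      using lb[OF 0] by simp
  next
    case (Suc k)
    from Suc.prems obtain wt wx where
      w: "\<And>i t x. i \<in> I \<Longrightarrow> ((\<lambda>r. w i (r, x)) has_real_derivative wt i (t, x)) (at t)"
      "\<And>i t x. i \<in> I \<Longrightarrow> ((\<lambda>r. w i (t, r)) has_real_derivative wx i (t, x)) (at x)"
      "CF k I wt" "CF k I wx"
      by (rule CF_prod_SucE) blast
    show ?case
    proof (rule CF_prod_SucI[OF _ _ _ CF_Suc_D[OF Suc.prems] Suc.IH[OF w(4)]])
      show "locally_bdd I (\<lambda>i p. anti (\<lambda>r. w i (r, snd p)) (fst p))"
        using Suc.prems CF_mono by (intro lb) blast
      fix i and t x :: real assume i: "i \<in> I"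
      have c: "continuous_on UNIV (\<lambda>r. w i (r, x))"
        by (intro continuous_intros continuous_on_compose2[OF CF_continuous[OF Suc.prems i, of UNIV]]) auto
      from anti_has_derivative[OF c]
      show "((\<lambda>r. anti (\<lambda>ra. w i (ra, snd (r, x))) (fst (r, x))) has_real_derivative w i (t, x)) (at t)"
        by simp
      show "((\<lambda>r. anti (\<lambda>ra. w i (ra, snd (t, r))) (fst (t, r))) has_real_derivative
          anti (\<lambda>r. wx i (r, snd (t, x))) (fst (t, x))) (at x)"
        using anti_param_has_derivative[OF CF_continuous[OF Suc.prems i] CF_continuous[OF w(4) i] w(2)[OF i]]
        by simp
    qed
  }
qed

lemma CF_anti_snd:
  fixes w :: "'i \<Rightarrow> real \<times> real \<Rightarrow> real"
  assumes "CF k I w" shows "CF k I (\<lambda>i p. anti (\<lambda>r. w i (fst p, r)) (snd p))"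
proof -
  have "CF k I (\<lambda>i p. w i (snd p, fst p))"
    by (intro CF_comp2 assms CF_fst CF_snd)
  from CF_comp2[OF CF_anti_fst[OF this] CF_snd CF_fst] show ?thesis
    by simp
qed

section \<open>Cut-off functions\<close>

text \<open>Pulling back along a map of index sets. With the one-point type as source of indices, a
  single function can enter every family.\<close>

lemma CF_reindex:
  fixes w :: "'j \<Rightarrow> 'a::euclidean_space \<Rightarrow> real"
  assumes "CF k J w" "\<And>i. i \<in> I \<Longrightarrow> g i \<in> J" shows "CF k I (\<lambda>i. w (g i))"
  using assms(1)
proof (induction k arbitrary: w)
  have lb: "locally_bdd J w \<Longrightarrow> locally_bdd I (\<lambda>i. w (g i))" for w :: "'j \<Rightarrow> 'a \<Rightarrow> real"
    using assms(2) unfolding locally_bdd_def by meson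
  {
    case 0
    then show ?case using lb assms(2) by auto
  next
    case (Suc k)
    from Suc.prems obtain w' where
      w: "\<And>i p. i \<in> J \<Longrightarrow> (w i has_derivative (\<lambda>h. \<Sum>b\<in>Basis. (h \<bullet> b) * w' b i p)) (at p)"
      "\<And>b. b \<in> Basis \<Longrightarrow> CF k J (w' b)" "locally_bdd J w"
      by (rule CF_SucE) blast
    show ?case
      unfolding CF.simps
      by (intro conjI exI[of _ "\<lambda>b i. w' b (g i)"] ballI allI lb w Suc.IH assms(2))
  }
qed

abbreviation smooth :: "nat \<Rightarrow> ('a::euclidean_space \<Rightarrow> real) \<Rightarrow> bool" where
  "smooth k f \<equiv> CF k (UNIV :: unit set) (\<lambda>_. f)"

lemma CF_smooth: "smooth k f \<Longrightarrow> CF k I (\<lambda>i. f)"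
  using CF_reindex[of k UNIV "\<lambda>_. f" I "\<lambda>_. ()"] by simp

lemma CF_smooth_comp:
  fixes f :: "real \<Rightarrow> real"
  shows "smooth k f \<Longrightarrow> CF k I z \<Longrightarrow> CF k I (\<lambda>i p. f (z i p))"
  by (rule CF_comp1) (rule CF_smooth)

lemma DERIV_zero_const:
  fixes F :: "real \<Rightarrow> real"
  assumes "x \<le> y" "\<And>z. x \<le> z \<Longrightarrow> z \<le> y \<Longrightarrow> (F has_real_derivative 0) (at z)"
  shows "F x = F y"
proof (cases "x = y")
  case False
  have "F y = F x"
  proof (rule DERIV_isconst_end[where f = F])
    show "continuous_on {x..y} F"
      using assms(2) by (auto intro: DERIV_atLeastAtMost_imp_continuous_on)
  qed (use False assms in auto)
  then show ?thesis by simp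
qed simp

lemma anti_eq_0:
  assumes "\<And>y. y \<le> 0 \<Longrightarrow> f y = 0" "t \<le> 0" shows "anti f t = 0"
proof -
  have "integral {0..1} (\<lambda>r. f (t * r)) = integral {0..1} (\<lambda>r::real. 0::real)"
    by (rule integral_cong) (use assms in \<open>auto intro!: assms(1) simp: mult_nonpos_nonneg\<close>)
  then show ?thesis
    by (simp add: anti_def)
qed

text \<open>Each antiderivative of \<open>max 0\<close> gains one order, still vanishes on the left,
  and is positive on the right because it increases there.\<close>

lemma ex_smooth_pos:
  "\<exists>p :: real \<Rightarrow> real. smooth k p \<and> (\<forall>y\<le>0. p y = 0) \<and> (\<forall>y>0. p y > 0)"
proof (induction k)
  case 0
  have "continuous_on UNIV (\<lambda>y::real. max 0 y)"
    by (intro continuous_intros)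
  then show ?case
    by (intro exI[of _ "max 0 :: real \<Rightarrow> real"]) (auto simp: locally_bdd_const)
next
  case (Suc k)
  then obtain p :: "real \<Rightarrow> real" where "smooth k p \<and> (\<forall>y\<le>0. p y = 0) \<and> (\<forall>y>0. p y > 0)" ..
  then have p: "smooth k p" "\<And>y. y \<le> 0 \<Longrightarrow> p y = 0" "\<And>y. y > 0 \<Longrightarrow> p y > 0"
    by auto
  have c: "continuous_on UNIV p"
    using CF_continuous[OF p(1)] by auto
  have "anti p y > 0" if "y > 0" for y
  proof -
    have "anti p 0 < anti p y"
    proof (rule DERIV_pos_imp_increasing_open[where f = "anti p"])
      show "continuous_on {0..y} (anti p)"
        using anti_has_derivative[OF c] by (auto intro: DERIV_atLeastAtMost_imp_continuous_on)
    qed (use that p(3) anti_has_derivative[OF c] in blast)+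
    then show ?thesis by simp
  qed
  then show ?case
    using CF_anti[OF p(1)] anti_eq_0[of p] p(2) by (intro exI[of _ "anti p"]) auto
qed

text \<open>The transition is the integral of the cube of a bump, divided by its mass. It is not an
  arbitrary cut-off because its derivative becomes a factor of the source, which has to be a
  cube.\<close>

lemma ex_smooth_step:
  obtains \<beta> S :: "real \<Rightarrow> real" where "smooth k \<beta>" "smooth k S"
    "\<And>y. (S has_real_derivative \<beta> y ^ 3) (at y)"
    "\<And>y. y \<le> 0 \<or> y \<ge> 1 \<Longrightarrow> \<beta> y = 0"
    "\<And>y. y \<le> 0 \<Longrightarrow> S y = 0" "\<And>y. y \<ge> 1 \<Longrightarrow> S y = 1" "\<And>y. 0 \<le> S y" "\<And>y. S y \<le> 1"
proof -
  obtain p :: "real \<Rightarrow> real" where "smooth k p \<and> (\<forall>y\<le>0. p y = 0) \<and> (\<forall>y>0. p y > 0)"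
    using ex_smooth_pos ..
  then have p: "smooth k p" "\<And>y. y \<le> 0 \<Longrightarrow> p y = 0" "\<And>y. y > 0 \<Longrightarrow> p y > 0"
    by auto
  have pnn: "p y \<ge> 0" for y
    using p(2)[of y] p(3)[of y] by (cases "y > 0") auto
  define \<gamma> where "\<gamma> = (\<lambda>y. p y * p (1 - y))"
  have g: "smooth k \<gamma>"
    unfolding \<gamma>_def
    by (intro CF_mult p(1) CF_comp1[OF p(1)] CF_diff CF_const CF_ident)
  have g3: "smooth k (\<lambda>y. \<gamma> y ^ 3)"
    by (intro CF_power g)
  have c: "continuous_on UNIV (\<lambda>y. \<gamma> y ^ 3)"
    using CF_continuous[OF g3] by auto
  define m where "m = anti (\<lambda>y. \<gamma> y ^ 3) 1"
  have "anti (\<lambda>y. \<gamma> y ^ 3) 0 < anti (\<lambda>y. \<gamma> y ^ 3) 1"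
  proof (rule DERIV_pos_imp_increasing_open[where f = "anti (\<lambda>y. \<gamma> y ^ 3)"])
    fix y :: real assume "0 < y" "y < 1"
    then show "\<exists>z. (anti (\<lambda>y. \<gamma> y ^ 3) has_real_derivative z) (at y) \<and> z > 0"
      using anti_has_derivative[OF c, of y] p(3)[of y] p(3)[of "1 - y"] by (auto simp: \<gamma>_def)
  next
    show "continuous_on {0..1} (anti (\<lambda>y. \<gamma> y ^ 3))"
      using anti_has_derivative[OF c] by (auto intro: DERIV_atLeastAtMost_imp_continuous_on)
  qed simp
  then have m: "m > 0"
    by (simp add: m_def)
  \<comment> \<open>Dividing the bump by the cube root of the mass m divides its cube by m, as the
    normalisation of \<open>S\<close> requires.\<close>
  define \<beta> where "\<beta> = (\<lambda>y. \<gamma> y * (1 / root 3 m))"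
  define S where "S = (\<lambda>y. anti (\<lambda>y. \<gamma> y ^ 3) y * (1 / m))"
  have S: "(S has_real_derivative \<beta> y ^ 3) (at y)" for y
  proof -
    have "(S has_real_derivative \<gamma> y ^ 3 * (1 / m)) (at y)"
      unfolding S_def by (rule DERIV_cmult_right[OF anti_has_derivative[OF c]])
    moreover have "\<gamma> y ^ 3 * (1 / m) = \<beta> y ^ 3"
      using odd_real_root_pow[of 3 m] by (simp add: \<beta>_def power_mult_distrib power_divide)
    ultimately show ?thesis by simp
  qed
  have b0: "\<beta> y = 0" if "y \<le> 0 \<or> y \<ge> 1" for y
    using that p(2)[of y] p(2)[of "1 - y"] by (auto simp: \<beta>_def \<gamma>_def)
  have bnn: "\<beta> y ^ 3 \<ge> 0" for y
    using pnn m by (simp add: \<beta>_def \<gamma>_def)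
  have S0: "S y = 0" if "y \<le> 0" for y
    unfolding S_def using that by (subst anti_eq_0) (auto simp: \<gamma>_def p)
  have S1: "S y = 1" if "y \<ge> 1" for y
  proof -
    have "S 1 = S y"
      by (rule DERIV_zero_const) (use that S b0 in \<open>auto intro: DERIV_cong[OF S]\<close>)
    then show ?thesis
      using m by (simp add: S_def m_def)
  qed
  have mono: "S x \<le> S y" if "x \<le> y" for x y
    by (rule DERIV_nonneg_imp_nondecreasing[OF that]) (use S bnn in blast)
  have "0 \<le> S y" "S y \<le> 1" for y
    using mono[of "min y 0" y] mono[of y "max y 1"] S0[of "min y 0"] S1[of "max y 1"] by auto
  moreover have "smooth k \<beta>"
    unfolding \<beta>_def by (intro CF_mult g CF_const)
  moreover have "smooth k S"
    unfolding S_def by (intro CF_mult CF_const CF_Suc_D[OF CF_anti[OF g3]])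
  ultimately show ?thesis
    by (intro that[of \<beta> S] S b0 S0 S1) auto
qed

text \<open>The profile \<open>\<alpha>\<close> must change sign, because its cube is to have a compactly supported antiderivative.\<close>

lemma ex_smooth_sign_changing:
  obtains \<alpha> A :: "real \<Rightarrow> real" where "smooth k \<alpha>" "smooth k A"
    "\<And>y. (A has_real_derivative \<alpha> y ^ 3) (at y)"
    "\<And>y. y \<le> -1 \<or> y \<ge> 7 \<Longrightarrow> \<alpha> y = 0" "\<And>y. y \<le> -1 \<or> y \<ge> 7 \<Longrightarrow> A y = 0"
    "\<And>y. 0 \<le> y \<Longrightarrow> y \<le> 2 \<Longrightarrow> \<alpha> y = 1"
proof -
  obtain \<beta> S :: "real \<Rightarrow> real" where S: "smooth k S"
    "\<And>y. y \<le> 0 \<Longrightarrow> S y = 0" "\<And>y. y \<ge> 1 \<Longrightarrow> S y = 1"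
    by (rule ex_smooth_step) blast
  \<comment> \<open>\<open>a\<close> equals 1 on [0, 2] and lives on [-1, 3]. Its copy shifted by 4
    lives on [3, 7], so the supports only touch, the cube of the difference is the difference of the
    cubes, and the total integral is 0.\<close>
  define a where "a = (\<lambda>y. S (y + 1) * S (3 - y))"
  define \<alpha> where "\<alpha> = (\<lambda>y. a y - a (y - 4))"
  define B where "B = anti (\<lambda>y. a y ^ 3)"
  define A where "A = (\<lambda>y. B y - B (y - 4))"
  have a: "smooth k a"
    unfolding a_def by (intro CF_mult CF_comp1[OF S(1)] CF_add CF_diff CF_const CF_ident)
  have a3: "smooth k (\<lambda>y. a y ^ 3)"
    by (intro CF_power a)
  have B: "smooth k B"
    unfolding B_def by (rule CF_Suc_D[OF CF_anti[OF a3]])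
  have B': "(B has_real_derivative a y ^ 3) (at y)" for y
    unfolding B_def using anti_has_derivative CF_continuous[OF a3] by blast
  have a0: "a y = 0" if "y \<le> -1 \<or> y \<ge> 3" for y
    using that by (auto simp: a_def S)
  have Bc: "B x = B y" if "x \<le> y" "y \<le> -1 \<or> x \<ge> 3" for x y
    by (rule DERIV_zero_const[OF that(1)], rule DERIV_cong[OF B']) (use that a0 in auto)
  have disj: "(a y - a (y - 4)) ^ 3 = a y ^ 3 - a (y - 4) ^ 3" for y
    using a0[of y] a0[of "y - 4"] by (cases "y \<ge> 3") auto
  show ?thesis
  proof (rule that[of \<alpha> A])
    show "smooth k \<alpha>" "smooth k A"
      unfolding \<alpha>_def A_def by (intro CF_diff a B CF_comp1[OF a] CF_comp1[OF B] CF_const CF_ident)+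
    show "(A has_real_derivative \<alpha> y ^ 3) (at y)" for y
      unfolding A_def \<alpha>_def disj
      by (rule DERIV_diff[OF B']) (use DERIV_shift[of B "a (y - 4) ^ 3" y "-4"] B'[of "y - 4"] in simp)
    show "\<alpha> y = 0" if "y \<le> -1 \<or> y \<ge> 7" for y
      using that by (auto simp: \<alpha>_def a0)
    show "A y = 0" if "y \<le> -1 \<or> y \<ge> 7" for y
      using that Bc[of "y - 4" y] by (auto simp: A_def)
    show "\<alpha> y = 1" if "0 \<le> y" "y \<le> 2" for y
      using that by (simp add: \<alpha>_def a0) (simp add: a_def S)
  qed
qed

section \<open>Waves\<close>

text \<open>The wave equation on U with source s, stated through pure second derivatives. The
  derivatives are quantified inside so that sums and products can be treated without naming them;
  \<open>has_box_local\<close> identifies them afterwards.\<close>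

definition has_box :: "(real \<times> real) set \<Rightarrow> real \<Rightarrow> (real \<times> real \<Rightarrow> real) \<Rightarrow> (real \<times> real \<Rightarrow> real) \<Rightarrow> bool" where
  "has_box U \<nu> w s \<longleftrightarrow> (\<exists>wt wx wtt wxx. \<forall>t x. (t, x) \<in> U \<longrightarrow>
     ((\<lambda>r. w (r, x)) has_real_derivative wt (t, x)) (at t) \<and>
     ((\<lambda>r. wt (r, x)) has_real_derivative wtt (t, x)) (at t) \<and>
     ((\<lambda>r. w (t, r)) has_real_derivative wx (t, x)) (at x) \<and>
     ((\<lambda>r. wx (t, r)) has_real_derivative wxx (t, x)) (at x) \<and>
     wtt (t, x) - \<nu>\<^sup>2 * wxx (t, x) = s (t, x))"

lemma has_boxI:
  assumes "\<And>t x. (t, x) \<in> U \<Longrightarrow> ((\<lambda>r. w (r, x)) has_real_derivative wt (t, x)) (at t)"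
    "\<And>t x. (t, x) \<in> U \<Longrightarrow> ((\<lambda>r. wt (r, x)) has_real_derivative wtt (t, x)) (at t)"
    "\<And>t x. (t, x) \<in> U \<Longrightarrow> ((\<lambda>r. w (t, r)) has_real_derivative wx (t, x)) (at x)"
    "\<And>t x. (t, x) \<in> U \<Longrightarrow> ((\<lambda>r. wx (t, r)) has_real_derivative wxx (t, x)) (at x)"
    "\<And>t x. (t, x) \<in> U \<Longrightarrow> wtt (t, x) - \<nu>\<^sup>2 * wxx (t, x) = s (t, x)"
  shows "has_box U \<nu> w s"
  unfolding has_box_def using assms
  by (intro exI[of _ wt] exI[of _ wx] exI[of _ wtt] exI[of _ wxx]) simp

lemma has_boxE:
  assumes "has_box U \<nu> w s"
  obtains wt wx wtt wxx where "\<And>t x. (t, x) \<in> U \<Longrightarrow> ((\<lambda>r. w (r, x)) has_real_derivative wt (t, x)) (at t)"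
    "\<And>t x. (t, x) \<in> U \<Longrightarrow> ((\<lambda>r. wt (r, x)) has_real_derivative wtt (t, x)) (at t)"
    "\<And>t x. (t, x) \<in> U \<Longrightarrow> ((\<lambda>r. w (t, r)) has_real_derivative wx (t, x)) (at x)"
    "\<And>t x. (t, x) \<in> U \<Longrightarrow> ((\<lambda>r. wx (t, r)) has_real_derivative wxx (t, x)) (at x)"
    "\<And>t x. (t, x) \<in> U \<Longrightarrow> wtt (t, x) - \<nu>\<^sup>2 * wxx (t, x) = s (t, x)"
proof -
  from assms obtain wt wx wtt wxx where "\<forall>t x. (t, x) \<in> U \<longrightarrow>
     ((\<lambda>r. w (r, x)) has_real_derivative wt (t, x)) (at t) \<and>
     ((\<lambda>r. wt (r, x)) has_real_derivative wtt (t, x)) (at t) \<and>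
     ((\<lambda>r. w (t, r)) has_real_derivative wx (t, x)) (at x) \<and>
     ((\<lambda>r. wx (t, r)) has_real_derivative wxx (t, x)) (at x) \<and>
     wtt (t, x) - \<nu>\<^sup>2 * wxx (t, x) = s (t, x)"
    unfolding has_box_def by (elim exE)
  then show ?thesis
    by (intro that[of wt wtt wx wxx]) simp_all
qed

lemma has_box_lincomb:
  assumes "has_box U \<nu> w s" "has_box U \<nu> z r"
  shows "has_box U \<nu> (\<lambda>p. w p + c * z p) (\<lambda>p. s p + c * r p)"
proof -
  from assms(1) obtain wt wx wtt wxx where w: "\<And>t x. (t, x) \<in> U \<Longrightarrow> ((\<lambda>r. w (r, x)) has_real_derivative wt (t, x)) (at t)"
    "\<And>t x. (t, x) \<in> U \<Longrightarrow> ((\<lambda>r. wt (r, x)) has_real_derivative wtt (t, x)) (at t)"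
    "\<And>t x. (t, x) \<in> U \<Longrightarrow> ((\<lambda>r. w (t, r)) has_real_derivative wx (t, x)) (at x)"
    "\<And>t x. (t, x) \<in> U \<Longrightarrow> ((\<lambda>r. wx (t, r)) has_real_derivative wxx (t, x)) (at x)"
    "\<And>t x. (t, x) \<in> U \<Longrightarrow> wtt (t, x) - \<nu>\<^sup>2 * wxx (t, x) = s (t, x)"
    by (rule has_boxE) blast
  from assms(2) obtain zt zx ztt zxx where z: "\<And>t x. (t, x) \<in> U \<Longrightarrow> ((\<lambda>r. z (r, x)) has_real_derivative zt (t, x)) (at t)"
    "\<And>t x. (t, x) \<in> U \<Longrightarrow> ((\<lambda>r. zt (r, x)) has_real_derivative ztt (t, x)) (at t)"
    "\<And>t x. (t, x) \<in> U \<Longrightarrow> ((\<lambda>r. z (t, r)) has_real_derivative zx (t, x)) (at x)"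
    "\<And>t x. (t, x) \<in> U \<Longrightarrow> ((\<lambda>r. zx (t, r)) has_real_derivative zxx (t, x)) (at x)"
    "\<And>t x. (t, x) \<in> U \<Longrightarrow> ztt (t, x) - \<nu>\<^sup>2 * zxx (t, x) = r (t, x)"
    by (rule has_boxE) blast
  show ?thesis
  proof (rule has_boxI[where wt = "\<lambda>p. wt p + c * zt p" and wx = "\<lambda>p. wx p + c * zx p"
        and wtt = "\<lambda>p. wtt p + c * ztt p" and wxx = "\<lambda>p. wxx p + c * zxx p"])
    fix t x assume tx: "(t, x) \<in> U"
    show "wtt (t, x) + c * ztt (t, x) - \<nu>\<^sup>2 * (wxx (t, x) + c * zxx (t, x)) = s (t, x) + c * r (t, x)"
      by (simp add: w(5)[OF tx, symmetric] z(5)[OF tx, symmetric] algebra_simps)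
    show "((\<lambda>r. w (r, x) + c * z (r, x)) has_real_derivative wt (t, x) + c * zt (t, x)) (at t)"
      by (rule DERIV_add[OF w(1)[OF tx] DERIV_cmult[OF z(1)[OF tx]]])
    show "((\<lambda>r. wt (r, x) + c * zt (r, x)) has_real_derivative wtt (t, x) + c * ztt (t, x)) (at t)"
      by (rule DERIV_add[OF w(2)[OF tx] DERIV_cmult[OF z(2)[OF tx]]])
    show "((\<lambda>r. w (t, r) + c * z (t, r)) has_real_derivative wx (t, x) + c * zx (t, x)) (at x)"
      by (rule DERIV_add[OF w(3)[OF tx] DERIV_cmult[OF z(3)[OF tx]]])
    show "((\<lambda>r. wx (t, r) + c * zx (t, r)) has_real_derivative wxx (t, x) + c * zxx (t, x)) (at x)"
      by (rule DERIV_add[OF w(4)[OF tx] DERIV_cmult[OF z(4)[OF tx]]])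
  qed
qed

lemma has_box_add:
  "has_box U \<nu> w s \<Longrightarrow> has_box U \<nu> z r \<Longrightarrow> has_box U \<nu> (\<lambda>p. w p + z p) (\<lambda>p. s p + r p)"
  using has_box_lincomb[of U \<nu> w s z r 1] by simp

lemma has_box_diff:
  "has_box U \<nu> w s \<Longrightarrow> has_box U \<nu> z r \<Longrightarrow> has_box U \<nu> (\<lambda>p. w p - z p) (\<lambda>p. s p - r p)"
  using has_box_lincomb[of U \<nu> w s z r "-1"] by simp

lemma has_box_0: "has_box U \<nu> (\<lambda>p. 0) (\<lambda>p. 0)"
  by (rule has_boxI[where wt = "\<lambda>p. 0" and wx = "\<lambda>p. 0" and wtt = "\<lambda>p. 0" and wxx = "\<lambda>p. 0"]) auto

lemma has_box_sum:
  "(\<And>j. j \<in> J \<Longrightarrow> has_box U \<nu> (w j) (s j)) \<Longrightarrow> has_box U \<nu> (\<lambda>p. \<Sum>j\<in>J. w j p) (\<lambda>p. \<Sum>j\<in>J. s j p)"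
  by (induction J rule: infinite_finite_induct) (auto intro: has_box_add has_box_0)

lemma has_box_cong:
  "has_box U \<nu> w s \<Longrightarrow> (\<And>p. w p = z p) \<Longrightarrow> (\<And>p. p \<in> U \<Longrightarrow> s p = r p) \<Longrightarrow> has_box U \<nu> z r"
  unfolding has_box_def by (simp add: fun_eq_iff[symmetric])

lemma open_sections:
  fixes U :: "(real \<times> real) set"
  assumes "open U" shows "open {r. (r, x) \<in> U}" "open {r. (t, r) \<in> U}"
proof -
  have "{r. (r, x) \<in> U} = (\<lambda>r. (r, x)) -` U" "{r. (t, r) \<in> U} = (\<lambda>r. (t, r)) -` U"
    by auto
  then show "open {r. (r, x) \<in> U}" "open {r. (t, r) \<in> U}"
    by (auto intro!: open_vimage assms continuous_intros)
qed

text \<open>On an open set derivatives are unique and depend on local values only, so the hidden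
  witnesses of \<open>has_box\<close> are the given partial derivatives.\<close>

lemma has_box_local:
  assumes "has_box U \<nu> w s" "open U" "\<And>p. p \<in> U \<Longrightarrow> w p = z p"
    "\<And>t x. ((\<lambda>r. z (r, x)) has_real_derivative zt (t, x)) (at t)"
    "\<And>t x. ((\<lambda>r. zt (r, x)) has_real_derivative ztt (t, x)) (at t)"
    "\<And>t x. ((\<lambda>r. z (t, r)) has_real_derivative zx (t, x)) (at x)"
    "\<And>t x. ((\<lambda>r. zx (t, r)) has_real_derivative zxx (t, x)) (at x)"
    "(t, x) \<in> U"
  shows "ztt (t, x) - \<nu>\<^sup>2 * zxx (t, x) = s (t, x)"
proof -
  from assms(1) obtain wt wx wtt wxx where w: "\<And>t x. (t, x) \<in> U \<Longrightarrow> ((\<lambda>r. w (r, x)) has_real_derivative wt (t, x)) (at t)"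
    "\<And>t x. (t, x) \<in> U \<Longrightarrow> ((\<lambda>r. wt (r, x)) has_real_derivative wtt (t, x)) (at t)"
    "\<And>t x. (t, x) \<in> U \<Longrightarrow> ((\<lambda>r. w (t, r)) has_real_derivative wx (t, x)) (at x)"
    "\<And>t x. (t, x) \<in> U \<Longrightarrow> ((\<lambda>r. wx (t, r)) has_real_derivative wxx (t, x)) (at x)"
    "\<And>t x. (t, x) \<in> U \<Longrightarrow> wtt (t, x) - \<nu>\<^sup>2 * wxx (t, x) = s (t, x)"
    by (rule has_boxE) blast
  note op = open_sections[OF assms(2)]
  have t1: "wt (t, x) = zt (t, x)" if "(t, x) \<in> U" for t x
  proof -
    have "((\<lambda>r. z (r, x)) has_real_derivative wt (t, x)) (at t)"
      by (rule has_field_derivative_transform_within_open[OF w(1)[OF that] op(1)[of x]]) (use that assms(3) in auto)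
    then show ?thesis
      using assms(4) DERIV_unique by blast
  qed
  have x1: "wx (t, x) = zx (t, x)" if "(t, x) \<in> U" for t x
  proof -
    have "((\<lambda>r. z (t, r)) has_real_derivative wx (t, x)) (at x)"
      by (rule has_field_derivative_transform_within_open[OF w(3)[OF that] op(2)[of t]]) (use that assms(3) in auto)
    then show ?thesis
      using assms(6) DERIV_unique by blast
  qed
  have "((\<lambda>r. zt (r, x)) has_real_derivative wtt (t, x)) (at t)"
    by (rule has_field_derivative_transform_within_open[OF w(2)[OF assms(8)] op(1)[of x]]) (use assms(8) t1 in auto)
  then have "wtt (t, x) = ztt (t, x)"
    using assms(5) DERIV_unique by blast
  moreover have "((\<lambda>r. zx (t, r)) has_real_derivative wxx (t, x)) (at x)"
    by (rule has_field_derivative_transform_within_open[OF w(4)[OF assms(8)] op(2)[of t]]) (use assms(8) x1 in auto)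
  then have "wxx (t, x) = zxx (t, x)"
    using assms(7) DERIV_unique by blast
  ultimately show ?thesis
    using w(5)[OF assms(8)] by simp
qed

section \<open>Characteristic coordinates, d'Alembert's and Duhamel's formulas\<close>

lemma DERIV_affine:
  assumes "\<And>x. (f has_real_derivative f' x) (at x)"
  shows "((\<lambda>r. f (c * r + d)) has_real_derivative c * f' (c * t + d)) (at t)"
proof -
  have "((\<lambda>r. c * r + d) has_real_derivative c) (at t)"
    by (auto intro!: derivative_eq_intros)
  from DERIV_chain2[OF assms this] show ?thesis
    by (simp add: mult.commute)
qed

lemma DERIV_shifts:
  assumes "\<And>x. (f has_real_derivative f' x) (at x)"
  shows "((\<lambda>r. f (\<nu> * r + x)) has_real_derivative \<nu> * f' (\<nu> * t + x)) (at t)"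
    "((\<lambda>r. f (\<nu> * r - x)) has_real_derivative \<nu> * f' (\<nu> * t - x)) (at t)"
    "((\<lambda>r. f (y + r)) has_real_derivative f' (y + x)) (at x)"
    "((\<lambda>r. f (y - r)) has_real_derivative - f' (y - x)) (at x)"
  using DERIV_affine[OF assms, of \<nu> x t] DERIV_affine[OF assms, of \<nu> "- x" t]
    DERIV_affine[OF assms, of 1 y x] DERIV_affine[OF assms, of "-1" y x]
  by (simp_all add: add.commute)

text \<open>In the coordinates \<xi> and \<eta> the wave operator is 4\<nu>^2 times the mixed
  derivative: the terms with f'' g and f g'' cancel.\<close>

lemma has_box_product:
  fixes f g :: "real \<Rightarrow> real"
  assumes f: "\<And>x. (f has_real_derivative f' x) (at x)" "\<And>x. (f' has_real_derivative f'' x) (at x)"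
    and g: "\<And>x. (g has_real_derivative g' x) (at x)" "\<And>x. (g' has_real_derivative g'' x) (at x)"
  shows "has_box U \<nu> (\<lambda>(t, x). f (\<nu> * t + x) * g (\<nu> * t - x)) (\<lambda>(t, x). 4 * \<nu>\<^sup>2 * (f' (\<nu> * t + x) * g' (\<nu> * t - x)))"
proof (rule has_boxI[where wt = "\<lambda>(t, x). \<nu> * (f' (\<nu> * t + x) * g (\<nu> * t - x) + f (\<nu> * t + x) * g' (\<nu> * t - x))"
      and wx = "\<lambda>(t, x). f' (\<nu> * t + x) * g (\<nu> * t - x) - f (\<nu> * t + x) * g' (\<nu> * t - x)"
      and wtt = "\<lambda>(t, x). \<nu>\<^sup>2 * (f'' (\<nu> * t + x) * g (\<nu> * t - x) + 2 * (f' (\<nu> * t + x) * g' (\<nu> * t - x)) + f (\<nu> * t + x) * g'' (\<nu> * t - x))"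
      and wxx = "\<lambda>(t, x). f'' (\<nu> * t + x) * g (\<nu> * t - x) - 2 * (f' (\<nu> * t + x) * g' (\<nu> * t - x)) + f (\<nu> * t + x) * g'' (\<nu> * t - x)"])
  fix t x :: real
  note d = DERIV_shifts(1,2)[OF f(1), of \<nu> x t] DERIV_shifts(3,4)[OF f(1), of "\<nu> * t" x]
    DERIV_shifts(1,2)[OF f(2), of \<nu> x t] DERIV_shifts(3,4)[OF f(2), of "\<nu> * t" x]
    DERIV_shifts(1,2)[OF g(1), of \<nu> x t] DERIV_shifts(3,4)[OF g(1), of "\<nu> * t" x]
    DERIV_shifts(1,2)[OF g(2), of \<nu> x t] DERIV_shifts(3,4)[OF g(2), of "\<nu> * t" x]
  show "((\<lambda>r. case (r, x) of (t, x) \<Rightarrow> f (\<nu> * t + x) * g (\<nu> * t - x)) has_real_derivative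
     (case (t, x) of (t, x) \<Rightarrow> \<nu> * (f' (\<nu> * t + x) * g (\<nu> * t - x) + f (\<nu> * t + x) * g' (\<nu> * t - x)))) (at t)"
    using DERIV_mult[OF d(1) d(10)] by (simp add: algebra_simps)
  show "((\<lambda>r. case (r, x) of (t, x) \<Rightarrow> \<nu> * (f' (\<nu> * t + x) * g (\<nu> * t - x) + f (\<nu> * t + x) * g' (\<nu> * t - x))) has_real_derivative
     (case (t, x) of (t, x) \<Rightarrow> \<nu>\<^sup>2 * (f'' (\<nu> * t + x) * g (\<nu> * t - x) + 2 * (f' (\<nu> * t + x) * g' (\<nu> * t - x)) + f (\<nu> * t + x) * g'' (\<nu> * t - x)))) (at t)"
    using DERIV_cmult[OF DERIV_add[OF DERIV_mult[OF d(5) d(10)] DERIV_mult[OF d(1) d(14)]], of \<nu>]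
    by (simp add: algebra_simps power2_eq_square)
  show "((\<lambda>r. case (t, r) of (t, x) \<Rightarrow> f (\<nu> * t + x) * g (\<nu> * t - x)) has_real_derivative
     (case (t, x) of (t, x) \<Rightarrow> f' (\<nu> * t + x) * g (\<nu> * t - x) - f (\<nu> * t + x) * g' (\<nu> * t - x))) (at x)"
    using DERIV_mult[OF d(3) d(12)] by (simp add: algebra_simps)
  show "((\<lambda>r. case (t, r) of (t, x) \<Rightarrow> f' (\<nu> * t + x) * g (\<nu> * t - x) - f (\<nu> * t + x) * g' (\<nu> * t - x)) has_real_derivative
     (case (t, x) of (t, x) \<Rightarrow> f'' (\<nu> * t + x) * g (\<nu> * t - x) - 2 * (f' (\<nu> * t + x) * g' (\<nu> * t - x)) + f (\<nu> * t + x) * g'' (\<nu> * t - x))) (at x)"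
    using DERIV_diff[OF DERIV_mult[OF d(7) d(12)] DERIV_mult[OF d(3) d(16)]]
    by (simp add: algebra_simps)
qed (auto simp: algebra_simps)

text \<open>The two reflections generate the translation by 2L, so these are the odd 2L-periodic
  functions. They satisfy the boundary conditions at both ends automatically.\<close>

definition odd_refl :: "real \<Rightarrow> (real \<Rightarrow> real) \<Rightarrow> bool" where
  "odd_refl L f \<longleftrightarrow> (\<forall>x. f (- x) = - f x \<and> f (2 * L - x) = - f x)"

lemma odd_reflD:
  assumes "odd_refl L f"
  shows "f (- x) = - f x" "f (2 * L - x) = - f x" "f (x + 2 * L) = f x" "f (x - 2 * L) = f x" "f 0 = 0" "f L = 0"
proof -
  have *: "f (- x) = - f x" "f (2 * L - x) = - f x" for x
    using assms by (auto simp: odd_refl_def)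
  show "f (- x) = - f x" "f (2 * L - x) = - f x"
    by (fact *)+
  show "f (x + 2 * L) = f x"
    using *(1)[of x] *(2)[of "- x"] by (simp add: add.commute)
  show "f (x - 2 * L) = f x"
    using *(1)[of "2 * L - x"] *(2)[of x] by simp
  show "f 0 = 0"
    using *(1)[of 0] by simp
  show "f L = 0"
    using *(2)[of L] by simp
qed

text \<open>Oddness of f about L makes the derivative of
  \<open>anti f (2 * L - x) - anti f x\<close> vanish, and at x = L the difference is 0.\<close>

lemma anti_even_refl:
  assumes "odd_refl L f" "continuous_on UNIV f"
  shows "anti f (- x) = anti f x" "anti f (2 * L - x) = anti f x" "anti f (x + 2 * L) = anti f x"
proof -
  have 1: "anti f (- x) = anti f x" for x
    using odd_reflD(1)[OF assms(1)] by (simp add: anti_def)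
  have 2: "anti f (2 * L - x) = anti f x" for x
  proof -
    define F where "F = (\<lambda>x. anti f (2 * L - x) - anti f x)"
    have "(F has_real_derivative 0) (at x)" for x
      unfolding F_def
      using DERIV_diff[OF DERIV_shifts(4)[OF anti_has_derivative[OF assms(2)], of "2 * L" x] anti_has_derivative[OF assms(2), of x]]
        odd_reflD(2)[OF assms(1), of x] by simp
    then have "F x = F L"
      using DERIV_isconst_all by blast
    then show ?thesis
      by (simp add: F_def)
  qed
  show "anti f (- x) = anti f x" "anti f (2 * L - x) = anti f x"
    by (fact 1 2)+
  show "anti f (x + 2 * L) = anti f x"
    using 1[of x] 2[of "- x"] by (simp add: add.commute)
qed

text \<open>For odd periodic data both travelling parts come from one periodic profile: the wave is
  f(\<nu>t + x) - f(\<nu>t - x), where f is half the sum of p0 and 1/\<nu> times the antiderivative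
  of p1. Controlling the wave thus means replacing one profile by another.\<close>

lemma dAlembert:
  fixes p0 p1 :: "'i \<Rightarrow> real \<Rightarrow> real"
  assumes p: "CF (Suc k) I p0" "CF k I p1" and o: "\<And>i. i \<in> I \<Longrightarrow> odd_refl L (p0 i)" "\<And>i. i \<in> I \<Longrightarrow> odd_refl L (p1 i)"
    and \<nu>: "\<nu> > 0"
  obtains f where "CF (Suc k) I f" "\<And>i x. i \<in> I \<Longrightarrow> f i (x + 2 * L) = f i x"
    "\<And>i x. i \<in> I \<Longrightarrow> f i x - f i (- x) = p0 i x"
    "\<And>i x. i \<in> I \<Longrightarrow> ((\<lambda>t. f i (\<nu> * t + x) - f i (\<nu> * t - x)) has_real_derivative p1 i x) (at 0)"
proof (rule that[of "\<lambda>i s. 1 / 2 * (p0 i s + 1 / \<nu> * anti (p1 i) s)"])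
  show "CF (Suc k) I (\<lambda>i s. 1 / 2 * (p0 i s + 1 / \<nu> * anti (p1 i) s))"
    by (intro CF_cmult CF_add p CF_anti)
  fix i and x :: real assume i: "i \<in> I"
  have c: "continuous_on UNIV (p1 i)"
    using CF_continuous[OF p(2) i] .
  note ev = anti_even_refl[OF o(2)[OF i] c]
  show "1 / 2 * (p0 i (x + 2 * L) + 1 / \<nu> * anti (p1 i) (x + 2 * L)) = 1 / 2 * (p0 i x + 1 / \<nu> * anti (p1 i) x)"
    using ev odd_reflD[OF o(1)[OF i]] by simp
  show "1 / 2 * (p0 i x + 1 / \<nu> * anti (p1 i) x) - 1 / 2 * (p0 i (- x) + 1 / \<nu> * anti (p1 i) (- x)) = p0 i x"
    using ev odd_reflD[OF o(1)[OF i]] by (simp add: field_simps)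
  obtain p0' where "\<And>j x. j \<in> I \<Longrightarrow> (p0 j has_real_derivative p0' j x) (at x)"
    using p(1) by (rule CF_real_SucE) blast
  note p0' = this[OF i]
  \<comment> \<open>Back to the usual form centred at x, by oddness of \<open>p0\<close> and
    evenness of the antiderivative of \<open>p1\<close>.\<close>
  have e: "1 / 2 * (p0 i (\<nu> * t + x) + 1 / \<nu> * anti (p1 i) (\<nu> * t + x)) - 1 / 2 * (p0 i (\<nu> * t - x) + 1 / \<nu> * anti (p1 i) (\<nu> * t - x))
    = 1 / 2 * (p0 i (x + \<nu> * t) + p0 i (x - \<nu> * t)) + 1 / (2 * \<nu>) * (anti (p1 i) (x + \<nu> * t) - anti (p1 i) (x - \<nu> * t))" for t
    using ev(1)[of "x - \<nu> * t"] odd_reflD(1)[OF o(1)[OF i], of "x - \<nu> * t"]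
    by (simp add: algebra_simps)
  have d: "((\<lambda>t. F (x + \<nu> * t)) has_real_derivative \<nu> * F' x) (at 0)"
     "((\<lambda>t. F (x - \<nu> * t)) has_real_derivative - \<nu> * F' x) (at 0)" if "\<And>x. (F has_real_derivative F' x) (at x)" for F F'
    using DERIV_affine[OF that, of \<nu> x 0] DERIV_affine[OF that, of "- \<nu>" x 0] by (simp_all add: add.commute)
  note d0 = d[of "p0 i" "p0' i", OF p0'] and d1 = d[of "anti (p1 i)" "p1 i", OF anti_has_derivative[OF c]]
  have "((\<lambda>t. 1 / 2 * (p0 i (x + \<nu> * t) + p0 i (x - \<nu> * t)) + 1 / (2 * \<nu>) * (anti (p1 i) (x + \<nu> * t) - anti (p1 i) (x - \<nu> * t)))
    has_real_derivative 1 / 2 * (\<nu> * p0' i x + - \<nu> * p0' i x) + 1 / (2 * \<nu>) * (\<nu> * p1 i x - - \<nu> * p1 i x)) (at 0)"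
    by (intro DERIV_add DERIV_cmult DERIV_diff d0 d1)
  then show "((\<lambda>t. 1 / 2 * (p0 i (\<nu> * t + x) + 1 / \<nu> * anti (p1 i) (\<nu> * t + x)) - 1 / 2 * (p0 i (\<nu> * t - x) + 1 / \<nu> * anti (p1 i) (\<nu> * t - x)))
     has_real_derivative p1 i x) (at 0)"
    unfolding e using \<nu> by simp
qed

lemma DERIV_prod_line:
  fixes w :: "real \<times> real \<Rightarrow> real"
  assumes "\<And>t x. ((\<lambda>r. w (r, x)) has_real_derivative wt (t, x)) (at t)"
    "\<And>t x. ((\<lambda>r. w (t, r)) has_real_derivative wx (t, x)) (at x)"
    "continuous_on UNIV wx"
  shows "((\<lambda>t. w (t, x + c * t)) has_real_derivative wt (t, x + c * t) + c * wx (t, x + c * t)) (at t)"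
proof -
  have "((\<lambda>t. (t, x + c * t)) has_derivative (\<lambda>h. (h, c * h))) (at t)"
    by (auto intro!: derivative_eq_intros)
  note has_derivative_compose[OF this has_derivative_prod_partials[of w wt wx, OF assms]]
  moreover have "(\<lambda>h. \<Sum>b\<in>Basis. ((h, c * h) \<bullet> b) * (if b = (1, 0) then wt (t, x + c * t) else wx (t, x + c * t)))
      = (*) (wt (t, x + c * t) + c * wx (t, x + c * t))"
    by (auto simp: Basis_real_prod algebra_simps)
  ultimately show ?thesis
    unfolding has_field_derivative_def by simp
qed

lemma DERIV_prod_snd_shift:
  fixes w :: "real \<times> real \<Rightarrow> real"
  assumes "\<And>t x. ((\<lambda>r. w (t, r)) has_real_derivative wx (t, x)) (at x)"
  shows "((\<lambda>x. w (t, x + c)) has_real_derivative wx (t, x + c)) (at x)"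
  using DERIV_shift[of "\<lambda>r. w (t, r)" "wx (t, x + c)" x c] assms by simp

text \<open>Z(t, x) is 1/(2\<nu>) times the integral over r from 0 to t of S(r, x + \<nu>(t - r)) -
  S(r, x - \<nu>(t - r)), with S the antiderivative of s in x. Here t is both a limit and an
  argument of the integrand. \<open>H c (t, y)\<close> separates the two roles: it integrates S
  along the line y + c r, so that Z consists of values of H at shifted points and the chain rule
  along lines applies.\<close>

lemma duhamel:
  fixes s :: "'i \<Rightarrow> real \<times> real \<Rightarrow> real"
  assumes s: "CF (Suc k) I s" and o: "\<And>i t. i \<in> I \<Longrightarrow> odd_refl L (\<lambda>x. s i (t, x))" and \<nu>: "\<nu> > 0"
  obtains Z Zt where "CF (Suc k) I Z" "CF (Suc k) I Zt"
    "\<And>i t x. i \<in> I \<Longrightarrow> ((\<lambda>r. Z i (r, x)) has_real_derivative Zt i (t, x)) (at t)"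
    "\<And>i. i \<in> I \<Longrightarrow> has_box UNIV \<nu> (Z i) (s i)"
    "\<And>i x. i \<in> I \<Longrightarrow> Z i (0, x) = 0" "\<And>i x. i \<in> I \<Longrightarrow> Zt i (0, x) = 0"
    "\<And>i t. i \<in> I \<Longrightarrow> odd_refl L (\<lambda>x. Z i (t, x))" "\<And>i t. i \<in> I \<Longrightarrow> odd_refl L (\<lambda>x. Zt i (t, x))"
proof -
  define S where "S = (\<lambda>i p. anti (\<lambda>r. s i (fst p, r)) (snd p))"
  define H where "H = (\<lambda>c i p. anti (\<lambda>r. S i (r, snd p + c * r)) (fst p))"
  define P where "P = (\<lambda>c i p. anti (\<lambda>r. s i (r, snd p + c * r)) (fst p))"
  define Z where "Z = (\<lambda>i p. 1 / (2 * \<nu>) * (H (- \<nu>) i (fst p, snd p + \<nu> * fst p) - H \<nu> i (fst p, snd p + (- \<nu>) * fst p)))"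
  define Zt where "Zt = (\<lambda>i p. 1 / 2 * (P (- \<nu>) i (fst p, snd p + \<nu> * fst p) + P \<nu> i (fst p, snd p + (- \<nu>) * fst p)))"
  have CFS: "CF (Suc k) I S"
    unfolding S_def by (rule CF_anti_snd[OF s])
  have line: "CF (Suc k) I (\<lambda>i p. w i (fst p, snd p + c * fst p))" if "CF (Suc k) I w" for w :: "'i \<Rightarrow> real \<times> real \<Rightarrow> real" and c
    by (intro CF_comp2 that CF_fst CF_snd CF_add CF_cmult)
  have CFH: "CF (Suc k) I (H c)" for c
    unfolding H_def using CF_anti_fst[OF line[OF CFS, of c]] by simp
  have CFP: "CF (Suc k) I (P c)" for c
    unfolding P_def using CF_anti_fst[OF line[OF s, of c]] by simp
  have CFZ: "CF (Suc k) I Z"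
    unfolding Z_def by (intro CF_cmult CF_diff line CFH)
  have CFZt: "CF (Suc k) I Zt"
    unfolding Zt_def by (intro CF_cmult CF_add line CFP)
  \<comment> \<open>The second derivatives of Z contain the x-derivative of P. It cancels from the
    wave operator, so its existence is enough and no formula for it is worked out.\<close>
  have "\<exists>Py. (\<forall>i\<in>I. \<forall>t x. ((\<lambda>r. P c i (t, r)) has_real_derivative Py i (t, x)) (at x)) \<and> CF k I Py" for c
    by (rule CF_prod_SucE[OF CFP[of c]]) blast
  then have "\<forall>c. \<exists>Py. (\<forall>i\<in>I. \<forall>t x. ((\<lambda>r. P c i (t, r)) has_real_derivative Py i (t, x)) (at x)) \<and> CF k I Py" ..
  from choice[OF this] obtain Py where
    "\<forall>c. (\<forall>i\<in>I. \<forall>t x. ((\<lambda>r. P c i (t, r)) has_real_derivative Py c i (t, x)) (at x)) \<and> CF k I (Py c)" ..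
  then have P': "\<And>c i t x. i \<in> I \<Longrightarrow> ((\<lambda>r. P c i (t, r)) has_real_derivative Py c i (t, x)) (at x)"
    "\<And>c. CF k I (Py c)"
    by auto
  {
    fix i assume i: "i \<in> I"
    have cs: "continuous_on UNIV (s i)" and cS: "continuous_on UNIV (S i)"
      using CF_continuous[OF s i] CF_continuous[OF CFS i] by auto
    have cP: "continuous_on UNIV (P c i)" and cPy: "continuous_on UNIV (Py c i)" for c
      using CF_continuous[OF CFP i] CF_continuous[OF P'(2) i] by auto
    have csx: "continuous_on UNIV (\<lambda>x. s i (t, x))" for t
      by (intro continuous_on_compose2[OF cs] continuous_intros) auto
    have cline: "continuous_on UNIV (\<lambda>p. w (fst p, snd p + c * fst p))" if "continuous_on UNIV w" for w :: "real \<times> real \<Rightarrow> real" and c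
      by (intro continuous_on_compose2[OF that] continuous_intros) auto
    have cline1: "continuous_on UNIV (\<lambda>r. w (r, x + c * r))" if "continuous_on UNIV w" for w :: "real \<times> real \<Rightarrow> real" and c x
      by (intro continuous_on_compose2[OF that] continuous_intros) auto
    have Sx: "((\<lambda>r. S i (t, r)) has_real_derivative s i (t, x)) (at x)" for t x
      unfolding S_def using anti_has_derivative[OF csx] by simp
    have Ht: "((\<lambda>r. H c i (r, x)) has_real_derivative S i (t, x + c * t)) (at t)" for c t x
      unfolding H_def using anti_has_derivative[OF cline1[OF cS]] by simp
    have Hx: "((\<lambda>r. H c i (t, r)) has_real_derivative P c i (t, x)) (at x)" for c t x
      using anti_param_has_derivative[OF cline[OF cS, of c] cline[OF cs, of c]] DERIV_prod_snd_shift[of "S i" "s i", OF Sx]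
      unfolding H_def P_def by simp
    have Pt: "((\<lambda>r. P c i (r, x)) has_real_derivative s i (t, x + c * t)) (at t)" for c t x
      unfolding P_def using anti_has_derivative[OF cline1[OF cs]] by simp
    have Z1: "((\<lambda>r. Z i (r, x)) has_real_derivative Zt i (t, x)) (at t)" for t x
    proof -
      have "((\<lambda>r. Z i (r, x)) has_real_derivative
         1 / (2 * \<nu>) * ((S i (t, (x + \<nu> * t) + (- \<nu>) * t) + \<nu> * P (- \<nu>) i (t, x + \<nu> * t)) -
           (S i (t, (x + (- \<nu>) * t) + \<nu> * t) + (- \<nu>) * P \<nu> i (t, x + (- \<nu>) * t)))) (at t)"
        unfolding Z_def fst_conv snd_conv
        by (intro DERIV_cmult DERIV_diff
            DERIV_prod_line[where w = "H (- \<nu>) i" and wt = "\<lambda>p. S i (fst p, snd p + (- \<nu>) * fst p)" and wx = "P (- \<nu>) i", unfolded fst_conv snd_conv]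
            DERIV_prod_line[where w = "H \<nu> i" and wt = "\<lambda>p. S i (fst p, snd p + \<nu> * fst p)" and wx = "P \<nu> i", unfolded fst_conv snd_conv]
            Ht Hx cP)
      moreover have "1 / (2 * \<nu>) * ((S i (t, (x + \<nu> * t) + (- \<nu>) * t) + \<nu> * P (- \<nu>) i (t, x + \<nu> * t)) -
           (S i (t, (x + (- \<nu>) * t) + \<nu> * t) + (- \<nu>) * P \<nu> i (t, x + (- \<nu>) * t))) = Zt i (t, x)"
        using \<nu> by (simp add: Zt_def field_simps)
      ultimately show ?thesis by simp
    qed
    have Z2: "((\<lambda>r. Zt i (r, x)) has_real_derivative
         s i (t, x) + \<nu> / 2 * (Py (- \<nu>) i (t, x + \<nu> * t) - Py \<nu> i (t, x + (- \<nu>) * t))) (at t)" for t x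
    proof -
      have "((\<lambda>r. Zt i (r, x)) has_real_derivative
         1 / 2 * ((s i (t, (x + \<nu> * t) + (- \<nu>) * t) + \<nu> * Py (- \<nu>) i (t, x + \<nu> * t)) +
           (s i (t, (x + (- \<nu>) * t) + \<nu> * t) + (- \<nu>) * Py \<nu> i (t, x + (- \<nu>) * t)))) (at t)"
        unfolding Zt_def fst_conv snd_conv
        by (intro DERIV_cmult DERIV_add
            DERIV_prod_line[where w = "P (- \<nu>) i" and wt = "\<lambda>p. s i (fst p, snd p + (- \<nu>) * fst p)" and wx = "Py (- \<nu>) i", unfolded fst_conv snd_conv]
            DERIV_prod_line[where w = "P \<nu> i" and wt = "\<lambda>p. s i (fst p, snd p + \<nu> * fst p)" and wx = "Py \<nu> i", unfolded fst_conv snd_conv]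
            Pt P'(1)[OF i] cPy)
      then show ?thesis
        by (simp add: field_simps)
    qed
    have Z3: "((\<lambda>r. Z i (t, r)) has_real_derivative
        1 / (2 * \<nu>) * (P (- \<nu>) i (t, x + \<nu> * t) - P \<nu> i (t, x + (- \<nu>) * t))) (at x)" for t x
      unfolding Z_def fst_conv snd_conv
      by (intro DERIV_cmult DERIV_diff DERIV_prod_snd_shift[where w = "H (- \<nu>) i"] DERIV_prod_snd_shift[where w = "H \<nu> i"] Hx)
    have Z4: "((\<lambda>r. 1 / (2 * \<nu>) * (P (- \<nu>) i (t, r + \<nu> * t) - P \<nu> i (t, r + (- \<nu>) * t))) has_real_derivative
        1 / (2 * \<nu>) * (Py (- \<nu>) i (t, x + \<nu> * t) - Py \<nu> i (t, x + (- \<nu>) * t))) (at x)" for t x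
      by (intro DERIV_cmult DERIV_diff DERIV_prod_snd_shift[where w = "P (- \<nu>) i"] DERIV_prod_snd_shift[where w = "P \<nu> i"] P'(1)[OF i])
    have "has_box UNIV \<nu> (Z i) (s i)"
      by (rule has_boxI[where wt = "Zt i"
            and wtt = "\<lambda>p. s i (fst p, snd p) + \<nu> / 2 * (Py (- \<nu>) i (fst p, snd p + \<nu> * fst p) - Py \<nu> i (fst p, snd p + (- \<nu>) * fst p))"
            and wx = "\<lambda>p. 1 / (2 * \<nu>) * (P (- \<nu>) i (fst p, snd p + \<nu> * fst p) - P \<nu> i (fst p, snd p + (- \<nu>) * fst p))"
            and wxx = "\<lambda>p. 1 / (2 * \<nu>) * (Py (- \<nu>) i (fst p, snd p + \<nu> * fst p) - Py \<nu> i (fst p, snd p + (- \<nu>) * fst p))",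
            unfolded fst_conv snd_conv]; (intro Z1 Z2 Z3 Z4)?)
        (use \<nu> in \<open>simp add: field_simps power2_eq_square\<close>)
    note bx = this Z1
    note ev = anti_even_refl[OF o[OF i] csx]
    \<comment> \<open>A reflection in x reverses the slope of a characteristic line and so exchanges
      \<open>H \<nu>\<close> with \<open>H (- \<nu>)\<close>; their difference changes sign. For P
      the oddness of s supplies a further sign, and Zt contains a sum.\<close>
    have Hm: "H c i (t, - y) = H (- c) i (t, y)" "H c i (t, 2 * L - y) = H (- c) i (t, y)" for c t y
    proof -
      have "S i (r, - y + c * r) = S i (r, y + (- c) * r)" "S i (r, 2 * L - y + c * r) = S i (r, y + (- c) * r)" for r
        using ev(1)[of r "y - c * r"] ev(2)[of r "y - c * r"] by (simp_all add: S_def algebra_simps)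
      then show "H c i (t, - y) = H (- c) i (t, y)" "H c i (t, 2 * L - y) = H (- c) i (t, y)"
        unfolding H_def fst_conv snd_conv by simp_all
    qed
    have Pm: "P c i (t, - y) = - P (- c) i (t, y)" "P c i (t, 2 * L - y) = - P (- c) i (t, y)" for c t y
    proof -
      have "s i (r, - y + c * r) = - s i (r, y + (- c) * r)" "s i (r, 2 * L - y + c * r) = - s i (r, y + (- c) * r)" for r
        using odd_reflD(1)[OF o[OF i], of r "y - c * r"] odd_reflD(2)[OF o[OF i], of r "y - c * r"] by (simp_all add: algebra_simps)
      then show "P c i (t, - y) = - P (- c) i (t, y)" "P c i (t, 2 * L - y) = - P (- c) i (t, y)"
        unfolding P_def fst_conv snd_conv by (simp_all add: anti_def)
    qed
    have "odd_refl L (\<lambda>x. Z i (t, x))" "odd_refl L (\<lambda>x. Zt i (t, x))" for t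
      unfolding odd_refl_def Z_def Zt_def fst_conv snd_conv
      using Hm(1)[of "- \<nu>" t "x - \<nu> * t" for x] Hm(1)[of \<nu> t "x + \<nu> * t" for x]
        Hm(2)[of "- \<nu>" t "x - \<nu> * t" for x] Hm(2)[of \<nu> t "x + \<nu> * t" for x]
        Pm(1)[of "- \<nu>" t "x - \<nu> * t" for x] Pm(1)[of \<nu> t "x + \<nu> * t" for x]
        Pm(2)[of "- \<nu>" t "x - \<nu> * t" for x] Pm(2)[of \<nu> t "x + \<nu> * t" for x]
      by (simp_all add: algebra_simps)
    note bx this
  }
  note * = this
  show ?thesis
    by (rule that[OF CFZ CFZt]) (use * in \<open>simp_all add: Z_def Zt_def H_def P_def\<close>)
qed

section \<open>Chains of cubes\<close>

text \<open>Every mixed term of (x + y)^3 contains the factor x y.\<close>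

lemma sum_cube_disjoint:
  fixes x :: "'j \<Rightarrow> real"
  assumes "\<And>j l. j \<in> J \<Longrightarrow> l \<in> J \<Longrightarrow> j \<noteq> l \<Longrightarrow> x j * x l = 0"
  shows "(\<Sum>j\<in>J. x j) ^ 3 = (\<Sum>j\<in>J. x j ^ 3)"
  using assms
proof (induction J rule: infinite_finite_induct)
  case (insert a J)
  have "x a * (\<Sum>j\<in>J. x j) = 0"
    unfolding sum_distrib_left using insert.hyps insert.prems by (intro sum.neutral) auto
  then have "(x a + (\<Sum>j\<in>J. x j)) ^ 3 = x a ^ 3 + (\<Sum>j\<in>J. x j) ^ 3"
    by auto
  then show ?case
    using insert by simp
qed auto

locale step_function =
  fixes \<beta> S :: "real \<Rightarrow> real" and k :: nat
  assumes \<beta>: "smooth (Suc k) \<beta>" and S: "smooth (Suc k) S"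
    and S': "(S has_real_derivative \<beta> y ^ 3) (at y)"
    and \<beta>0: "y \<le> 0 \<or> y \<ge> 1 \<Longrightarrow> \<beta> y = 0"
    and S0: "y \<le> 0 \<Longrightarrow> S y = 0" and S1: "y \<ge> 1 \<Longrightarrow> S y = 1" and S_ge: "0 \<le> S y" and S_le: "S y \<le> 1"
begin

lemma CF_S: "CF (Suc k) I z \<Longrightarrow> CF (Suc k) I (\<lambda>i p. S (z i p))"
  by (rule CF_smooth_comp[OF S])

lemma S_scaled_has_derivative:
  "((\<lambda>y. S ((y - c) / d)) has_real_derivative \<beta> ((y - c) / d) ^ 3 / d) (at y)"
  using DERIV_affine[OF S', of "1 / d" "- c / d" y] by (simp add: diff_divide_distrib)

lemma CF_affine: "CF n I (\<lambda>i y::real. (y - c) / d)"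
proof -
  have "CF n I (\<lambda>i y::real. 1 / d * (y - c))"
    by (intro CF_cmult CF_diff CF_const CF_ident)
  then show ?thesis by simp
qed

text \<open>
  The building block of the control: the products \<open>f j p * g j q\<close> have mixed derivatives \<open>(c j p * b j q)\<^sup>3\<close>
  with disjoint supports, and their sum switches from \<open>0\<close> to \<open>G p\<close> when \<open>q\<close> passes \<open>Y k\<close>, for
  \<open>p\<close> near the grid point \<open>p0 + k * \<epsilon>\<close>. In each cell a large multiple of a sign-changing cube is added
  and subtracted at neighbouring positions, so that only cube roots of functions bounded below are taken.
\<close>

lemma cube_chain:
  fixes G :: "'i \<Rightarrow> real \<Rightarrow> real" and Y :: "nat \<Rightarrow> real"
  assumes G: "CF (Suc k) I G" and \<epsilon>: "\<epsilon> > 0" and N: "N > 0"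
  obtains f c :: "nat \<Rightarrow> 'i \<Rightarrow> real \<Rightarrow> real" and g b :: "nat \<Rightarrow> real \<Rightarrow> real" where
    "\<And>j. CF (Suc k) I (f j)" "\<And>j. smooth (Suc k) (g j)"
    "\<And>j. CF k I (c j)" "\<And>j. smooth k (b j)"
    "\<And>j i p. j < 2 * N \<Longrightarrow> i \<in> I \<Longrightarrow> (f j i has_real_derivative c j i p ^ 3) (at p)"
    "\<And>j q. (g j has_real_derivative b j q ^ 3) (at q)"
    "\<And>j l q. j < 2 * N \<Longrightarrow> l < 2 * N \<Longrightarrow> j \<noteq> l \<Longrightarrow> b j q * b l q = 0"
    "\<And>j i p. c j i p \<noteq> 0 \<Longrightarrow> p0 + real (j div 2) * \<epsilon> - \<epsilon> \<le> p \<and> p \<le> p0 + real (j div 2) * \<epsilon> + 7 * \<epsilon>"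
    "\<And>j q. j < 2 * N \<Longrightarrow> b j q \<noteq> 0 \<Longrightarrow> \<bar>q - Y (j div 2)\<bar> \<le> \<epsilon>"
    "\<And>i p q. (\<And>k. k < N \<Longrightarrow> p0 + real k * \<epsilon> - \<epsilon> \<le> p \<Longrightarrow> p \<le> p0 + real k * \<epsilon> + 7 * \<epsilon> \<Longrightarrow> q \<le> Y k - \<epsilon>)
       \<Longrightarrow> (\<Sum>j<2*N. f j i p * g j q) = 0"
    "\<And>i p q. (\<And>k. k < N \<Longrightarrow> p0 + real k * \<epsilon> - \<epsilon> \<le> p \<Longrightarrow> p \<le> p0 + real k * \<epsilon> + 7 * \<epsilon> \<Longrightarrow> q \<ge> Y k + \<epsilon>)
       \<Longrightarrow> (\<Sum>j<2*N. f j i p * g j q) = G i p * (S ((p - p0) / \<epsilon>) - S ((p - (p0 + real N * \<epsilon>)) / \<epsilon>))"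
proof -
  obtain \<alpha> A :: "real \<Rightarrow> real" where \<alpha>: "smooth (Suc k) \<alpha>" and A: "smooth (Suc k) A"
    and A': "\<And>y. (A has_real_derivative \<alpha> y ^ 3) (at y)"
    and \<alpha>0: "\<And>y. y \<le> -1 \<or> y \<ge> 7 \<Longrightarrow> \<alpha> y = 0" and A0: "\<And>y. y \<le> -1 \<or> y \<ge> 7 \<Longrightarrow> A y = 0"
    and \<alpha>1: "\<And>y. 0 \<le> y \<Longrightarrow> y \<le> 2 \<Longrightarrow> \<alpha> y = 1"
    by (rule ex_smooth_sign_changing[of "Suc k"]) blast
  obtain G' where "\<And>i x. i \<in> I \<Longrightarrow> (G i has_real_derivative G' i x) (at x)" and G'k: "CF k I G'"
    using G by (rule CF_real_SucE) blast
  note G' = this(1)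
  define P where "P = (\<lambda>n. p0 + real n * \<epsilon>)"
  \<comment> \<open>A telescoping partition: \<pi> n lives on
    \<open>[P n, P n + 2 * \<epsilon>]\<close>, which is why \<alpha> was made 1 on [0, 2], and the
    sum over n < N is the plateau from p0 to p0 + N \<epsilon>.\<close>
  define \<pi> where "\<pi> = (\<lambda>n p. S ((p - P n) / \<epsilon>) - S ((p - P (Suc n)) / \<epsilon>))"
  define D where "D = (\<lambda>n i p. G' i p * \<pi> n p + (\<beta> ((p - P n) / \<epsilon>) ^ 3 / \<epsilon> - \<beta> ((p - P (Suc n)) / \<epsilon>) ^ 3 / \<epsilon>) * G i p)"
  have \<pi>': "((\<pi> n) has_real_derivative (\<beta> ((p - P n) / \<epsilon>) ^ 3 / \<epsilon> - \<beta> ((p - P (Suc n)) / \<epsilon>) ^ 3 / \<epsilon>)) (at p)" for n p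
    unfolding \<pi>_def by (intro DERIV_diff S_scaled_has_derivative)
  have D: "((\<lambda>p. G i p * \<pi> n p) has_real_derivative D n i p) (at p)" if "i \<in> I" for i n p
    unfolding D_def by (rule DERIV_mult[OF G'[OF that] \<pi>'])
  have CF\<pi>: "CF (Suc k) I (\<lambda>i. \<pi> n)" for n
    unfolding \<pi>_def by (intro CF_diff CF_S CF_affine)
  have CF\<beta>: "CF (Suc k) I (\<lambda>i p. \<beta> ((p - c) / \<epsilon>) ^ 3 / \<epsilon>)" for c
  proof -
    have "CF (Suc k) I (\<lambda>i p. 1 / \<epsilon> * \<beta> ((p - c) / \<epsilon>) ^ 3)"
      by (intro CF_cmult CF_power CF_smooth_comp[OF \<beta>] CF_affine)
    then show ?thesis by simp
  qed
  have CFD: "CF k I (D n)" for n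
    unfolding D_def by (intro CF_add CF_mult CF_diff G'k CF_Suc_D[OF G] CF_Suc_D[OF CF\<pi>] CF_Suc_D[OF CF\<beta>])
  have \<pi>0: "\<pi> n p = 0" if "p \<le> P n \<or> p \<ge> P n + 2 * \<epsilon>" for n p
    using that \<epsilon> by (auto simp: \<pi>_def P_def S0 S1 field_simps)
  have D0: "D n i p = 0" if "p \<le> P n \<or> p \<ge> P n + 2 * \<epsilon>" for n i p
    using that \<epsilon> \<pi>0[OF that] by (auto simp: D_def P_def \<beta>0 field_simps)
  \<comment> \<open>D n vanishes off a bounded interval, so local bounds are global ones. The
    constant M, and with it the size of the control, then depends on the whole family but not on its
    members.\<close>
  have "\<exists>M. \<forall>n<N. \<forall>i\<in>I. \<forall>p. \<bar>D n i p\<bar> \<le> M"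
  proof -
    have "\<forall>n. \<exists>M>0. \<forall>i\<in>I. \<forall>p. \<bar>D n i p\<bar> \<le> M"
    proof
      fix n
      obtain M where M: "M > 0" "\<And>i p. i \<in> I \<Longrightarrow> norm p \<le> \<bar>P n\<bar> + 2 * \<epsilon> \<Longrightarrow> \<bar>D n i p\<bar> \<le> M"
        by (rule locally_bddD[OF CF_locally_bdd[OF CFD], of "\<bar>P n\<bar> + 2 * \<epsilon>" n]) blast
      have "\<bar>D n i p\<bar> \<le> M" if "i \<in> I" for i p
      proof (cases "norm p \<le> \<bar>P n\<bar> + 2 * \<epsilon>")
        case False
        then have "p \<le> P n \<or> p \<ge> P n + 2 * \<epsilon>" using \<epsilon> by auto
        then show ?thesis using D0 M(1) by simp
      qed (use M that in auto)
      then show "\<exists>M>0. \<forall>i\<in>I. \<forall>p. \<bar>D n i p\<bar> \<le> M"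
        using M(1) by blast
    qed
    from choice[OF this] obtain M where M: "\<And>n. M n > 0" "\<And>n i p. i \<in> I \<Longrightarrow> \<bar>D n i p\<bar> \<le> M n"
      by blast
    have "M n \<le> (\<Sum>n<N. M n)" if "n < N" for n
      by (rule member_le_sum) (use that M(1) less_imp_le in auto)
    then show ?thesis
      using M(2) by (intro exI[of _ "\<Sum>n<N. M n"]) (meson order_trans)
  qed
  then obtain M0 where M0: "\<And>n i p. n < N \<Longrightarrow> i \<in> I \<Longrightarrow> \<bar>D n i p\<bar> \<le> M0"
    by blast
  define M where "M = \<bar>M0\<bar> + 1"
  have M: "M + D n i p \<ge> 1" if "n < N" "i \<in> I" for n i p
    using M0[OF that, of p] by (simp add: M_def)
  \<comment> \<open>An interval of length \<epsilon> is divided into 2N slots of length \<delta>, as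
    many as there are cells.\<close>
  define \<delta> where "\<delta> = \<epsilon> / real (2 * N)"
  have \<delta>: "\<delta> > 0"
    using \<epsilon> N by (simp add: \<delta>_def)
  have N\<delta>: "\<epsilon> = real (2 * N) * \<delta>"
    using N by (simp add: \<delta>_def)
  \<comment> \<open>Y is rounded down to a multiple of \<epsilon> = 2N \<delta>, and cell j takes
    the j-th slot from there. Its slot number is j modulo 2N, so different cells never share a slot,
    whatever the values of Y.\<close>
  define Q where "Q = (\<lambda>j. \<epsilon> * of_int \<lfloor>Y (j div 2) / \<epsilon>\<rfloor> + \<delta> * real j)"
  \<comment> \<open>Cell 2n adds \<open>G * \<pi> n\<close> together with M times a compactly
    supported function; cell 2n + 1 removes the latter again.\<close>
  define f where "f = (\<lambda>j i p. (if even j then G i p * \<pi> (j div 2) p else 0) + (if even j then M else - M) * (\<epsilon> * A ((p - P (j div 2)) / \<epsilon>)))"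
  \<comment> \<open>Since \<alpha> = 1 on the support of D, the derivative D + M \<alpha>^3 of the
    even cell equals \<alpha>^3 (M + D), the cube of \<alpha> times a smooth root. The bound
    \<open>M + D \<ge> 1\<close> is available for n < N only; elsewhere the default is 0.\<close>
  define c where "c = (\<lambda>j i p. if j < 2 * N then \<alpha> ((p - P (j div 2)) / \<epsilon>) * (if even j then root 3 (M + D (j div 2) i p) else - root 3 M) else 0)"
  define g where "g = (\<lambda>j q. S ((q - Q j) / \<delta>))"
  define b where "b = (\<lambda>j q. \<beta> ((q - Q j) / \<delta>) * (1 / root 3 \<delta>))"
  have QY: "Y (j div 2) - \<epsilon> \<le> Q j" "Q j + \<delta> \<le> Y (j div 2) + \<epsilon>" if "j < 2 * N" for j
  proof -
    have 1: "\<epsilon> * of_int \<lfloor>Y (j div 2) / \<epsilon>\<rfloor> \<le> Y (j div 2)" "\<epsilon> * of_int \<lfloor>Y (j div 2) / \<epsilon>\<rfloor> \<ge> Y (j div 2) - \<epsilon>"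
      using mult_left_mono[OF of_int_floor_le[of "Y (j div 2) / \<epsilon>"], of \<epsilon>]
        real_of_int_floor_add_one_gt[of "Y (j div 2) / \<epsilon>"] \<epsilon>
      by (simp_all add: field_simps)
    have "\<delta> * (real j + 1) \<le> \<delta> * real (2 * N)"
      using that \<delta> by (intro mult_left_mono) auto
    then have 2: "\<delta> * real j + \<delta> \<le> \<epsilon>"
      using N\<delta> by (simp add: algebra_simps)
    show "Y (j div 2) - \<epsilon> \<le> Q j" "Q j + \<delta> \<le> Y (j div 2) + \<epsilon>"
      unfolding Q_def using 1 2 \<delta> by (auto intro: add_increasing2)
  qed
  have f0: "f j i p = 0" if "p < P (j div 2) - \<epsilon> \<or> p > P (j div 2) + 7 * \<epsilon>" for j i p
  proof -
    have "(p - P (j div 2)) / \<epsilon> \<le> - 1 \<or> (p - P (j div 2)) / \<epsilon> \<ge> 7"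
      using that \<epsilon> by (auto simp: field_simps)
    moreover have "\<pi> (j div 2) p = 0"
      using that \<epsilon> by (intro \<pi>0) auto
    ultimately show ?thesis
      using A0 by (simp add: f_def)
  qed
  show ?thesis
  proof (rule that[of f g c b])
    have CFA: "CF (Suc k) I (\<lambda>i p. A ((p - P n) / \<epsilon>))" for n
      by (rule CF_smooth_comp[OF A CF_affine])
    show "CF (Suc k) I (f j)" for j
      unfolding f_def using CF\<pi>[of "j div 2"]
      by (cases "even j") (auto simp del: CF.simps intro!: CF_add CF_minus CF_cmult CF_mult G CFA CF_const)
    show "smooth (Suc k) (g j)" for j
      unfolding g_def by (intro CF_S CF_affine)
    show "CF k I (c j)" for j
    proof (cases "j < 2 * N")
      case True
      then have "j div 2 < N" by auto
      then have "CF k I (\<lambda>i p. root 3 (M + D (j div 2) i p))"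
        by (intro CF_cbrt CF_add CF_const CFD M)
      moreover have "CF k I (\<lambda>i p. \<alpha> ((p - P (j div 2)) / \<epsilon>))"
        by (rule CF_smooth_comp[OF CF_Suc_D[OF \<alpha>] CF_affine])
      ultimately show ?thesis
        unfolding c_def using True by (cases "even j") (auto simp del: CF.simps intro!: CF_minus CF_mult CF_const)
    qed (auto simp: c_def CF_const)
    show "smooth k (b j)" for j
      unfolding b_def by (intro CF_mult CF_const CF_smooth_comp[OF CF_Suc_D[OF \<beta>]] CF_affine)
    show "(f j i has_real_derivative c j i p ^ 3) (at p)" if j: "j < 2 * N" and i: "i \<in> I" for j i p
    proof -
      let ?n = "j div 2" and ?a = "\<alpha> ((p - P (j div 2)) / \<epsilon>)"
      have n: "?n < N" using j by auto
      have "((\<lambda>p. \<epsilon> * A ((p - P ?n) / \<epsilon>)) has_real_derivative \<epsilon> * (1 / \<epsilon> * ?a ^ 3)) (at p)"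
        using DERIV_cmult[OF DERIV_affine[OF A', of "1 / \<epsilon>" "- P ?n / \<epsilon>" p], of \<epsilon>] by (simp add: diff_divide_distrib)
      then have dA: "((\<lambda>p. \<epsilon> * A ((p - P ?n) / \<epsilon>)) has_real_derivative ?a ^ 3) (at p)"
        using \<epsilon> by simp
      have DD: "?a ^ 3 * D ?n i p = D ?n i p"
      proof (cases "p \<le> P ?n \<or> p \<ge> P ?n + 2 * \<epsilon>")
        case False
        then have "?a = 1" using \<epsilon> by (intro \<alpha>1) (auto simp: field_simps)
        then show ?thesis by simp
      qed (simp add: D0)
      have r: "root 3 x ^ 3 = x" for x :: real
        by (rule odd_real_root_pow) auto
      show ?thesis
      proof (cases "even j")
        case True
        have "((\<lambda>p. G i p * \<pi> ?n p + M * (\<epsilon> * A ((p - P ?n) / \<epsilon>))) has_real_derivative D ?n i p + M * ?a ^ 3) (at p)"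
          by (intro DERIV_add D[OF i] DERIV_cmult dA)
        moreover have "c j i p ^ 3 = ?a ^ 3 * D ?n i p + M * ?a ^ 3"
          using True j by (simp add: c_def power_mult_distrib r algebra_simps)
        then have "c j i p ^ 3 = D ?n i p + M * ?a ^ 3"
          unfolding DD .
        ultimately show ?thesis
          using True by (simp add: f_def)
      next
        case False
        have "((\<lambda>p. - M * (\<epsilon> * A ((p - P ?n) / \<epsilon>))) has_real_derivative - M * ?a ^ 3) (at p)"
          by (intro DERIV_cmult dA)
        moreover have "c j i p ^ 3 = - M * ?a ^ 3"
          using False j by (simp add: c_def power_mult_distrib r power_minus_odd)
        ultimately show ?thesis
          using False by (simp add: f_def)
      qed
    qed
    show "(g j has_real_derivative b j q ^ 3) (at q)" for j q
      using S_scaled_has_derivative[of "Q j" \<delta> q] odd_real_root_pow[of 3 \<delta>]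
      by (simp add: g_def b_def power_mult_distrib power_divide)
    have bQ: "Q j < q \<and> q < Q j + \<delta>" if "b j q \<noteq> 0" for j q
    proof -
      have "\<not> ((q - Q j) / \<delta> \<le> 0 \<or> (q - Q j) / \<delta> \<ge> 1)"
        using that \<beta>0 by (auto simp: b_def)
      then show ?thesis
        using \<delta> by (simp add: field_simps not_le)
    qed
    show "b j q * b l q = 0" if "j < 2 * N" "l < 2 * N" "j \<noteq> l" for j l q
    proof (rule ccontr)
      assume "b j q * b l q \<noteq> 0"
      then have *: "\<bar>Q j - Q l\<bar> < \<delta>"
        using bQ[of j q] bQ[of l q] by auto
      \<comment> \<open>The slot numbers differ by the integer z, and overlapping slots force z = 0;
        reduction modulo 2N then recovers j = l.\<close>
      define z where "z = (int (2 * N) * \<lfloor>Y (j div 2) / \<epsilon>\<rfloor> + int j) - (int (2 * N) * \<lfloor>Y (l div 2) / \<epsilon>\<rfloor> + int l)"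
      have "Q j - Q l = \<delta> * of_int z"
        unfolding Q_def z_def N\<delta> by (simp add: algebra_simps)
      then have "\<bar>\<delta> * of_int z\<bar> < \<delta>"
        using * by simp
      then have "\<bar>real_of_int z\<bar> < 1"
        using \<delta> by (simp add: abs_mult)
      then have "z = 0" by linarith
      then have "(int (2 * N) * \<lfloor>Y (j div 2) / \<epsilon>\<rfloor> + int j) mod int (2 * N) = (int (2 * N) * \<lfloor>Y (l div 2) / \<epsilon>\<rfloor> + int l) mod int (2 * N)"
        by (simp add: z_def)
      then have "int j = int l"
        using that by simp
      then show False using that by simp
    qed
    show "p0 + real (j div 2) * \<epsilon> - \<epsilon> \<le> p \<and> p \<le> p0 + real (j div 2) * \<epsilon> + 7 * \<epsilon>" if "c j i p \<noteq> 0" for j i p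
    proof -
      have "\<not> ((p - P (j div 2)) / \<epsilon> \<le> - 1 \<or> (p - P (j div 2)) / \<epsilon> \<ge> 7)"
        using that \<alpha>0 by (auto simp: c_def split: if_splits)
      then show ?thesis
        using \<epsilon> by (simp add: P_def field_simps not_le)
    qed
    show "\<bar>q - Y (j div 2)\<bar> \<le> \<epsilon>" if "j < 2 * N" "b j q \<noteq> 0" for j q
      using bQ[OF that(2)] QY[OF that(1)] by auto
    show "(\<Sum>j<2*N. f j i p * g j q) = 0"
      if h: "\<And>k. k < N \<Longrightarrow> p0 + real k * \<epsilon> - \<epsilon> \<le> p \<Longrightarrow> p \<le> p0 + real k * \<epsilon> + 7 * \<epsilon> \<Longrightarrow> q \<le> Y k - \<epsilon>" for i p q
    proof (rule sum.neutral, rule ballI)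
      fix j assume j: "j \<in> {..<2*N}"
      show "f j i p * g j q = 0"
      proof (cases "p < P (j div 2) - \<epsilon> \<or> p > P (j div 2) + 7 * \<epsilon>")
        case False
        then have "q \<le> Y (j div 2) - \<epsilon>"
          using j by (intro h) (auto simp: P_def)
        then have "q \<le> Q j" using QY(1)[of j] j by auto
        then show ?thesis using \<delta> by (simp add: g_def S0 divide_nonpos_pos)
      qed (simp add: f0)
    qed
    show "(\<Sum>j<2*N. f j i p * g j q) = G i p * (S ((p - p0) / \<epsilon>) - S ((p - (p0 + real N * \<epsilon>)) / \<epsilon>))"
      if h: "\<And>k. k < N \<Longrightarrow> p0 + real k * \<epsilon> - \<epsilon> \<le> p \<Longrightarrow> p \<le> p0 + real k * \<epsilon> + 7 * \<epsilon> \<Longrightarrow> q \<ge> Y k + \<epsilon>" for i p q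
    proof -
      \<comment> \<open>Wherever \<open>f j\<close> is nonzero, q has passed the slot of cell j, so
        \<open>g j\<close> is 1. In the resulting sum the auxiliary terms cancel in pairs and the
        partition telescopes.\<close>
      have "f j i p * g j q = f j i p" if j: "j < 2 * N" for j
      proof (cases "p < P (j div 2) - \<epsilon> \<or> p > P (j div 2) + 7 * \<epsilon>")
        case False
        then have "q \<ge> Y (j div 2) + \<epsilon>"
          using j by (intro h) (auto simp: P_def)
        then have "q - Q j \<ge> \<delta>" using QY(2)[of j] j by auto
        then show ?thesis using \<delta> by (simp add: g_def S1)
      qed (simp add: f0)
      then have "(\<Sum>j<2*N. f j i p * g j q) = (\<Sum>j<2*N. f j i p)"
        by (intro sum.cong) auto
      also have "(\<Sum>j<2*n. f j i p) = G i p * (S ((p - P 0) / \<epsilon>) - S ((p - P n) / \<epsilon>))" for n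
        by (induction n) (auto simp: f_def \<pi>_def algebra_simps)
      finally show ?thesis
        by (simp add: P_def)
    qed
  qed
qed

end

section \<open>A wave equation controlled by a cube\<close>

lemma has_box_product_CF:
  assumes "CF (Suc k) I f'" "CF (Suc k) J g'" "i \<in> I" "j \<in> J"
    "\<And>x. (f has_real_derivative f' i x) (at x)" "\<And>x. (g has_real_derivative g' j x) (at x)"
  shows "has_box U \<nu> (\<lambda>p. f (\<nu> * fst p + snd p) * g (\<nu> * fst p - snd p))
    (\<lambda>p. 4 * \<nu>\<^sup>2 * (f' i (\<nu> * fst p + snd p) * g' j (\<nu> * fst p - snd p)))"
proof -
  obtain f'' where "\<And>i x. i \<in> I \<Longrightarrow> (f' i has_real_derivative f'' i x) (at x)"
    using assms(1) by (rule CF_real_SucE) blast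
  note f'' = this[OF assms(3)]
  obtain g'' where "\<And>i x. i \<in> J \<Longrightarrow> (g' i has_real_derivative g'' i x) (at x)"
    using assms(2) by (rule CF_real_SucE) blast
  note g'' = this[OF assms(4)]
  show ?thesis
    using has_box_product[of f "f' i" "f'' i" g "g' j" "g'' j" U \<nu>, OF assms(5) f'' assms(6) g'']
    by (simp add: case_prod_beta')
qed

lemma has_box_travelling:
  assumes "CF (Suc (Suc k)) I f" "i \<in> I"
  shows "has_box U \<nu> (\<lambda>p. f i (\<nu> * fst p + snd p)) (\<lambda>p. 0)"
    "has_box U \<nu> (\<lambda>p. f i (\<nu> * fst p - snd p)) (\<lambda>p. 0)"
proof -
  obtain f' where "\<And>i x. i \<in> I \<Longrightarrow> (f i has_real_derivative f' i x) (at x)" and k: "CF (Suc k) I f'"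
    using assms(1) by (rule CF_real_SucE) blast
  note f' = this(1)[OF assms(2)]
  show "has_box U \<nu> (\<lambda>p. f i (\<nu> * fst p + snd p)) (\<lambda>p. 0)"
    using has_box_product_CF[OF k CF_const[of "Suc k" I 0] assms(2) assms(2) f', of "\<lambda>_. 1" U \<nu>] by simp
  show "has_box U \<nu> (\<lambda>p. f i (\<nu> * fst p - snd p)) (\<lambda>p. 0)"
    using has_box_product_CF[OF CF_const[of "Suc k" I 0] k assms(2) assms(2) _ f', of "\<lambda>_. 1" U \<nu>] by simp
qed

lemma CF_characteristic:
  fixes f :: "'i \<Rightarrow> real \<Rightarrow> real"
  assumes "CF k I f"
  shows "CF k I (\<lambda>i p :: real \<times> real. f i (\<nu> * fst p + snd p))"
    "CF k I (\<lambda>i p :: real \<times> real. f i (\<nu> * fst p - snd p))"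
  by (intro CF_comp1[OF assms] CF_add CF_diff CF_cmult CF_fst CF_snd)+

lemma DERIV_eq_near:
  fixes f g :: "real \<Rightarrow> real"
  assumes "(g has_real_derivative d) (at t)" "\<tau> > 0" "\<And>r. \<bar>r - t\<bar> < \<tau> \<Longrightarrow> f r = g r"
  shows "(f has_real_derivative d) (at t)"
  by (rule has_field_derivative_transform_within[OF assms(1,2)]) (use assms(3) in \<open>auto simp: dist_real_def\<close>)

context step_function
begin

text \<open>Reflection joins leftgoing rays (fixed \<xi>) and rightgoing rays (fixed \<eta>) to a
  circle of length 2L. It is cut open at time T/2: the rays then present in [0, L] are \<xi> in
  [\<sigma>, \<sigma> + L] and \<eta> in [\<sigma> - L, \<sigma>]. One chain of cubes switches each
  of these two families inside the control region, and later rays inherit the switch by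
  reflection.\<close>

lemma controlled_wave:
  fixes s :: "'i \<Rightarrow> real \<times> real \<Rightarrow> real" and v0 v1 w0 w1 :: "'i \<Rightarrow> real \<Rightarrow> real"
  assumes L: "L > 0" and \<nu>: "\<nu> > 0" and x: "0 \<le> xa" "xa < xb" "xb \<le> L" and ta: "ta \<ge> 0"
    and T: "\<nu> * (T - 2 * ta) > 2 * xa" "\<nu> * (T - 2 * ta) > 2 * (L - xb)"
    and k: "k = Suc k'"
    and s: "CF (Suc k) I s" "\<And>i t. i \<in> I \<Longrightarrow> odd_refl L (\<lambda>x. s i (t, x))"
    and data: "CF (Suc k) I v0" "CF k I v1" "CF (Suc k) I w0" "CF k I w1"
      "\<And>i. i \<in> I \<Longrightarrow> odd_refl L (v0 i)" "\<And>i. i \<in> I \<Longrightarrow> odd_refl L (v1 i)"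
      "\<And>i. i \<in> I \<Longrightarrow> odd_refl L (w0 i)" "\<And>i. i \<in> I \<Longrightarrow> odd_refl L (w1 i)"
  obtains v \<Omega> where "CF k I v" "CF k I \<Omega>"
    "\<And>i. i \<in> I \<Longrightarrow> has_box UNIV \<nu> (v i) (\<lambda>p. s i p + \<Omega> i p ^ 3)"
    "\<And>i x. i \<in> I \<Longrightarrow> 0 \<le> x \<Longrightarrow> x \<le> L \<Longrightarrow> v i (0, x) = v0 i x"
    "\<And>i x. i \<in> I \<Longrightarrow> 0 \<le> x \<Longrightarrow> x \<le> L \<Longrightarrow> ((\<lambda>t. v i (t, x)) has_real_derivative v1 i x) (at 0)"
    "\<And>i x. i \<in> I \<Longrightarrow> 0 \<le> x \<Longrightarrow> x \<le> L \<Longrightarrow> v i (T, x) = w0 i x"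
    "\<And>i x. i \<in> I \<Longrightarrow> 0 \<le> x \<Longrightarrow> x \<le> L \<Longrightarrow> ((\<lambda>t. v i (t, x)) has_real_derivative w1 i x) (at T)"
    "\<And>i t. i \<in> I \<Longrightarrow> v i (t, 0) = 0" "\<And>i t. i \<in> I \<Longrightarrow> v i (t, L) = 0"
    "\<And>i t x. i \<in> I \<Longrightarrow> \<Omega> i (t, x) \<noteq> 0 \<Longrightarrow> ta \<le> t \<and> t \<le> T - ta \<and> xa \<le> x \<and> x \<le> xb"
proof -
  obtain Z Zt where Z: "CF (Suc k) I Z" "CF (Suc k) I Zt"
    and Zt: "\<And>i t x. i \<in> I \<Longrightarrow> ((\<lambda>r. Z i (r, x)) has_real_derivative Zt i (t, x)) (at t)"
    and Zbox: "\<And>i. i \<in> I \<Longrightarrow> has_box UNIV \<nu> (Z i) (s i)"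
    and Z0: "\<And>i x. i \<in> I \<Longrightarrow> Z i (0, x) = 0" "\<And>i x. i \<in> I \<Longrightarrow> Zt i (0, x) = 0"
    and Zo: "\<And>i t. i \<in> I \<Longrightarrow> odd_refl L (\<lambda>x. Z i (t, x))" "\<And>i t. i \<in> I \<Longrightarrow> odd_refl L (\<lambda>x. Zt i (t, x))"
    proof (rule duhamel[OF s \<nu>], assumption, goal_cases)
    case (1 Z Zt)
    show ?case by (rule that[of Z Zt]) (fact 1)+
  qed
  obtain f0 where f0: "CF (Suc k) I f0" "\<And>i x. i \<in> I \<Longrightarrow> f0 i (x + 2 * L) = f0 i x"
    "\<And>i x. i \<in> I \<Longrightarrow> f0 i x - f0 i (- x) = v0 i x"
    "\<And>i x. i \<in> I \<Longrightarrow> ((\<lambda>t. f0 i (\<nu> * t + x) - f0 i (\<nu> * t - x)) has_real_derivative v1 i x) (at 0)"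
    proof (rule dAlembert[OF data(1,2,5,6) \<nu>], assumption, assumption, goal_cases)
    case (1 f0)
    show ?case by (rule that[of f0]) (fact 1)+
  qed
  have atT: "CF n I (\<lambda>i x. z i (T, x))" if "CF n I z" for n and z :: "'i \<Rightarrow> real \<times> real \<Rightarrow> real"
    by (intro CF_comp2[OF that] CF_const CF_ident)
  have odd_T: "odd_refl L (\<lambda>x. w0 i x - Z i (T, x))" "odd_refl L (\<lambda>x. w1 i x - Zt i (T, x))" if "i \<in> I" for i
    using data(7,8)[OF that] Zo[OF that, of T] unfolding odd_refl_def by simp_all
  \<comment> \<open>Duhamel's term \<open>Z\<close> takes care of the prescribed source, so the free
    part has to reach the final data diminished by \<open>Z\<close> and \<open>Zt\<close> at time
    T.\<close>
  obtain f1 where f1: "CF (Suc k) I f1" "\<And>i x. i \<in> I \<Longrightarrow> f1 i (x + 2 * L) = f1 i x"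
    "\<And>i x. i \<in> I \<Longrightarrow> f1 i x - f1 i (- x) = w0 i x - Z i (T, x)"
    "\<And>i x. i \<in> I \<Longrightarrow> ((\<lambda>t. f1 i (\<nu> * t + x) - f1 i (\<nu> * t - x)) has_real_derivative w1 i x - Zt i (T, x)) (at 0)"
proof (rule dAlembert[OF CF_diff[OF data(3) atT[OF Z(1)]] CF_diff[OF data(4) atT[OF CF_Suc_D[OF Z(2)]]] odd_T \<nu>], assumption, assumption, goal_cases)
    case (1 f1)
    show ?case by (rule that[of f1]) (fact 1)+
  qed
  \<comment> \<open>In absolute phase the final profile is f1 delayed by \<nu>T; F is what has to be
    added to f0 on every ray.\<close>
  define F where "F = (\<lambda>i y. f1 i (y - \<nu> * T) - f0 i y)"
  have F: "CF (Suc k) I F"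
    unfolding F_def by (intro CF_diff f0(1) CF_comp1[OF f1(1)] CF_ident CF_const)
  have Fper: "F i (y + 2 * L) = F i y" if "i \<in> I" for i y
    using f1(2)[OF that, of "y - \<nu> * T"] f0(2)[OF that, of y] by (simp add: F_def algebra_simps)

  define \<sigma> where "\<sigma> = \<nu> * T / 2"
  have T': "\<sigma> - \<nu> * ta > xa" "\<sigma> - \<nu> * ta > L - xb"
    using T by (simp_all add: \<sigma>_def algebra_simps)
  \<comment> \<open>An eighth of the smallest margin among the width of the region and the two
    reserves of travel time; all roundings below are charged to multiples of m.\<close>
  define m where "m = min (xb - xa) (min (\<sigma> - \<nu> * ta - xa) (\<sigma> - \<nu> * ta - (L - xb))) / 8"
  have m: "m > 0" "8 * m \<le> xb - xa" "8 * m \<le> \<sigma> - \<nu> * ta - xa" "8 * m \<le> \<sigma> - \<nu> * ta - (L - xb)"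
    using T' x by (auto simp: m_def)
  \<comment> \<open>This gives 24 \<epsilon> < m. A cell reaches at most 4 \<epsilon> from its
    centre in x, so cells of the two chains stay apart when their centres are m / 2 apart.\<close>
  obtain N :: nat where N: "24 * L / m < real N"
    using reals_Archimedean2 by blast
  have Npos: "N > 0"
    using N L m(1) by (metis divide_pos_pos gr0I less_asym mult_pos_pos of_nat_0 zero_less_numeral)
  define \<epsilon> where "\<epsilon> = L / real N"
  have \<epsilon>: "\<epsilon> > 0" "24 * \<epsilon> < m" "real N * \<epsilon> = L"
    using N L m(1) Npos by (auto simp: \<epsilon>_def field_simps)
  \<comment> \<open>Moves a position at time T/2 into the inner part of the control region. The
    displacement is at most xa + 2m or L - xb + 2m, which a ray covers within the available
    time.\<close>
  define cl where "cl = (\<lambda>z. max (xa + 2 * m) (min (xb - 2 * m) z))"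
  have cl: "xa + 2 * m \<le> cl z" "cl z \<le> xb - 2 * m" "0 \<le> z \<Longrightarrow> cl z - z \<le> xa + 2 * m" "z \<le> L \<Longrightarrow> z - cl z \<le> L - xb + 2 * m" for z
    using m x by (auto simp: cl_def)
  \<comment> \<open>The switching places of leftgoing rays are rounded to multiples of m, those of
    rightgoing rays to odd multiples of m / 2. So the two kinds of places are at least m / 2 apart,
    even though rays of both kinds cross.\<close>
  define XP where "XP = (\<lambda>n. m * of_int \<lfloor>cl (real n * \<epsilon>) / m\<rfloor>)"
  define XQ where "XQ = (\<lambda>n. m * of_int \<lfloor>cl (L - real n * \<epsilon>) / m\<rfloor> + m / 2)"
  have fl: "y - m \<le> m * of_int \<lfloor>y / m\<rfloor>" "m * of_int \<lfloor>y / m\<rfloor> \<le> y" for y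
    using mult_left_mono[OF of_int_floor_le[of "y / m"], of m] real_of_int_floor_add_one_gt[of "y / m"] m(1)
    by (simp_all add: field_simps)
  have n\<epsilon>: "0 \<le> real n * \<epsilon>" "n < N \<Longrightarrow> real n * \<epsilon> \<le> L" for n
  proof -
    show "0 \<le> real n * \<epsilon>" using \<epsilon> by simp
    assume "n < N"
    then have "real n * \<epsilon> \<le> real N * \<epsilon>" using \<epsilon> by (intro mult_right_mono) auto
    then show "real n * \<epsilon> \<le> L" using \<epsilon> by simp
  qed
  have XP: "xa + m \<le> XP n" "XP n \<le> xb - 2 * m" "n < N \<Longrightarrow> real n * \<epsilon> - XP n \<le> L - xb + 3 * m"
    "n < N \<Longrightarrow> real n * \<epsilon> - XP n \<ge> - xa - 2 * m" for n
    using fl[of "cl (real n * \<epsilon>)"] cl[of "real n * \<epsilon>"] n\<epsilon>[of n] by (auto simp: XP_def)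
  have XQ: "xa + m \<le> XQ n" "XQ n \<le> xb - m" "n < N \<Longrightarrow> L - real n * \<epsilon> - XQ n \<le> L - xb + 3 * m"
    "n < N \<Longrightarrow> L - real n * \<epsilon> - XQ n \<ge> - xa - 3 * m" for n
    using fl[of "cl (L - real n * \<epsilon>)"] cl[of "L - real n * \<epsilon>"] n\<epsilon>[of n] m(1) by (auto simp: XQ_def)
  \<comment> \<open>As \<xi> - \<eta> = 2x, the ray \<xi> = \<sigma> + n \<epsilon> is at the place
    XP n when \<eta> has this value; likewise for the rays of the other family and XQ n.\<close>
  define YP where "YP = (\<lambda>n. \<sigma> + real n * \<epsilon> - 2 * XP n)"
  define YQ where "YQ = (\<lambda>n. (\<sigma> - L) + real n * \<epsilon> + 2 * XQ n)"
  obtain f c g b where fc: "\<And>j. CF (Suc k) I (f j)" "\<And>j. smooth (Suc k) (g j)"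
    "\<And>j. CF k I (c j)" "\<And>j. smooth k (b j)"
    "\<And>j i p. j < 2 * N \<Longrightarrow> i \<in> I \<Longrightarrow> (f j i has_real_derivative c j i p ^ 3) (at p)"
    "\<And>j q. (g j has_real_derivative b j q ^ 3) (at q)"
    "\<And>j l q. j < 2 * N \<Longrightarrow> l < 2 * N \<Longrightarrow> j \<noteq> l \<Longrightarrow> b j q * b l q = 0"
    "\<And>j i p. c j i p \<noteq> 0 \<Longrightarrow> \<sigma> + real (j div 2) * \<epsilon> - \<epsilon> \<le> p \<and> p \<le> \<sigma> + real (j div 2) * \<epsilon> + 7 * \<epsilon>"
    "\<And>j q. j < 2 * N \<Longrightarrow> b j q \<noteq> 0 \<Longrightarrow> \<bar>q - YP (j div 2)\<bar> \<le> \<epsilon>"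
    "\<And>i p q. (\<And>k. k < N \<Longrightarrow> \<sigma> + real k * \<epsilon> - \<epsilon> \<le> p \<Longrightarrow> p \<le> \<sigma> + real k * \<epsilon> + 7 * \<epsilon> \<Longrightarrow> q \<le> YP k - \<epsilon>)
       \<Longrightarrow> (\<Sum>j<2*N. f j i p * g j q) = 0"
    "\<And>i p q. (\<And>k. k < N \<Longrightarrow> \<sigma> + real k * \<epsilon> - \<epsilon> \<le> p \<Longrightarrow> p \<le> \<sigma> + real k * \<epsilon> + 7 * \<epsilon> \<Longrightarrow> q \<ge> YP k + \<epsilon>)
       \<Longrightarrow> (\<Sum>j<2*N. f j i p * g j q) = F i p * (S ((p - \<sigma>) / \<epsilon>) - S ((p - (\<sigma> + real N * \<epsilon>)) / \<epsilon>))"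
    proof (rule cube_chain[OF F \<epsilon>(1) Npos, of \<sigma> YP], goal_cases)
    case (1 f c g b)
    show ?case by (rule that[of f g c b]) (fact 1)+
  qed
  obtain f' c' g' b' where fc': "\<And>j. CF (Suc k) I (f' j)" "\<And>j. smooth (Suc k) (g' j)"
    "\<And>j. CF k I (c' j)" "\<And>j. smooth k (b' j)"
    "\<And>j i p. j < 2 * N \<Longrightarrow> i \<in> I \<Longrightarrow> (f' j i has_real_derivative c' j i p ^ 3) (at p)"
    "\<And>j q. (g' j has_real_derivative b' j q ^ 3) (at q)"
    "\<And>j l q. j < 2 * N \<Longrightarrow> l < 2 * N \<Longrightarrow> j \<noteq> l \<Longrightarrow> b' j q * b' l q = 0"
    "\<And>j i p. c' j i p \<noteq> 0 \<Longrightarrow> (\<sigma> - L) + real (j div 2) * \<epsilon> - \<epsilon> \<le> p \<and> p \<le> (\<sigma> - L) + real (j div 2) * \<epsilon> + 7 * \<epsilon>"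
    "\<And>j q. j < 2 * N \<Longrightarrow> b' j q \<noteq> 0 \<Longrightarrow> \<bar>q - YQ (j div 2)\<bar> \<le> \<epsilon>"
    "\<And>i p q. (\<And>k. k < N \<Longrightarrow> (\<sigma> - L) + real k * \<epsilon> - \<epsilon> \<le> p \<Longrightarrow> p \<le> (\<sigma> - L) + real k * \<epsilon> + 7 * \<epsilon> \<Longrightarrow> q \<le> YQ k - \<epsilon>)
       \<Longrightarrow> (\<Sum>j<2*N. f' j i p * g' j q) = 0"
    "\<And>i p q. (\<And>k. k < N \<Longrightarrow> (\<sigma> - L) + real k * \<epsilon> - \<epsilon> \<le> p \<Longrightarrow> p \<le> (\<sigma> - L) + real k * \<epsilon> + 7 * \<epsilon> \<Longrightarrow> q \<ge> YQ k + \<epsilon>)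
       \<Longrightarrow> (\<Sum>j<2*N. f' j i p * g' j q) = F i p * (S ((p - (\<sigma> - L)) / \<epsilon>) - S ((p - ((\<sigma> - L) + real N * \<epsilon>)) / \<epsilon>))"
    proof (rule cube_chain[OF F \<epsilon>(1) Npos, of "\<sigma> - L" YQ], goal_cases)
    case (1 f' c' g' b')
    show ?case by (rule that[of f' g' c' b']) (fact 1)+
  qed

  \<comment> \<open>In each bracket the chain switches the rays inside the window, and a free
    travelling term takes over where the window ends, at \<xi> = \<sigma> + L and at \<eta> =
    \<sigma>.\<close>
  define e where "e = (\<lambda>i \<xi> \<eta>. (F i \<xi> * S ((\<xi> - (\<sigma> + L)) / \<epsilon>) + (\<Sum>j<2*N. f j i \<xi> * g j \<eta>)) -
     (F i \<eta> * S ((\<eta> - \<sigma>) / \<epsilon>) + (\<Sum>j<2*N. f' j i \<eta> * g' j \<xi>)))"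
  define v where "v = (\<lambda>i p. Z i p + (f0 i (\<nu> * fst p + snd p) - f0 i (\<nu> * fst p - snd p)) + e i (\<nu> * fst p + snd p) (\<nu> * fst p - snd p))"
  define \<Omega>P where "\<Omega>P = (\<lambda>i \<xi> \<eta>. \<Sum>j<2*N. c j i \<xi> * b j \<eta>)"
  define \<Omega>Q where "\<Omega>Q = (\<lambda>i \<xi> \<eta>. \<Sum>j<2*N. c' j i \<eta> * b' j \<xi>)"
  \<comment> \<open>The cube root of 4\<nu>^2 accounts for the factor in the wave operator, and the
    minus sign for that of the second bracket, since the cube is odd.\<close>
  define \<Omega> where "\<Omega> = (\<lambda>i p. root 3 (4 * \<nu>\<^sup>2) * (\<Omega>P i (\<nu> * fst p + snd p) (\<nu> * fst p - snd p) - \<Omega>Q i (\<nu> * fst p + snd p) (\<nu> * fst p - snd p)))"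

  \<comment> \<open>Until \<nu>t = \<nu>ta + m no ray inside [0, L] has met its switching cell, and
    the travelling terms have not begun.\<close>
  have early: "e i (\<nu> * t + x) (\<nu> * t - x) = 0" if "\<nu> * t \<le> \<nu> * ta + m" "0 \<le> x" "x \<le> L" for i t x
  proof -
    have "(\<Sum>j<2*N. f j i (\<nu> * t + x) * g j (\<nu> * t - x)) = 0"
      by (rule fc(10)) (use that m \<epsilon> XP in \<open>force simp: YP_def\<close>)
    moreover have "(\<Sum>j<2*N. f' j i (\<nu> * t - x) * g' j (\<nu> * t + x)) = 0"
      by (rule fc'(10)) (use that m \<epsilon> XQ in \<open>force simp: YQ_def\<close>)
    moreover have "S ((\<nu> * t + x - (\<sigma> + L)) / \<epsilon>) = 0" "S ((\<nu> * t - x - \<sigma>) / \<epsilon>) = 0"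
      using that m \<epsilon> x by (auto intro!: S0 divide_nonpos_pos)
    ultimately show ?thesis
      by (simp add: e_def)
  qed
  have late: "e i (\<nu> * t + x) (\<nu> * t - x) = F i (\<nu> * t + x) - F i (\<nu> * t - x)"
    if "\<nu> * t \<ge> \<nu> * T - \<nu> * ta - m" "0 \<le> x" "x \<le> L" for i t x
  proof -
    have t: "\<nu> * t \<ge> 2 * \<sigma> - \<nu> * ta - m"
      using that by (simp add: \<sigma>_def)
    have "(\<Sum>j<2*N. f j i (\<nu> * t + x) * g j (\<nu> * t - x)) = F i (\<nu> * t + x) * (S ((\<nu> * t + x - \<sigma>) / \<epsilon>) - S ((\<nu> * t + x - (\<sigma> + L)) / \<epsilon>))"
      by (rule fc(11)[unfolded \<epsilon>(3)]) (use t m \<epsilon> XP in \<open>force simp: YP_def\<close>)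
    moreover have "(\<Sum>j<2*N. f' j i (\<nu> * t - x) * g' j (\<nu> * t + x)) = F i (\<nu> * t - x) * (S ((\<nu> * t - x - (\<sigma> - L)) / \<epsilon>) - S ((\<nu> * t - x - ((\<sigma> - L) + L)) / \<epsilon>))"
      by (rule fc'(11)[unfolded \<epsilon>(3)]) (use t m \<epsilon> XQ in \<open>force simp: YQ_def\<close>)
    moreover have "S ((\<nu> * t + x - \<sigma>) / \<epsilon>) = 1" "S ((\<nu> * t - x - (\<sigma> - L)) / \<epsilon>) = 1"
      using t that m \<epsilon> x by (auto intro!: S1 simp: le_divide_eq)
    ultimately show ?thesis
      by (simp add: e_def algebra_simps)
  qed
  have XP_bd: "XP n > 0" "XP n \<ge> 4 * \<epsilon>" "XP n \<le> L - 4 * \<epsilon>" and XQ_bd: "XQ n > 0" "XQ n \<ge> 4 * \<epsilon>" "XQ n \<le> L - 4 * \<epsilon>" for n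
    using XP(1,2)[of n] XQ(1,2)[of n] m \<epsilon> x by linarith+
  \<comment> \<open>At x = 0 a leftgoing ray has already passed its cell and a rightgoing one has
    not met its own. Both brackets then reduce to F(y) times the transition at \<sigma>.\<close>
  have left: "e i y y = 0" for i y
  proof -
    have "(\<Sum>j<2*N. f j i y * g j y) = F i y * (S ((y - \<sigma>) / \<epsilon>) - S ((y - (\<sigma> + L)) / \<epsilon>))"
      by (rule fc(11)[unfolded \<epsilon>(3)]) (use XP_bd \<epsilon>(1) in \<open>smt (verit) YP_def\<close>)
    moreover have "(\<Sum>j<2*N. f' j i y * g' j y) = 0"
      by (rule fc'(10)) (use XQ_bd \<epsilon>(1) in \<open>smt (verit) YQ_def\<close>)
    ultimately show ?thesis
      by (simp add: e_def algebra_simps)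
  qed
  \<comment> \<open>At x = L the roles are exchanged. Both brackets carry the transition of y at
    \<sigma>, and the arguments of F differ by 2L, so periodicity makes them equal.\<close>
  have right: "e i (y + L) (y - L) = 0" if "i \<in> I" for i y
  proof -
    have "(\<Sum>j<2*N. f j i (y + L) * g j (y - L)) = 0"
      by (rule fc(10)) (use XP_bd \<epsilon>(1) in \<open>smt (verit) YP_def\<close>)
    moreover have "(\<Sum>j<2*N. f' j i (y - L) * g' j (y + L)) = F i (y - L) * (S (((y - L) - (\<sigma> - L)) / \<epsilon>) - S (((y - L) - ((\<sigma> - L) + L)) / \<epsilon>))"
      by (rule fc'(11)[unfolded \<epsilon>(3)]) (use XQ_bd \<epsilon>(1) in \<open>smt (verit) YQ_def\<close>)
    moreover have "F i (y + L) = F i (y - L)"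
      using Fper[OF that, of "y - L"] by (simp add: add.commute)
    ultimately show ?thesis
      by (simp add: e_def algebra_simps)
  qed
  have P_cell: "\<exists>n<N. 2 * \<bar>x - XP n\<bar> \<le> 8 * \<epsilon> \<and> 2 * \<bar>\<nu> * t - (\<sigma> + real n * \<epsilon> - XP n)\<bar> \<le> 8 * \<epsilon>"
    if "\<Omega>P i (\<nu> * t + x) (\<nu> * t - x) \<noteq> 0" for i t x
  proof -
    note nz = that[unfolded \<Omega>P_def]
    obtain j where j: "j < 2 * N" "c j i (\<nu> * t + x) \<noteq> 0" "b j (\<nu> * t - x) \<noteq> 0"
      using sum.not_neutral_contains_not_neutral[OF nz] by (metis lessThan_iff mult_eq_0_iff)
    show ?thesis
    proof (intro exI[of _ "j div 2"] conjI)
      show "j div 2 < N" using j by auto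
    qed (use conjunct1[OF fc(8)[OF j(2)]] conjunct2[OF fc(8)[OF j(2)]] fc(9)[OF j(1,3), unfolded YP_def] \<epsilon>(1) in \<open>simp_all add: abs_le_iff\<close>)
  qed
  have Q_cell: "\<exists>n<N. 2 * \<bar>x - XQ n\<bar> \<le> 8 * \<epsilon> \<and> 2 * \<bar>\<nu> * t - (\<sigma> - L + real n * \<epsilon> + XQ n)\<bar> \<le> 8 * \<epsilon>"
    if "\<Omega>Q i (\<nu> * t + x) (\<nu> * t - x) \<noteq> 0" for i t x
  proof -
    note nz = that[unfolded \<Omega>Q_def]
    obtain j where j: "j < 2 * N" "c' j i (\<nu> * t - x) \<noteq> 0" "b' j (\<nu> * t + x) \<noteq> 0"
      using sum.not_neutral_contains_not_neutral[OF nz] by (metis lessThan_iff mult_eq_0_iff)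
    show ?thesis
    proof (intro exI[of _ "j div 2"] conjI)
      show "j div 2 < N" using j by auto
    qed (use conjunct1[OF fc'(8)[OF j(2)]] conjunct2[OF fc'(8)[OF j(2)]] fc'(9)[OF j(1,3), unfolded YQ_def] \<epsilon>(1) in \<open>simp_all add: abs_le_iff\<close>)
  qed
  have disjoint: "\<Omega>P i (\<nu> * t + x) (\<nu> * t - x) * \<Omega>Q i (\<nu> * t + x) (\<nu> * t - x) = 0" for i t x
  proof (rule ccontr)
    assume "\<not> ?thesis"
    then obtain n l where "2 * \<bar>x - XP n\<bar> \<le> 8 * \<epsilon>" "2 * \<bar>x - XQ l\<bar> \<le> 8 * \<epsilon>"
      using P_cell[of i t x] Q_cell[of i t x] by auto
    then have "\<bar>XQ l - XP n\<bar> \<le> 8 * \<epsilon>" by (smt (verit))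
    moreover define z where "z = \<lfloor>cl (L - real l * \<epsilon>) / m\<rfloor> - \<lfloor>cl (real n * \<epsilon>) / m\<rfloor>"
    have "XQ l - XP n = m * of_int z + m / 2"
      by (simp add: XQ_def XP_def z_def algebra_simps)
    \<comment> \<open>An odd multiple of m / 2 is never small.\<close>
    moreover have "\<bar>m * of_int z + m / 2\<bar> \<ge> m / 2"
    proof (cases "z \<ge> 0")
      case True
      then have "m * of_int z \<ge> 0" using m(1) by simp
      then show ?thesis by linarith
    next
      case False
      then have "real_of_int z \<le> -1" by linarith
      then have "m * of_int z \<le> m * (-1)" using m(1) by (intro mult_left_mono) auto
      then show ?thesis using m(1) by linarith
    qed
    ultimately show False
      using \<epsilon> m(1) by linarith
  qed
  have box: "has_box UNIV \<nu> (v i) (\<lambda>p. s i p + \<Omega> i p ^ 3)" if i: "i \<in> I" for i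
  proof -
    \<comment> \<open>The cubes are first derivatives of the factors of the products and must be
      differentiable themselves for the wave operator; hence \<open>k = Suc k'\<close>.\<close>
    note CFk = CF_power[OF fc(3)[unfolded k], where n = 3] CF_power[OF fc(4)[unfolded k], where n = 3]
      CF_power[OF fc'(3)[unfolded k], where n = 3] CF_power[OF fc'(4)[unfolded k], where n = 3]
    have P: "has_box UNIV \<nu> (\<lambda>p. f j i (\<nu> * fst p + snd p) * g j (\<nu> * fst p - snd p))
        (\<lambda>p. 4 * \<nu>\<^sup>2 * (c j i (\<nu> * fst p + snd p) ^ 3 * b j (\<nu> * fst p - snd p) ^ 3))" if "j < 2 * N" for j
      by (rule has_box_product_CF[OF CFk(1) CFk(2) i UNIV_I fc(5)[OF that i] fc(6)])
    have Q: "has_box UNIV \<nu> (\<lambda>p. g' j (\<nu> * fst p + snd p) * f' j i (\<nu> * fst p - snd p))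
        (\<lambda>p. 4 * \<nu>\<^sup>2 * (b' j (\<nu> * fst p + snd p) ^ 3 * c' j i (\<nu> * fst p - snd p) ^ 3))" if "j < 2 * N" for j
      by (rule has_box_product_CF[OF CFk(4) CFk(3) UNIV_I i fc'(6) fc'(5)[OF that i]])
    have W: "CF (Suc (Suc k')) I (\<lambda>i y. F i y * S ((y - z) / \<epsilon>))" for z
      using CF_mult[OF F CF_S[OF CF_affine]] k by simp
    have f02: "CF (Suc (Suc k')) I f0"
      using f0(1) k by simp
    have "has_box UNIV \<nu> (\<lambda>p. Z i p + (f0 i (\<nu> * fst p + snd p) - f0 i (\<nu> * fst p - snd p)) +
       ((F i (\<nu> * fst p + snd p) * S ((\<nu> * fst p + snd p - (\<sigma> + L)) / \<epsilon>) +
          (\<Sum>j<2*N. f j i (\<nu> * fst p + snd p) * g j (\<nu> * fst p - snd p))) -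
        (F i (\<nu> * fst p - snd p) * S ((\<nu> * fst p - snd p - \<sigma>) / \<epsilon>) +
          (\<Sum>j<2*N. g' j (\<nu> * fst p + snd p) * f' j i (\<nu> * fst p - snd p)))))
      (\<lambda>p. s i p + (0 - 0) + ((0 + (\<Sum>j<2*N. 4 * \<nu>\<^sup>2 * (c j i (\<nu> * fst p + snd p) ^ 3 * b j (\<nu> * fst p - snd p) ^ 3))) -
         (0 + (\<Sum>j<2*N. 4 * \<nu>\<^sup>2 * (b' j (\<nu> * fst p + snd p) ^ 3 * c' j i (\<nu> * fst p - snd p) ^ 3)))))"
      by (intro has_box_add has_box_diff has_box_sum Zbox[OF i] has_box_travelling[OF f02 i]
          has_box_travelling[OF W i] P Q) auto
    then show ?thesis
    proof (rule has_box_cong)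
      fix p :: "real \<times> real"
      show "Z i p + (f0 i (\<nu> * fst p + snd p) - f0 i (\<nu> * fst p - snd p)) +
       ((F i (\<nu> * fst p + snd p) * S ((\<nu> * fst p + snd p - (\<sigma> + L)) / \<epsilon>) +
          (\<Sum>j<2*N. f j i (\<nu> * fst p + snd p) * g j (\<nu> * fst p - snd p))) -
        (F i (\<nu> * fst p - snd p) * S ((\<nu> * fst p - snd p - \<sigma>) / \<epsilon>) +
          (\<Sum>j<2*N. g' j (\<nu> * fst p + snd p) * f' j i (\<nu> * fst p - snd p)))) = v i p"
        by (simp add: v_def e_def mult.commute)
      obtain t x where p: "p = (t, x)" by (cases p)
      let ?\<xi> = "\<nu> * fst p + snd p" and ?\<eta> = "\<nu> * fst p - snd p"
      have d: "\<Omega>P i ?\<xi> ?\<eta> = 0 \<or> \<Omega>Q i ?\<xi> ?\<eta> = 0"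
        using disjoint[of i t x] by (simp add: p)
      have "(\<Omega>P i ?\<xi> ?\<eta> - \<Omega>Q i ?\<xi> ?\<eta>) ^ 3 = \<Omega>P i ?\<xi> ?\<eta> ^ 3 - \<Omega>Q i ?\<xi> ?\<eta> ^ 3"
        using d by (auto simp: power_minus_odd)
      then have "\<Omega> i p ^ 3 = 4 * \<nu>\<^sup>2 * (\<Omega>P i ?\<xi> ?\<eta> ^ 3 - \<Omega>Q i ?\<xi> ?\<eta> ^ 3)"
        using odd_real_root_pow[of 3 "4 * \<nu>\<^sup>2"] by (simp add: \<Omega>_def power_mult_distrib)
      moreover have "\<Omega>P i ?\<xi> ?\<eta> ^ 3 = (\<Sum>j<2*N. c j i ?\<xi> ^ 3 * b j ?\<eta> ^ 3)"
        unfolding \<Omega>P_def by (subst sum_cube_disjoint) (use fc(7) in \<open>auto simp: power_mult_distrib\<close>)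
      moreover have "\<Omega>Q i ?\<xi> ?\<eta> ^ 3 = (\<Sum>j<2*N. b' j ?\<xi> ^ 3 * c' j i ?\<eta> ^ 3)"
        unfolding \<Omega>Q_def by (subst sum_cube_disjoint) (use fc'(7) in \<open>auto simp: power_mult_distrib mult.commute\<close>)
      ultimately show "s i p + (0 - 0) + ((0 + (\<Sum>j<2*N. 4 * \<nu>\<^sup>2 * (c j i ?\<xi> ^ 3 * b j ?\<eta> ^ 3))) -
         (0 + (\<Sum>j<2*N. 4 * \<nu>\<^sup>2 * (b' j ?\<xi> ^ 3 * c' j i ?\<eta> ^ 3)))) = s i p + \<Omega> i p ^ 3"
        by (simp add: sum_distrib_left[symmetric] algebra_simps)
    qed
  qed
  show ?thesis
  proof (rule that[of v \<Omega>])
    note kk = CF_Suc_D[OF F] CF_Suc_D[OF f0(1)] CF_Suc_D[OF fc(1)] CF_Suc_D[OF fc'(1)] CF_Suc_D[OF Z(1)]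
      CF_smooth[OF CF_Suc_D[OF fc(2)]] CF_smooth[OF CF_Suc_D[OF fc'(2)]]
    have Sk: "CF k I (\<lambda>i y. S ((y - z) / \<epsilon>))" for z
      by (rule CF_Suc_D[OF CF_S[OF CF_affine]])
    show "CF k I v"
      unfolding v_def e_def
      by (intro CF_add CF_diff CF_sum CF_mult kk(5)
          CF_characteristic[OF kk(1)] CF_characteristic[OF kk(2)] CF_characteristic[OF kk(3)] CF_characteristic[OF kk(4)]
          CF_characteristic[OF kk(6)] CF_characteristic[OF kk(7)] CF_characteristic[OF Sk])
    show "CF k I \<Omega>"
      unfolding \<Omega>_def \<Omega>P_def \<Omega>Q_def
      by (intro CF_cmult CF_diff CF_sum CF_mult CF_characteristic[OF fc(3)] CF_characteristic[OF fc'(3)]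
          CF_characteristic[OF CF_smooth[OF fc(4)]] CF_characteristic[OF CF_smooth[OF fc'(4)]])
  next
    fix i assume "i \<in> I"
    then show "has_box UNIV \<nu> (v i) (\<lambda>p. s i p + \<Omega> i p ^ 3)" by (rule box)
  next
    fix i and x :: real assume i: "i \<in> I" and x0: "0 \<le> x" and xL: "x \<le> L"
    have near0: "v i (t, x) = Z i (t, x) + (f0 i (\<nu> * t + x) - f0 i (\<nu> * t - x))" if "\<bar>t - 0\<bar> < m / \<nu>" for t
    proof -
      have "t < m / \<nu>" using that by linarith
      then have "\<nu> * t \<le> m" using \<nu> by (simp add: field_simps)
      then have "\<nu> * t \<le> \<nu> * ta + m" using \<nu> ta by (simp add: add_increasing)
      then show ?thesis
        using early[of t x i] x0 xL by (simp add: v_def)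
    qed
    show "v i (0, x) = v0 i x"
      using near0[of 0] \<nu> m(1) Z0(1)[OF i] f0(3)[OF i] by simp
    show "((\<lambda>t. v i (t, x)) has_real_derivative v1 i x) (at 0)"
      by (rule DERIV_eq_near[OF _ _ near0])
        (use DERIV_add[OF Zt[OF i, where t = 0 and x = x] f0(4)[OF i, of x]] Z0(2)[OF i] \<nu> m(1) in simp_all)
    have nearT: "v i (t, x) = Z i (t, x) + (f1 i (\<nu> * (t - T) + x) - f1 i (\<nu> * (t - T) - x))" if "\<bar>t - T\<bar> < m / \<nu>" for t
    proof -
      have "T - t < m / \<nu>" using that by linarith
      then have "\<nu> * (T - t) \<le> m" using \<nu> by (simp add: field_simps)
      moreover have "0 \<le> \<nu> * ta" using \<nu> ta by simp
      ultimately have "\<nu> * t \<ge> \<nu> * T - \<nu> * ta - m"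
        unfolding right_diff_distrib by linarith
      then show ?thesis
        using late[of t x i] x0 xL by (simp add: v_def F_def algebra_simps)
    qed
    show "v i (T, x) = w0 i x"
      using nearT[of T] \<nu> m(1) f1(3)[OF i] by simp
    have "((\<lambda>t. f1 i (\<nu> * (t - T) + x) - f1 i (\<nu> * (t - T) - x)) has_real_derivative w1 i x - Zt i (T, x)) (at T)"
      using f1(4)[OF i, of x] DERIV_shift[of "\<lambda>t. f1 i (\<nu> * t + x) - f1 i (\<nu> * t - x)" "w1 i x - Zt i (T, x)" T "- T"] by simp
    from DERIV_add[OF Zt[OF i, where t = T and x = x] this]
    have "((\<lambda>t. Z i (t, x) + (f1 i (\<nu> * (t - T) + x) - f1 i (\<nu> * (t - T) - x))) has_real_derivative w1 i x) (at T)"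
      by simp
    then show "((\<lambda>t. v i (t, x)) has_real_derivative w1 i x) (at T)"
      by (rule DERIV_eq_near[where \<tau> = "m / \<nu>"]) (use \<nu> m(1) nearT in auto)
  next
    fix i t assume i: "i \<in> I"
    show "v i (t, 0) = 0"
      using left[of i "\<nu> * t"] odd_reflD(5)[OF Zo(1)[OF i]] by (simp add: v_def)
    show "v i (t, L) = 0"
      using right[OF i, of "\<nu> * t"] odd_reflD(6)[OF Zo(1)[OF i]] f0(2)[OF i, of "\<nu> * t - L"]
      by (simp add: v_def add.commute[of L])
  next
    fix i t x assume i: "i \<in> I" and "\<Omega> i (t, x) \<noteq> 0"
    then have "\<Omega>P i (\<nu> * t + x) (\<nu> * t - x) \<noteq> 0 \<or> \<Omega>Q i (\<nu> * t + x) (\<nu> * t - x) \<noteq> 0"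
      by (auto simp: \<Omega>_def)
    then have "\<nu> * ta \<le> \<nu> * t \<and> \<nu> * t \<le> 2 * \<sigma> - \<nu> * ta \<and> xa \<le> x \<and> x \<le> xb"
    proof
      assume "\<Omega>P i (\<nu> * t + x) (\<nu> * t - x) \<noteq> 0"
      then obtain n where n: "n < N" "2 * \<bar>x - XP n\<bar> \<le> 8 * \<epsilon>" "2 * \<bar>\<nu> * t - (\<sigma> + real n * \<epsilon> - XP n)\<bar> \<le> 8 * \<epsilon>"
        using P_cell by blast
      show ?thesis
        using n(2,3) XP(1,2)[of n] XP(3,4)[OF n(1)] m \<epsilon>(1,2) by (intro conjI; smt (verit))
    next
      assume "\<Omega>Q i (\<nu> * t + x) (\<nu> * t - x) \<noteq> 0"
      then obtain n where n: "n < N" "2 * \<bar>x - XQ n\<bar> \<le> 8 * \<epsilon>" "2 * \<bar>\<nu> * t - (\<sigma> - L + real n * \<epsilon> + XQ n)\<bar> \<le> 8 * \<epsilon>"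
        using Q_cell by blast
      show ?thesis
        using n(2,3) XQ(1,2)[of n] XQ(3,4)[OF n(1)] m \<epsilon>(1,2) by (intro conjI; smt (verit))
    qed
    moreover have "2 * \<sigma> - \<nu> * ta = \<nu> * (T - ta)"
      by (simp add: \<sigma>_def algebra_simps)
    ultimately show "ta \<le> t \<and> t \<le> T - ta \<and> xa \<le> x \<and> x \<le> xb"
      using \<nu> by simp
  qed
qed

end

section \<open>Periodic cut-offs\<close>

lemma has_box_cong_open:
  assumes "has_box U \<nu> w s" "open U" "\<And>p. p \<in> U \<Longrightarrow> w p = z p"
  shows "has_box U \<nu> z s"
proof -
  from assms(1) obtain wt wx wtt wxx where w: "\<And>t x. (t, x) \<in> U \<Longrightarrow> ((\<lambda>r. w (r, x)) has_real_derivative wt (t, x)) (at t)"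
    "\<And>t x. (t, x) \<in> U \<Longrightarrow> ((\<lambda>r. wt (r, x)) has_real_derivative wtt (t, x)) (at t)"
    "\<And>t x. (t, x) \<in> U \<Longrightarrow> ((\<lambda>r. w (t, r)) has_real_derivative wx (t, x)) (at x)"
    "\<And>t x. (t, x) \<in> U \<Longrightarrow> ((\<lambda>r. wx (t, r)) has_real_derivative wxx (t, x)) (at x)"
    "\<And>t x. (t, x) \<in> U \<Longrightarrow> wtt (t, x) - \<nu>\<^sup>2 * wxx (t, x) = s (t, x)"
    by (rule has_boxE) blast
  show ?thesis
  proof (rule has_boxI[OF _ w(2) _ w(4) w(5)])
    fix t x assume tx: "(t, x) \<in> U"
    show "((\<lambda>r. z (r, x)) has_real_derivative wt (t, x)) (at t)"
      by (rule has_field_derivative_transform_within_open[OF w(1)[OF tx] open_sections(1)[OF assms(2), of x]]) (use tx assms(3) in auto)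
    show "((\<lambda>r. z (t, r)) has_real_derivative wx (t, x)) (at x)"
      by (rule has_field_derivative_transform_within_open[OF w(3)[OF tx] open_sections(2)[OF assms(2), of t]]) (use tx assms(3) in auto)
  qed
qed

lemma smooth_sin_cos: "smooth k (sin :: real \<Rightarrow> real) \<and> smooth k (cos :: real \<Rightarrow> real)"
proof (induction k)
  case 0
  have "continuous_on UNIV (sin :: real \<Rightarrow> real)" "continuous_on UNIV (cos :: real \<Rightarrow> real)"
    by (intro continuous_intros)+
  then show ?case
    by (auto simp: locally_bdd_const)
next
  case (Suc k)
  have lb: "locally_bdd (UNIV :: unit set) (\<lambda>_. sin :: real \<Rightarrow> real)" "locally_bdd (UNIV :: unit set) (\<lambda>_. cos :: real \<Rightarrow> real)"
    by (intro locally_bdd_const continuous_intros)+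
  have "CF (Suc k) (UNIV :: unit set) (\<lambda>_. sin :: real \<Rightarrow> real)"
    by (rule CF_real_SucI[OF lb(1), of "\<lambda>_. cos"]) (use Suc in \<open>auto intro!: derivative_eq_intros\<close>)
  moreover have "CF (Suc k) (UNIV :: unit set) (\<lambda>_. cos :: real \<Rightarrow> real)"
    by (rule CF_real_SucI[OF lb(2), of "\<lambda>_ x. - sin x"]) (use Suc in \<open>auto intro!: derivative_eq_intros CF_minus\<close>)
  ultimately show ?case ..
qed

text \<open>The cell [-L, L) is centred at 0 so that odd profiles have odd periodisations.\<close>

definition periodize :: "real \<Rightarrow> (real \<Rightarrow> real) \<Rightarrow> real \<Rightarrow> real" where
  "periodize L f x = f (x - 2 * L * of_int \<lfloor>(x + L) / (2 * L)\<rfloor>)"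

lemma periodize_shift:
  assumes "L > 0" shows "periodize L f (x + 2 * L * of_int n) = periodize L f x"
proof -
  have "(x + 2 * L * of_int n + L) / (2 * L) = (x + L) / (2 * L) + of_int n"
    using assms by (simp add: field_simps)
  then show ?thesis
    by (simp add: periodize_def algebra_simps)
qed

lemma periodize_eq:
  assumes "L > 0" "- L \<le> x" "x < L" shows "periodize L f x = f x"
proof -
  have "\<lfloor>(x + L) / (2 * L)\<rfloor> = 0"
    using assms by (simp add: floor_eq_iff field_simps)
  then show ?thesis
    by (simp add: periodize_def)
qed

text \<open>The profile vanishes near both ends of the cell, so nothing changes when a cell boundary
  is crossed: near every point the periodised function is a single translate of f.\<close>

lemma periodize_local:
  assumes L: "L > 0" and f: "\<And>x. \<bar>x\<bar> \<ge> c \<Longrightarrow> f x = 0" and c: "0 \<le> c" "c < L"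
  shows "\<exists>\<tau>>0. \<forall>y. \<bar>y - x\<bar> < \<tau> \<longrightarrow> periodize L f y = f (y - 2 * L * of_int \<lfloor>(x + L) / (2 * L)\<rfloor>)"
proof -
  define n where "n = \<lfloor>(x + L) / (2 * L)\<rfloor>"
  define z where "z = x - 2 * L * of_int n"
  have "of_int n \<le> (x + L) / (2 * L)" "(x + L) / (2 * L) < of_int n + 1"
    unfolding n_def by linarith+
  then have z: "- L \<le> z" "z < L"
    using L by (simp_all add: z_def field_simps)
  have sh: "periodize L f y = periodize L f (y - 2 * L * of_int n)" for y
    using periodize_shift[OF L, of f y "- n"] by simp
  show ?thesis
    unfolding n_def[symmetric]
  proof (cases "z = - L")
    case False
    show "\<exists>\<tau>>0. \<forall>y. \<bar>y - x\<bar> < \<tau> \<longrightarrow> periodize L f y = f (y - 2 * L * of_int n)"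
    proof (intro exI conjI allI impI)
      show "L - \<bar>z\<bar> > 0" using False z by auto
      fix y assume "\<bar>y - x\<bar> < L - \<bar>z\<bar>"
      then have "- L \<le> y - 2 * L * of_int n" "y - 2 * L * of_int n < L"
        by (auto simp: z_def)
      then show "periodize L f y = f (y - 2 * L * of_int n)"
        by (subst sh) (rule periodize_eq[OF L])
    qed
  next
    case True
    show "\<exists>\<tau>>0. \<forall>y. \<bar>y - x\<bar> < \<tau> \<longrightarrow> periodize L f y = f (y - 2 * L * of_int n)"
    proof (intro exI conjI allI impI)
      show "L - c > 0" using c by auto
      fix y assume y: "\<bar>y - x\<bar> < L - c"
      let ?y = "y - 2 * L * of_int n"
      have y2: "\<bar>?y + L\<bar> < L - c"
        using y True by (simp add: z_def algebra_simps)
      show "periodize L f y = f ?y"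
      proof (cases "?y \<ge> - L")
        case True
        then show ?thesis
          using y2 c by (subst sh, intro periodize_eq[OF L]) auto
      next
        case False
        have "periodize L f y = periodize L f (?y + 2 * L)"
          using periodize_shift[OF L, of f ?y 1] sh by simp
        also have "\<dots> = f (?y + 2 * L)"
          using False y2 c by (intro periodize_eq[OF L]) auto
        also have "\<dots> = 0"
          using False y2 c by (intro f) auto
        also have "\<dots> = f ?y"
          using False c by (intro f[symmetric]) auto
        finally show ?thesis .
      qed
    qed
  qed
qed

lemma smooth_periodize:
  assumes "L > 0" "smooth k f" "\<And>x. \<bar>x\<bar> \<ge> c \<Longrightarrow> f x = 0" "0 \<le> c" "c < L"
  shows "smooth k (periodize L f)"
  using assms(2-5)
proof (induction k arbitrary: f c)
  have cont: "continuous_on UNIV (periodize L f)"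
    if "continuous_on UNIV f" and f0: "\<And>x. \<bar>x\<bar> \<ge> c \<Longrightarrow> f x = 0" "0 \<le> c" "c < L" for f c
    unfolding continuous_on_eq_continuous_within
  proof
    fix x :: real
    let ?n = "\<lfloor>(x + L) / (2 * L)\<rfloor>"
    obtain \<tau> where t: "\<tau> > 0" "\<And>y. \<bar>y - x\<bar> < \<tau> \<Longrightarrow> periodize L f y = f (y - 2 * L * of_int ?n)"
      using periodize_local[of L c f x] assms(1) f0 by blast
    have "continuous (at x) (\<lambda>y. f (y - 2 * L * of_int ?n))"
      using continuous_on_compose2[OF that(1), of UNIV "\<lambda>y. y - 2 * L * of_int ?n"]
      by (auto simp: continuous_on_eq_continuous_within intro: continuous_intros)
    then show "continuous (at x) (periodize L f)"
      by (rule continuous_transform_within[OF _ t(1)]) (auto simp: t(2) dist_real_def)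
  qed
  {
    case 0
    have "continuous_on UNIV f"
      using CF_continuous[OF 0(1)] by auto
    then have "continuous_on UNIV (periodize L f)"
      using 0 by (intro cont)
    then show ?case
      by (auto simp: locally_bdd_const)
  next
    case (Suc k)
    obtain f' where "\<And>i x. i \<in> UNIV \<Longrightarrow> (f has_real_derivative f' i x) (at x)" and k: "CF k (UNIV :: unit set) f'"
      using CF_real_SucE[OF Suc.prems(1)] by blast
    then have f': "\<And>x. (f has_real_derivative f' () x) (at x)"
      by blast
    \<comment> \<open>Vanishing of f' is derived at points where f vanishes in a whole
      neighbourhood, so the bound is enlarged to halfway between c and L. This can be repeated at
      each order.\<close>
    define c' where "c' = (c + L) / 2"
    have c': "0 \<le> c'" "c < c'" "c' < L"
      using Suc.prems(3,4) by (auto simp: c'_def)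
    have f'0: "f' () x = 0" if "\<bar>x\<bar> \<ge> c'" for x
    proof -
      have "((\<lambda>_. 0) has_real_derivative f' () x) (at x)"
        by (rule DERIV_eq_near[OF f', where \<tau> = "c' - c"]) (use that c' Suc.prems(2) in \<open>auto intro!: Suc.prems(2)[symmetric]\<close>)
      then show ?thesis
        using DERIV_unique DERIV_const by blast
    qed
    show ?case
    proof (rule CF_real_SucI)
      show "locally_bdd UNIV (\<lambda>_::unit. periodize L f)"
        using CF_continuous[OF Suc.prems(1)] Suc.prems(2-4) by (intro locally_bdd_const cont) auto
      have "smooth k (f' ())"
        by (rule CF_reindex[OF k UNIV_I, where g = "\<lambda>_. ()"])
      then show "smooth k (periodize L (f' ()))"
        using f'0 c' by (intro Suc.IH) auto
      fix x :: real
      let ?n = "\<lfloor>(x + L) / (2 * L)\<rfloor>"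
      obtain \<tau> where t: "\<tau> > 0" "\<And>y. \<bar>y - x\<bar> < \<tau> \<Longrightarrow> periodize L f y = f (y - 2 * L * of_int ?n)"
        using periodize_local[of L c f x] assms(1) Suc.prems(2-4) by blast
      have "((\<lambda>y. f (y - 2 * L * of_int ?n)) has_real_derivative f' () (x - 2 * L * of_int ?n)) (at x)"
        using DERIV_affine[OF f', of 1 "- 2 * L * of_int ?n" x] by simp
      then have "(periodize L f has_real_derivative f' () (x - 2 * L * of_int ?n)) (at x)"
        by (rule DERIV_eq_near[OF _ t])
      then show "(periodize L f has_real_derivative periodize L (f' ()) x) (at x)"
        by (simp add: periodize_def)
    qed
  }
qed


lemma periodize_minus:
  assumes "L > 0" "\<And>x. \<bar>x\<bar> \<ge> c \<Longrightarrow> f x = 0" "c < L" "\<And>x. f (- x) = - f x"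
  shows "periodize L f (- x) = - periodize L f x"
proof -
  define n where "n = \<lfloor>(x + L) / (2 * L)\<rfloor>"
  define z where "z = x - 2 * L * of_int n"
  have "of_int n \<le> (x + L) / (2 * L)" "(x + L) / (2 * L) < of_int n + 1"
    unfolding n_def by linarith+
  then have z: "- L \<le> z" "z < L"
    using assms(1) by (simp_all add: z_def field_simps)
  have 1: "periodize L f x = f z"
    by (simp add: periodize_def z_def n_def)
  have "periodize L f (- x) = periodize L f (- z)"
    using periodize_shift[OF assms(1), of f "- z" "- n"] by (simp add: z_def)
  also have "\<dots> = f (- z)"
  proof (cases "z = - L")
    case True
    have "periodize L f L = periodize L f (- L)"
      using periodize_shift[OF assms(1), of f "- L" 1] by simp
    also have "\<dots> = f (- L)"
      using assms(1) by (intro periodize_eq) auto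
    finally show ?thesis
      using True assms by simp
  qed (use z assms(1) in \<open>auto intro!: periodize_eq\<close>)
  finally show ?thesis
    using 1 assms(4) by simp
qed

section \<open>Phases and cut-offs compatible with the reflections\<close>

context step_function
begin

text \<open>Building block of the phase: the coordinate itself near the centre and 0 at a distance,
  so that copies around 0 and around L can be periodised and added.\<close>

lemma ex_cutoff_identity:
  assumes "0 \<le> A" "d > 0"
  obtains f where "smooth (Suc k) f" "\<And>x. f (- x) = - f x" "\<And>x. \<bar>x\<bar> \<le> A \<Longrightarrow> f x = x"
    "\<And>x. \<bar>x\<bar> \<ge> A + d \<Longrightarrow> f x = 0" "\<And>x. \<bar>f x\<bar> \<le> A + d"
proof -
  define f where "f = (\<lambda>x. x * (S ((x - (- A - d)) / d) * S (((- x) - (- A - d)) / d)))"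
  have f_smooth: "smooth (Suc k) f"
    unfolding f_def
    by (intro CF_mult CF_ident CF_S CF_affine CF_comp1[OF CF_affine] CF_minus)
  have f0: "f x = 0" if "\<bar>x\<bar> \<ge> A + d" for x
  proof -
    have "(x - (- A - d)) / d \<le> 0 \<or> ((- x) - (- A - d)) / d \<le> 0"
      using that assms by (auto simp: divide_le_0_iff)
    then show ?thesis by (auto simp: f_def S0)
  qed
  have f_le: "\<bar>f x\<bar> \<le> A + d" for x
  proof (cases "\<bar>x\<bar> \<ge> A + d")
    case False
    have "\<bar>f x\<bar> \<le> \<bar>x\<bar> * 1"
      unfolding f_def abs_mult by (intro mult_left_mono mult_le_one) (auto simp: S_ge S_le)
    then show ?thesis using False by auto
  next
    case True
    then show ?thesis using assms by (subst f0) auto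
  qed
  have f_id: "f x = x" if "\<bar>x\<bar> \<le> A" for x
  proof -
    have "(x - (- A - d)) / d \<ge> 1" "((- x) - (- A - d)) / d \<ge> 1"
      using that assms by (auto simp: le_divide_eq)
    then show ?thesis by (simp add: f_def S1)
  qed
  show ?thesis
    by (rule that[of f]; (rule f_smooth f_id f0 f_le; assumption)?) (simp add: f_def mult.commute)
qed

text \<open>
  With this phase, a single time cut-off evaluated at \<open>\<nu>t + \<rho>(x)\<close> depends only on \<open>\<nu>t + x\<close> outside the
  control region, and therefore produces free waves there.
\<close>

lemma ex_phase:
  assumes ab: "0 \<le> a" "a < b" "b \<le> L" and d: "0 < d" "2 * d \<le> b - a"
  obtains \<rho> where "smooth (Suc k) \<rho>" "\<And>x. \<rho> (- x) = - \<rho> x" "\<And>x. \<rho> (x + 2 * L) = \<rho> x"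
    "\<And>x. \<bar>x\<bar> \<le> a \<Longrightarrow> \<rho> x = x" "\<And>x. b \<le> x \<Longrightarrow> x \<le> 2 * L - b \<Longrightarrow> \<rho> x = x - L"
    "\<And>x. 0 \<le> x \<Longrightarrow> x \<le> L \<Longrightarrow> \<bar>\<rho> x\<bar> \<le> max a (L - b) + d"
proof -
  have L: "L > 0" using ab by auto
  obtain f where f: "smooth (Suc k) f" "\<And>x. f (- x) = - f x" "\<And>x. \<bar>x\<bar> \<le> a \<Longrightarrow> f x = x"
    "\<And>x. \<bar>x\<bar> \<ge> a + d \<Longrightarrow> f x = 0" "\<And>x. \<bar>f x\<bar> \<le> a + d"
    using ex_cutoff_identity[OF ab(1) d(1)] by blast
  obtain g where g: "smooth (Suc k) g" "\<And>x. g (- x) = - g x" "\<And>x. \<bar>x\<bar> \<le> L - b \<Longrightarrow> g x = x"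
    "\<And>x. \<bar>x\<bar> \<ge> L - b + d \<Longrightarrow> g x = 0" "\<And>x. \<bar>g x\<bar> \<le> L - b + d"
    using ex_cutoff_identity[of "L - b" d] ab d by auto
  \<comment> \<open>The first summand follows x around 0, the second x - L around L. In [0, L] their
    supports do not overlap because 2d \<le> b - a, so the bounds of the summands also bound
    \<rho>.\<close>
  define \<rho> where "\<rho> = (\<lambda>x. periodize L f x + periodize L g (x - L))"
  have c: "0 \<le> a + d" "a + d < L" "0 \<le> L - b + d" "L - b + d < L"
    using ab d by auto
  have odd: "\<rho> (- x) = - \<rho> x" for x
  proof -
    have "periodize L f (- x) = - periodize L f x"
      by (rule periodize_minus[of L "a + d" f]) (use L f c in auto)
    moreover have "periodize L g (- (x + L)) = - periodize L g (x + L)"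
      by (rule periodize_minus[of L "L - b + d" g]) (use L g c in auto)
    moreover have "periodize L g (x + L) = periodize L g (x - L)"
      using periodize_shift[OF L, of g "x - L" 1] by (simp add: add.commute)
    ultimately show ?thesis
      by (simp add: \<rho>_def)
  qed
  have per: "\<rho> (x + 2 * L) = \<rho> x" for x
    using periodize_shift[OF L, of f x 1] periodize_shift[OF L, of g "x - L" 1] by (simp add: \<rho>_def algebra_simps)
  have eq: "\<rho> x = f x + g (x - L)" if "0 \<le> x" "x \<le> L" for x
  proof -
    have "periodize L f x = f x"
    proof (cases "x = L")
      case True
      have "periodize L f L = periodize L f (- L)"
        using periodize_shift[OF L, of f "- L" 1] by simp
      also have "\<dots> = f (- L)"
        using L by (intro periodize_eq) auto
      finally show ?thesis
        using True f(2) f(4)[of L] c by simp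
    qed (use that L in \<open>auto intro!: periodize_eq\<close>)
    moreover have "periodize L g (x - L) = g (x - L)"
      using that L by (intro periodize_eq) auto
    ultimately show ?thesis by (simp add: \<rho>_def)
  qed
  have left: "\<rho> x = x" if "0 \<le> x" "x \<le> a" for x
    using that ab d f(3)[of x] g(4)[of "x - L"] by (subst eq) auto
  have right: "\<rho> x = x - L" if "b \<le> x" "x \<le> L" for x
    using that ab d f(4)[of x] g(3)[of "x - L"] by (subst eq) auto
  show ?thesis
  proof (rule that[of \<rho>])
    have "smooth (Suc k) (periodize L f)" "smooth (Suc k) (periodize L g)"
      using smooth_periodize[of L "Suc k" f "a + d"] smooth_periodize[of L "Suc k" g "L - b + d"] L f(1,4) g(1,4) c by blast+
    then show "smooth (Suc k) \<rho>"
      unfolding \<rho>_def by (rule CF_add[OF _ CF_smooth_comp[OF _ CF_diff[OF CF_ident CF_const]]])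
    show "\<rho> x = x" if "\<bar>x\<bar> \<le> a" for x
      using left[of x] left[of "- x"] odd[of x] that by (cases "x \<ge> 0") auto
    show "\<rho> x = x - L" if "b \<le> x" "x \<le> 2 * L - b" for x
      using right[of x] right[of "2 * L - x"] per[of "x - 2 * L"] odd[of "2 * L - x"] that by (cases "x \<le> L") auto
    show "\<bar>\<rho> x\<bar> \<le> max a (L - b) + d" if x: "0 \<le> x" "x \<le> L" for x
    proof (cases "x \<ge> a + d")
      case True
      then show ?thesis
        using eq[OF x] f(4)[of x] g(5)[of "x - L"] by auto
    next
      case False
      then show ?thesis
        using eq[OF x] f(5)[of x] g(4)[of "x - L"] x d by auto
    qed
  qed (fact odd per)+
qed

text \<open>cos(pi x / L) is invariant under both reflections and strictly decreasing on [0, L].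
  Functions of it are symmetric by construction, and comparisons of positions become comparisons of
  its values.\<close>

lemma ex_space_cutoff:
  fixes L a b xa xb :: real
  assumes "L > 0" "0 \<le> a" "a < xa" "xa < xb" "xb < b" "b \<le> L"
  obtains \<kappa> where "smooth (Suc k) \<kappa>" "\<And>x. \<kappa> (- x) = \<kappa> x" "\<And>x. \<kappa> (2 * L - x) = \<kappa> x"
    "\<And>x. xa \<le> x \<Longrightarrow> x \<le> xb \<Longrightarrow> \<kappa> x = 1" "\<And>x. \<bar>x\<bar> \<le> a \<Longrightarrow> \<kappa> x = 0"
    "\<And>x. b \<le> x \<Longrightarrow> x \<le> 2 * L - b \<Longrightarrow> \<kappa> x = 0"
proof -
  define C where "C = (\<lambda>x. cos (pi / L * x))"
  have Cmono: "C y < C x" if "0 \<le> x" "x < y" "y \<le> L" for x y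
    unfolding C_def using that assms(1) by (intro cos_monotone_0_pi) (auto simp: field_simps)
  have Cmono': "C y \<le> C x" if "0 \<le> x" "x \<le> y" "y \<le> L" for x y
    using Cmono[of x y] that by (cases "x = y") auto
  have Ceven: "C (- x) = C x" for x
    by (simp add: C_def)
  have Crefl: "C (2 * L - x) = C x" for x
  proof -
    have "pi / L * (2 * L - x) = 2 * pi - pi / L * x"
      using assms(1) by (simp add: field_simps)
    then show ?thesis
      by (simp add: C_def cos_diff)
  qed
  \<comment> \<open>The smaller of the drops of the cosine across the two transition zones, so that
    both transitions can be completed.\<close>
  define d where "d = min (C a - C xa) (C xb - C b)"
  have d: "d > 0" "d \<le> C a - C xa" "d \<le> C xb - C b"
    using Cmono[of a xa] Cmono[of xb b] assms by (auto simp: d_def)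
  define \<kappa> where "\<kappa> = (\<lambda>x. S ((- C x - (- C a)) / d) * S ((C x - C b) / d))"
  show ?thesis
  proof (rule that[of \<kappa>])
    have "smooth (Suc k) (cos :: real \<Rightarrow> real)"
      using smooth_sin_cos by blast
    then have C: "smooth (Suc k) C"
      unfolding C_def by (rule CF_smooth_comp) (intro CF_cmult CF_ident)
    show "smooth (Suc k) \<kappa>"
      unfolding \<kappa>_def by (intro CF_mult CF_S CF_comp1[OF CF_affine] CF_minus C)
    show "\<kappa> (- x) = \<kappa> x" "\<kappa> (2 * L - x) = \<kappa> x" for x
      by (simp_all add: \<kappa>_def Ceven Crefl)
    show "\<kappa> x = 1" if "xa \<le> x" "x \<le> xb" for x
    proof -
      have "(- C x - (- C a)) / d \<ge> 1" "(C x - C b) / d \<ge> 1"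
        using d Cmono'[of xa x] Cmono'[of x xb] that assms by (auto simp: le_divide_eq)
      then show ?thesis by (simp add: \<kappa>_def S1)
    qed
    show "\<kappa> x = 0" if "\<bar>x\<bar> \<le> a" for x
    proof -
      have "C a \<le> C x"
        using Cmono'[of x a] Cmono'[of "- x" a] Ceven[of x] that assms by (cases "x \<ge> 0") auto
      then show ?thesis
        using d by (simp add: \<kappa>_def S0 divide_nonpos_pos)
    qed
    show "\<kappa> x = 0" if "b \<le> x" "x \<le> 2 * L - b" for x
    proof -
      have "C x \<le> C b"
        using Cmono'[of b x] Cmono'[of b "2 * L - x"] Crefl[of x] that assms by (cases "x \<le> L") auto
      then show ?thesis
        using d by (simp add: \<kappa>_def S0 divide_nonpos_pos)
    qed
  qed
qed


end

section \<open>The controlled system\<close>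

context step_function
begin

text \<open>The change of profile on each ray is timed by the phase \<rho>, which leaves free waves
  near both ends; the residual inside the region is absorbed by h. The factor
  \<open>1 - \<theta> * \<kappa>\<close> empties the middle, where the cubic control of v will act.
  Every ingredient respects the reflections, so the cube of w is an admissible source for Duhamel's
  formula.\<close>

lemma controlled_free_wave:
  fixes p0 p1 w0 w1 :: "'i \<Rightarrow> real \<Rightarrow> real"
  assumes L: "L > 0" and \<nu>: "\<nu> > 0" and ab: "0 \<le> a" "a < xa" "xa < xb" "xb < b" "b \<le> L" and ta: "ta > 0"
    and T: "\<nu> * T > 2 * a" "\<nu> * T > 2 * (L - b)"
    and k: "k = Suc k'"
    and data: "CF (Suc k) I p0" "CF k I p1" "CF (Suc k) I w0" "CF k I w1"
      "\<And>i. i \<in> I \<Longrightarrow> odd_refl L (p0 i)" "\<And>i. i \<in> I \<Longrightarrow> odd_refl L (p1 i)"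
      "\<And>i. i \<in> I \<Longrightarrow> odd_refl L (w0 i)" "\<And>i. i \<in> I \<Longrightarrow> odd_refl L (w1 i)"
  obtains w where "CF (Suc k) I w" "\<And>i t. i \<in> I \<Longrightarrow> odd_refl L (\<lambda>x. w i (t, x))"
    "\<And>i x. i \<in> I \<Longrightarrow> 0 \<le> x \<Longrightarrow> x \<le> L \<Longrightarrow> w i (0, x) = p0 i x"
    "\<And>i x. i \<in> I \<Longrightarrow> 0 \<le> x \<Longrightarrow> x \<le> L \<Longrightarrow> ((\<lambda>t. w i (t, x)) has_real_derivative p1 i x) (at 0)"
    "\<And>i x. i \<in> I \<Longrightarrow> 0 \<le> x \<Longrightarrow> x \<le> L \<Longrightarrow> w i (T, x) = w0 i x"
    "\<And>i x. i \<in> I \<Longrightarrow> 0 \<le> x \<Longrightarrow> x \<le> L \<Longrightarrow> ((\<lambda>t. w i (t, x)) has_real_derivative w1 i x) (at T)"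
    "\<And>i t x. i \<in> I \<Longrightarrow> ta \<le> t \<Longrightarrow> t \<le> T - ta \<Longrightarrow> xa \<le> x \<Longrightarrow> x \<le> xb \<Longrightarrow> w i (t, x) = 0"
    "\<And>i. i \<in> I \<Longrightarrow> has_box (UNIV \<times> {-a<..<a}) \<nu> (w i) (\<lambda>p. 0)"
    "\<And>i. i \<in> I \<Longrightarrow> has_box (UNIV \<times> {b<..<2 * L - b}) \<nu> (w i) (\<lambda>p. 0)"
proof -
  obtain f0 where f0: "CF (Suc k) I f0" "\<And>i x. i \<in> I \<Longrightarrow> f0 i (x + 2 * L) = f0 i x"
    "\<And>i x. i \<in> I \<Longrightarrow> f0 i x - f0 i (- x) = p0 i x"
    "\<And>i x. i \<in> I \<Longrightarrow> ((\<lambda>t. f0 i (\<nu> * t + x) - f0 i (\<nu> * t - x)) has_real_derivative p1 i x) (at 0)"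
  proof (rule dAlembert[OF data(1,2,5,6) \<nu>], assumption, assumption, goal_cases)
    case (1 f0)
    show ?case by (rule that[of f0]) (fact 1)+
  qed
  obtain f1 where f1: "CF (Suc k) I f1" "\<And>i x. i \<in> I \<Longrightarrow> f1 i (x + 2 * L) = f1 i x"
    "\<And>i x. i \<in> I \<Longrightarrow> f1 i x - f1 i (- x) = w0 i x"
    "\<And>i x. i \<in> I \<Longrightarrow> ((\<lambda>t. f1 i (\<nu> * t + x) - f1 i (\<nu> * t - x)) has_real_derivative w1 i x) (at 0)"
  proof (rule dAlembert[OF data(3,4,7,8) \<nu>], assumption, assumption, goal_cases)
    case (1 f1)
    show ?case by (rule that[of f1]) (fact 1)+
  qed
  define F where "F = (\<lambda>i y. f1 i (y - \<nu> * T) - f0 i y)"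
  have F: "CF (Suc k) I F"
    unfolding F_def by (intro CF_diff f0(1) CF_comp1[OF f1(1)] CF_ident CF_const)
  have Fper: "F i (y + 2 * L) = F i y" if "i \<in> I" for i y
    using f1(2)[OF that, of "y - \<nu> * T"] f0(2)[OF that, of y] by (simp add: F_def algebra_simps)
  define \<sigma> where "\<sigma> = \<nu> * T / 2"
  \<comment> \<open>|\<rho>| may exceed max(a, L - b) by d, \<Theta> needs another d for its
    transition, and a further d is spent on neighbourhoods of the times 0 and T; four times d fits
    into the margin.\<close>
  define d where "d = min ((b - a) / 2) ((\<sigma> - max a (L - b)) / 4)"
  have "max a (L - b) < \<sigma>"
    unfolding \<sigma>_def max_less_iff_conj using T by auto
  then have d_pos: "0 < d"
    using ab by (simp add: d_def)
  have "d \<le> (b - a) / 2"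
    unfolding d_def by (rule min.cobounded1)
  then have d_ab: "2 * d \<le> b - a"
    by simp
  have "d \<le> (\<sigma> - max a (L - b)) / 4"
    unfolding d_def by (rule min.cobounded2)
  then have "4 * d \<le> \<sigma> - max a (L - b)"
    by simp
  then have "max a (L - b) + 4 * d \<le> \<sigma>"
    by simp
  note d = d_pos d_ab this
  have ab': "a < b" using ab by auto
  obtain \<rho> where \<rho>: "smooth (Suc k) \<rho>" "\<And>x. \<rho> (- x) = - \<rho> x" "\<And>x. \<rho> (x + 2 * L) = \<rho> x"
    "\<And>x. \<bar>x\<bar> \<le> a \<Longrightarrow> \<rho> x = x" "\<And>x. b \<le> x \<Longrightarrow> x \<le> 2 * L - b \<Longrightarrow> \<rho> x = x - L"
    "\<And>x. 0 \<le> x \<Longrightarrow> x \<le> L \<Longrightarrow> \<bar>\<rho> x\<bar> \<le> max a (L - b) + d"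
    by (rule ex_phase[OF ab(1) ab' ab(5) d(1,2)]) blast
  obtain \<kappa> where \<kappa>: "smooth (Suc k) \<kappa>" "\<And>x. \<kappa> (- x) = \<kappa> x" "\<And>x. \<kappa> (2 * L - x) = \<kappa> x"
    "\<And>x. xa \<le> x \<Longrightarrow> x \<le> xb \<Longrightarrow> \<kappa> x = 1" "\<And>x. \<bar>x\<bar> \<le> a \<Longrightarrow> \<kappa> x = 0"
    "\<And>x. b \<le> x \<Longrightarrow> x \<le> 2 * L - b \<Longrightarrow> \<kappa> x = 0"
    by (rule ex_space_cutoff[OF L ab]) blast
  define \<theta> where "\<theta> = (\<lambda>t. S ((t - ta / 2) / (ta / 2)) * S (((- t) - (ta / 2 - T)) / (ta / 2)))"
  define \<Theta> where "\<Theta> = (\<lambda>y. S ((y - \<sigma>) / d))"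
  have \<theta>0: "\<theta> t = 0" if "t \<le> ta / 2 \<or> t \<ge> T - ta / 2" for t
    using that ta by (auto simp: \<theta>_def S0 divide_nonpos_pos)
  have \<theta>1: "\<theta> t = 1" if "ta \<le> t" "t \<le> T - ta" for t
  proof -
    have "(t - ta / 2) / (ta / 2) \<ge> 1" "((- t) - (ta / 2 - T)) / (ta / 2) \<ge> 1"
      using that ta by (auto simp: le_divide_eq)
    then show ?thesis by (simp only: \<theta>_def S1 mult_1)
  qed
  have \<Theta>0: "\<Theta> y = 0" if "y \<le> \<sigma>" for y
    using that d by (simp add: \<Theta>_def S0 divide_nonpos_pos)
  have \<Theta>1: "\<Theta> y = 1" if "y \<ge> \<sigma> + d" for y
    using that d by (simp add: \<Theta>_def S1 le_divide_eq)
  have \<Theta>: "smooth (Suc k) \<Theta>"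
    unfolding \<Theta>_def by (intro CF_S CF_affine)
  have \<theta>: "smooth (Suc k) \<theta>"
    unfolding \<theta>_def by (intro CF_mult CF_S CF_affine CF_comp1[OF CF_affine] CF_minus CF_ident)
  define w where "w = (\<lambda>i p. (1 - \<theta> (fst p) * \<kappa> (snd p)) *
     (f0 i (\<nu> * fst p + snd p) - f0 i (\<nu> * fst p - snd p) +
      (\<Theta> (\<nu> * fst p + \<rho> (snd p)) * F i (\<nu> * fst p + snd p) - \<Theta> (\<nu> * fst p - \<rho> (snd p)) * F i (\<nu> * fst p - snd p))))"
  show ?thesis
  proof (rule that[of w])
    show "CF (Suc k) I w"
      unfolding w_def
      by (intro CF_add CF_diff CF_mult CF_const CF_cmult CF_fst CF_characteristic[OF f0(1)] CF_characteristic[OF F]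
          CF_smooth_comp[OF \<theta>] CF_smooth_comp[OF \<kappa>(1)] CF_smooth_comp[OF \<Theta>] CF_smooth_comp[OF \<rho>(1)] CF_snd)
    show "odd_refl L (\<lambda>x. w i (t, x))" if i: "i \<in> I" for i t
      unfolding odd_refl_def
    proof (intro allI conjI)
      fix x
      show "w i (t, - x) = - w i (t, x)"
        by (simp add: w_def \<kappa>(2) \<rho>(2) algebra_simps)
      have R: "\<rho> (2 * L - x) = - \<rho> x"
        using \<rho>(3)[of "- x"] \<rho>(2)[of x] by simp
      have G: "g i (\<nu> * t + (2 * L - x)) = g i (\<nu> * t - x)" "g i (\<nu> * t - (2 * L - x)) = g i (\<nu> * t + x)"
        if "\<And>y. g i (y + 2 * L) = g i y" for g :: "'i \<Rightarrow> real \<Rightarrow> real"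
        using that[of "\<nu> * t - x"] that[of "\<nu> * t - (2 * L - x)"] by (simp_all add: algebra_simps)
      show "w i (t, 2 * L - x) = - w i (t, x)"
        unfolding w_def fst_conv snd_conv \<kappa>(3) R G[of f0, OF f0(2)[OF i]] G[of F, OF Fper[OF i]]
        by (simp add: algebra_simps)
    qed
  next
    fix i and x :: real assume i: "i \<in> I" and x: "0 \<le> x" "x \<le> L"
    note \<rho>x = \<rho>(6)[OF x]
    define \<tau> where "\<tau> = min (ta / 2) (d / \<nu>)"
    have \<tau>: "\<tau> > 0"
      using ta d \<nu> by (simp add: \<tau>_def)
    have \<nu>t: "\<bar>\<nu> * t\<bar> < d" if "\<bar>t\<bar> < \<tau>" for t
      using that \<nu> by (auto simp: \<tau>_def abs_mult field_simps)
    have near0: "w i (t, x) = f0 i (\<nu> * t + x) - f0 i (\<nu> * t - x)" if "\<bar>t - 0\<bar> < \<tau>" for t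
    proof -
      have "\<theta> t = 0"
        using that by (intro \<theta>0) (auto simp: \<tau>_def)
      moreover have "\<Theta> (\<nu> * t + \<rho> x) = 0" "\<Theta> (\<nu> * t - \<rho> x) = 0"
        using \<nu>t[of t] that \<rho>x d by (auto intro!: \<Theta>0)
      ultimately show ?thesis
        by (simp add: w_def)
    qed
    show "w i (0, x) = p0 i x"
      using near0[of 0] \<tau> f0(3)[OF i, of x] by simp
    show "((\<lambda>t. w i (t, x)) has_real_derivative p1 i x) (at 0)"
      by (rule DERIV_eq_near[OF f0(4)[OF i] \<tau> near0])
    have nearT: "w i (t, x) = f1 i (\<nu> * (t - T) + x) - f1 i (\<nu> * (t - T) - x)" if "\<bar>t - T\<bar> < \<tau>" for t
    proof -
      have "\<theta> t = 0"
      proof (rule \<theta>0)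
        have "\<bar>t - T\<bar> < ta / 2"
          using that unfolding \<tau>_def min_less_iff_conj by (rule conjunct1)
        then show "t \<le> ta / 2 \<or> t \<ge> T - ta / 2"
          unfolding abs_less_iff by simp
      qed
      moreover have "\<bar>\<nu> * t - 2 * \<sigma>\<bar> < d"
        using \<nu>t[OF that] by (simp add: \<sigma>_def algebra_simps)
      then have "\<Theta> (\<nu> * t + \<rho> x) = 1" "\<Theta> (\<nu> * t - \<rho> x) = 1"
        using \<rho>x d by (auto intro!: \<Theta>1)
      ultimately show ?thesis
        by (simp add: w_def F_def algebra_simps)
    qed
    show "w i (T, x) = w0 i x"
      using nearT[of T] \<tau> f1(3)[OF i, of x] by simp
    have "((\<lambda>t. f1 i (\<nu> * (t - T) + x) - f1 i (\<nu> * (t - T) - x)) has_real_derivative w1 i x) (at T)"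
      using f1(4)[OF i, of x] DERIV_shift[of "\<lambda>t. f1 i (\<nu> * t + x) - f1 i (\<nu> * t - x)" "w1 i x" T "- T"] by simp
    then show "((\<lambda>t. w i (t, x)) has_real_derivative w1 i x) (at T)"
      by (rule DERIV_eq_near[OF _ \<tau> nearT])
  next
    fix i t x assume "ta \<le> t" "t \<le> T - ta" "xa \<le> x" "x \<le> xb"
    then show "w i (t, x) = 0"
      by (simp add: w_def \<theta>1 \<kappa>(4))
  next
    fix i assume i: "i \<in> I"
    have sh: "CF (Suc (Suc k')) I (\<lambda>i y. \<Theta> (y + c) * F i y)" for c
      using CF_mult[OF CF_smooth_comp[OF \<Theta> CF_add[OF CF_ident CF_const]] F] k by simp
    have f02: "CF (Suc (Suc k')) I f0"
      using f0(1) k by simp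
    \<comment> \<open>With a constant phase shift each \<Theta> depends on one characteristic
      variable only. Near 0 the shifts are 0; near L the phase is x - L, which gives the shifts -L
      for \<xi> and L for \<eta>.\<close>
    have bx: "has_box U \<nu> (\<lambda>p. f0 i (\<nu> * fst p + snd p) - f0 i (\<nu> * fst p - snd p) +
       (\<Theta> (\<nu> * fst p + snd p + c) * F i (\<nu> * fst p + snd p) - \<Theta> (\<nu> * fst p - snd p + c') * F i (\<nu> * fst p - snd p)))
      (\<lambda>p. 0)" for U c c'
      using has_box_add[OF has_box_diff[OF has_box_travelling[OF f02 i, of U \<nu>]] has_box_diff[OF has_box_travelling(1)[OF sh[of c] i, of U \<nu>] has_box_travelling(2)[OF sh[of c'] i, of U \<nu>]]]
      by simp
    show "has_box (UNIV \<times> {-a<..<a}) \<nu> (w i) (\<lambda>p. 0)"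
      by (rule has_box_cong_open[OF bx[where c = 0 and c' = 0]]) (auto simp: w_def \<kappa>(5) \<rho>(4) open_Times)
    show "has_box (UNIV \<times> {b<..<2 * L - b}) \<nu> (w i) (\<lambda>p. 0)"
      by (rule has_box_cong_open[OF bx[where c = "- L" and c' = L]]) (auto simp: w_def \<kappa>(6) \<rho>(5) open_Times algebra_simps)
  qed
qed

text \<open>The cube of w acts on v as a prescribed source, and the remaining task for v is
  performed by \<Omega>^3 in the region emptied of w. Since w \<Omega> = 0, the sum u = w + \<Omega>
  satisfies u^3 = w^3 + \<Omega>^3 exactly.\<close>

lemma controlled_system:
  fixes u0 u1 v0 v1 u0f u1f v0f v1f :: "'i \<Rightarrow> real \<Rightarrow> real"
  assumes L: "L > 0" and \<nu>: "\<nu>1 > 0" "\<nu>2 > 0" and ab: "0 \<le> a" "a < b" "b \<le> L"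
    and T: "\<nu>1 * T > 2 * a" "\<nu>1 * T > 2 * (L - b)" "\<nu>2 * T > 2 * a" "\<nu>2 * T > 2 * (L - b)"
    and k: "k = Suc k'"
    and u: "CF (Suc k) I u0" "CF k I u1" "CF (Suc k) I u0f" "CF k I u1f"
      "\<And>i. i \<in> I \<Longrightarrow> odd_refl L (u0 i)" "\<And>i. i \<in> I \<Longrightarrow> odd_refl L (u1 i)"
      "\<And>i. i \<in> I \<Longrightarrow> odd_refl L (u0f i)" "\<And>i. i \<in> I \<Longrightarrow> odd_refl L (u1f i)"
    and v: "CF (Suc k) I v0" "CF k I v1" "CF (Suc k) I v0f" "CF k I v1f"
      "\<And>i. i \<in> I \<Longrightarrow> odd_refl L (v0 i)" "\<And>i. i \<in> I \<Longrightarrow> odd_refl L (v1 i)"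
      "\<And>i. i \<in> I \<Longrightarrow> odd_refl L (v0f i)" "\<And>i. i \<in> I \<Longrightarrow> odd_refl L (v1f i)"
  obtains u v where "CF k I u" "CF k I v"
    "\<And>i x. i \<in> I \<Longrightarrow> 0 \<le> x \<Longrightarrow> x \<le> L \<Longrightarrow> u i (0, x) = u0 i x"
    "\<And>i x. i \<in> I \<Longrightarrow> 0 \<le> x \<Longrightarrow> x \<le> L \<Longrightarrow> ((\<lambda>t. u i (t, x)) has_real_derivative u1 i x) (at 0)"
    "\<And>i x. i \<in> I \<Longrightarrow> 0 \<le> x \<Longrightarrow> x \<le> L \<Longrightarrow> u i (T, x) = u0f i x"
    "\<And>i x. i \<in> I \<Longrightarrow> 0 \<le> x \<Longrightarrow> x \<le> L \<Longrightarrow> ((\<lambda>t. u i (t, x)) has_real_derivative u1f i x) (at T)"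
    "\<And>i x. i \<in> I \<Longrightarrow> 0 \<le> x \<Longrightarrow> x \<le> L \<Longrightarrow> v i (0, x) = v0 i x"
    "\<And>i x. i \<in> I \<Longrightarrow> 0 \<le> x \<Longrightarrow> x \<le> L \<Longrightarrow> ((\<lambda>t. v i (t, x)) has_real_derivative v1 i x) (at 0)"
    "\<And>i x. i \<in> I \<Longrightarrow> 0 \<le> x \<Longrightarrow> x \<le> L \<Longrightarrow> v i (T, x) = v0f i x"
    "\<And>i x. i \<in> I \<Longrightarrow> 0 \<le> x \<Longrightarrow> x \<le> L \<Longrightarrow> ((\<lambda>t. v i (t, x)) has_real_derivative v1f i x) (at T)"
    "\<And>i t. i \<in> I \<Longrightarrow> u i (t, 0) = 0" "\<And>i t. i \<in> I \<Longrightarrow> u i (t, L) = 0"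
    "\<And>i t. i \<in> I \<Longrightarrow> v i (t, 0) = 0" "\<And>i t. i \<in> I \<Longrightarrow> v i (t, L) = 0"
    "\<And>i. i \<in> I \<Longrightarrow> has_box UNIV \<nu>2 (v i) (\<lambda>p. u i p ^ 3)"
    "\<And>i. i \<in> I \<Longrightarrow> has_box (UNIV \<times> {-a<..<a}) \<nu>1 (u i) (\<lambda>p. 0)"
    "\<And>i. i \<in> I \<Longrightarrow> has_box (UNIV \<times> {b<..<2 * L - b}) \<nu>1 (u i) (\<lambda>p. 0)"
proof -
  \<comment> \<open>A margin in space and time: the control of v is confined to [a + m, b - m] and
    to times at distance at least m / \<nu>2 from 0 and T, and the travel-time conditions survive.
    Near the end points in time u is then equal to w.\<close>
  define m where "m = min (b - a) (min (\<nu>2 * T - 2 * a) (\<nu>2 * T - 2 * (L - b))) / 8"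
  have m: "m > 0" "8 * m \<le> b - a" "8 * m \<le> \<nu>2 * T - 2 * a" "8 * m \<le> \<nu>2 * T - 2 * (L - b)"
    using ab T by (auto simp: m_def)
  define xa where "xa = a + m"
  define xb where "xb = b - m"
  define ta where "ta = m / \<nu>2"
  have ta: "ta > 0" "\<nu>2 * (T - 2 * ta) = \<nu>2 * T - 2 * m"
    using m \<nu> by (simp_all add: ta_def algebra_simps)
  have x: "a < xa" "xa < xb" "xb < b" "0 \<le> xa" "xb \<le> L"
    using m ab by (auto simp: xa_def xb_def)
  obtain w where w: "CF (Suc k) I w" "\<And>i t. i \<in> I \<Longrightarrow> odd_refl L (\<lambda>x. w i (t, x))"
    "\<And>i x. i \<in> I \<Longrightarrow> 0 \<le> x \<Longrightarrow> x \<le> L \<Longrightarrow> w i (0, x) = u0 i x"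
    "\<And>i x. i \<in> I \<Longrightarrow> 0 \<le> x \<Longrightarrow> x \<le> L \<Longrightarrow> ((\<lambda>t. w i (t, x)) has_real_derivative u1 i x) (at 0)"
    "\<And>i x. i \<in> I \<Longrightarrow> 0 \<le> x \<Longrightarrow> x \<le> L \<Longrightarrow> w i (T, x) = u0f i x"
    "\<And>i x. i \<in> I \<Longrightarrow> 0 \<le> x \<Longrightarrow> x \<le> L \<Longrightarrow> ((\<lambda>t. w i (t, x)) has_real_derivative u1f i x) (at T)"
    "\<And>i t x. i \<in> I \<Longrightarrow> ta \<le> t \<Longrightarrow> t \<le> T - ta \<Longrightarrow> xa \<le> x \<Longrightarrow> x \<le> xb \<Longrightarrow> w i (t, x) = 0"
    "\<And>i. i \<in> I \<Longrightarrow> has_box (UNIV \<times> {-a<..<a}) \<nu>1 (w i) (\<lambda>p. 0)"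
    "\<And>i. i \<in> I \<Longrightarrow> has_box (UNIV \<times> {b<..<2 * L - b}) \<nu>1 (w i) (\<lambda>p. 0)"
  proof (rule controlled_free_wave[OF L \<nu>(1) ab(1) x(1-3) ab(3) ta(1) T(1,2) k u],
      assumption, assumption, assumption, assumption, goal_cases)
    case (1 w)
    show ?case by (rule that[of w]) (fact 1)+
  qed
  have s: "CF (Suc k) I (\<lambda>i p. w i p ^ 3)" "\<And>i t. i \<in> I \<Longrightarrow> odd_refl L (\<lambda>x. w i (t, x) ^ 3)"
    using CF_power[OF w(1)] w(2) by (auto simp: odd_refl_def simp del: CF.simps)
  have T2: "\<nu>2 * (T - 2 * ta) > 2 * xa" "\<nu>2 * (T - 2 * ta) > 2 * (L - xb)"
    using m unfolding ta(2) by (auto simp: xa_def xb_def)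
  obtain v \<Omega> where v: "CF k I v" "CF k I \<Omega>"
    "\<And>i. i \<in> I \<Longrightarrow> has_box UNIV \<nu>2 (v i) (\<lambda>p. w i p ^ 3 + \<Omega> i p ^ 3)"
    "\<And>i x. i \<in> I \<Longrightarrow> 0 \<le> x \<Longrightarrow> x \<le> L \<Longrightarrow> v i (0, x) = v0 i x"
    "\<And>i x. i \<in> I \<Longrightarrow> 0 \<le> x \<Longrightarrow> x \<le> L \<Longrightarrow> ((\<lambda>t. v i (t, x)) has_real_derivative v1 i x) (at 0)"
    "\<And>i x. i \<in> I \<Longrightarrow> 0 \<le> x \<Longrightarrow> x \<le> L \<Longrightarrow> v i (T, x) = v0f i x"
    "\<And>i x. i \<in> I \<Longrightarrow> 0 \<le> x \<Longrightarrow> x \<le> L \<Longrightarrow> ((\<lambda>t. v i (t, x)) has_real_derivative v1f i x) (at T)"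
    "\<And>i t. i \<in> I \<Longrightarrow> v i (t, 0) = 0" "\<And>i t. i \<in> I \<Longrightarrow> v i (t, L) = 0"
    "\<And>i t x. i \<in> I \<Longrightarrow> \<Omega> i (t, x) \<noteq> 0 \<Longrightarrow> ta \<le> t \<and> t \<le> T - ta \<and> xa \<le> x \<and> x \<le> xb"
  proof (rule controlled_wave[OF L \<nu>(2) x(4,2,5) less_imp_le[OF ta(1)] T2 k s v],
      assumption, assumption, assumption, assumption, assumption, goal_cases)
    case (1 v \<Omega>)
    show ?case by (rule that[of v \<Omega>]) (fact 1)+
  qed
  define u where "u = (\<lambda>i p. w i p + \<Omega> i p)"
  have eq: "u i (t, x) = w i (t, x)" if "i \<in> I" "x < xa \<or> x > xb \<or> t < ta \<or> t > T - ta" for i t x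
    using v(10)[OF that(1), of t x] that(2) by (cases "\<Omega> i (t, x) = 0") (auto simp: u_def)
  show ?thesis
  proof (rule that[of u v])
    show "CF k I u" "CF k I v"
      unfolding u_def by (intro CF_add CF_Suc_D[OF w(1)] v)+
  next
    fix i and x :: real assume i: "i \<in> I" and x': "0 \<le> x" "x \<le> L"
    show "u i (0, x) = u0 i x" "u i (T, x) = u0f i x" "v i (0, x) = v0 i x" "v i (T, x) = v0f i x"
      using eq[OF i] ta(1) w(3,5)[OF i x'] v(4,6)[OF i x'] by auto
    show "((\<lambda>t. u i (t, x)) has_real_derivative u1 i x) (at 0)"
      by (rule DERIV_eq_near[OF w(4)[OF i x'] ta(1)], rule eq[OF i]) auto
    show "((\<lambda>t. u i (t, x)) has_real_derivative u1f i x) (at T)"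
      by (rule DERIV_eq_near[OF w(6)[OF i x'] ta(1)], rule eq[OF i]) auto
    show "((\<lambda>t. v i (t, x)) has_real_derivative v1 i x) (at 0)" "((\<lambda>t. v i (t, x)) has_real_derivative v1f i x) (at T)"
      using v(5,7)[OF i x'] by auto
  next
    fix i t assume i: "i \<in> I"
    show "u i (t, 0) = 0" "u i (t, L) = 0" "v i (t, 0) = 0" "v i (t, L) = 0"
      using eq[OF i, of 0 t] eq[OF i, of L t] odd_reflD(5,6)[OF w(2)[OF i]] v(8,9)[OF i] x ab by auto
  next
    fix i assume i: "i \<in> I"
    have "w i p ^ 3 + \<Omega> i p ^ 3 = u i p ^ 3" for p
    proof -
      obtain t x where p: "p = (t, x)" by (cases p)
      have "\<Omega> i (t, x) = 0 \<or> w i (t, x) = 0"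
        using v(10)[OF i, of t x] w(7)[OF i, of t x] by blast
      then show ?thesis
        by (auto simp: u_def p)
    qed
    then show "has_box UNIV \<nu>2 (v i) (\<lambda>p. u i p ^ 3)"
      using v(3)[OF i] by simp
    show "has_box (UNIV \<times> {-a<..<a}) \<nu>1 (u i) (\<lambda>p. 0)"
      by (rule has_box_cong_open[OF w(8)[OF i]]) (use eq[OF i] x in \<open>auto simp: open_Times\<close>)
    show "has_box (UNIV \<times> {b<..<2 * L - b}) \<nu>1 (u i) (\<lambda>p. 0)"
      by (rule has_box_cong_open[OF w(9)[OF i]]) (use eq[OF i] x in \<open>auto simp: open_Times\<close>)
  qed
qed

end

section \<open>Compatibility conditions\<close>

lemma deriv_within_works:
  assumes "f differentiable_on S" "x \<in> S"
  shows "(f has_real_derivative deriv_within S f x) (at x within S)"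
  using assms unfolding deriv_within_def differentiable_on_def
  by (simp add: has_real_derivative_iff_has_vector_derivative vector_derivative_works[symmetric])

lemma deriv_within_eqI:
  assumes "(f has_real_derivative d) (at x within {a..b})" "x \<in> {a..b}" "a < b"
  shows "deriv_within {a..b} f x = d"
  using assms vector_derivative_within_cbox[of a b x f d]
  by (simp add: deriv_within_def has_real_derivative_iff_has_vector_derivative)

text \<open>Both sides are choices from the same predicate, so they agree also at points without a
  derivative.\<close>

lemma deriv_within_cong:
  assumes "\<And>y. y \<in> S \<Longrightarrow> f y = g y" "x \<in> S"
  shows "deriv_within S f x = deriv_within S g x"
proof -
  have "(f has_vector_derivative d) (at x within S) = (g has_vector_derivative d) (at x within S)" for d
    using has_vector_derivative_transform[of x S f g d] has_vector_derivative_transform[of x S g f d] assms by metis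
  then show ?thesis
    by (simp add: deriv_within_def vector_derivative_def)
qed

lemma differentiable_on_cong:
  fixes f g :: "real \<Rightarrow> real"
  assumes "\<And>y. y \<in> S \<Longrightarrow> f y = g y"
  shows "f differentiable_on S \<longleftrightarrow> g differentiable_on S"
  unfolding differentiable_on_def differentiable_def
  using has_derivative_transform[of _ S f g] has_derivative_transform[of _ S g f] assms by metis

text \<open>
  The mode \<open>Some True\<close> (\<open>Some False\<close>) says that the derivatives of even (odd) order vanish at both end
  points, that is, that the odd (even) \<open>2L\<close>-periodic extension is as smooth as the function;
  the mode \<open>None\<close> imposes no condition.
\<close>

fun C_par :: "bool option \<Rightarrow> nat \<Rightarrow> real \<Rightarrow> (real \<Rightarrow> real) \<Rightarrow> bool" where
  "C_par m 0 L f \<longleftrightarrow> continuous_on {0..L} f \<and> (m = Some True \<longrightarrow> f 0 = 0 \<and> f L = 0)"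
| "C_par m (Suc k) L f \<longleftrightarrow> f differentiable_on {0..L} \<and> (m = Some True \<longrightarrow> f 0 = 0 \<and> f L = 0) \<and>
     C_par (map_option Not m) k L (deriv_within {0..L} f)"

lemma C_par_None: "C_par None k L f \<longleftrightarrow> C_on k {0..L} f"
  by (induction k arbitrary: f) auto

lemma C_par_weaken: "C_par m k L f \<Longrightarrow> C_par None k L f"
  by (induction k arbitrary: f m) auto

lemma C_par_zero: "C_par (Some True) k L f \<Longrightarrow> f 0 = 0 \<and> f L = 0"
  by (cases k) auto

context
  fixes L :: real
  assumes L: "0 < L"
begin

lemma C_par_cong:
  "(\<And>x. x \<in> {0..L} \<Longrightarrow> f x = g x) \<Longrightarrow> C_par m k L f = C_par m k L g"
proof (induction k arbitrary: f g m)
  case 0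
  then show ?case
    using continuous_on_cong[of "{0..L}" "{0..L}" f g] L by simp
next
  case (Suc k)
  have "C_par (map_option Not m) k L (deriv_within {0..L} f) = C_par (map_option Not m) k L (deriv_within {0..L} g)"
    using Suc.prems by (intro Suc.IH deriv_within_cong)
  then show ?case
    using differentiable_on_cong[of "{0..L}" f g] Suc.prems L by simp
qed

lemma C_par_Suc_D: "C_par m (Suc k) L f \<Longrightarrow> C_par m k L f"
  by (induction k arbitrary: f m) (auto simp: differentiable_imp_continuous_on)

lemma C_par_mono: "C_par m k L f \<Longrightarrow> j \<le> k \<Longrightarrow> C_par m j L f"
proof (induction k)
  case (Suc k)
  then show ?case
    using C_par_Suc_D le_Suc_eq by blast
qed simp

lemma C_par_add: "C_par m k L f \<Longrightarrow> C_par m k L g \<Longrightarrow> C_par m k L (\<lambda>x. f x + g x)"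
proof (induction k arbitrary: f g m)
  case 0
  then show ?case by (auto intro: continuous_intros)
next
  case (Suc k)
  have "deriv_within {0..L} (\<lambda>x. f x + g x) x = deriv_within {0..L} f x + deriv_within {0..L} g x" if "x \<in> {0..L}" for x
    using Suc.prems that L by (intro deriv_within_eqI DERIV_add deriv_within_works) auto
  then have "C_par (map_option Not m) k L (deriv_within {0..L} (\<lambda>x. f x + g x))"
    using Suc by (subst C_par_cong) auto
  then show ?case
    using Suc.prems by auto
qed

lemma C_par_const_0: "C_par m k L (\<lambda>x. 0)"
proof (induction k arbitrary: m)
  case (Suc k)
  have "deriv_within {0..L} (\<lambda>x. 0) x = 0" if "x \<in> {0..L}" for x
    using that L by (intro deriv_within_eqI) auto
  then have "C_par (map_option Not m) k L (deriv_within {0..L} (\<lambda>x. 0))"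
    using Suc by (subst C_par_cong) auto
  then show ?case
    by auto
qed auto

lemma C_par_cmult: "C_par m k L f \<Longrightarrow> C_par m k L (\<lambda>x. c * f x)"
proof (induction k arbitrary: f m)
  case 0
  then show ?case by (auto intro: continuous_intros)
next
  case (Suc k)
  have "deriv_within {0..L} (\<lambda>x. c * f x) x = c * deriv_within {0..L} f x" if "x \<in> {0..L}" for x
    using Suc.prems that L by (intro deriv_within_eqI DERIV_cmult deriv_within_works) auto
  then have "C_par (map_option Not m) k L (deriv_within {0..L} (\<lambda>x. c * f x))"
    using Suc by (subst C_par_cong) auto
  then show ?case
    using Suc.prems by auto
qed

lemma C_par_sum: "(\<And>j. j \<in> J \<Longrightarrow> C_par m k L (f j)) \<Longrightarrow> C_par m k L (\<lambda>x. \<Sum>j\<in>J. f j x)"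
  by (induction J rule: infinite_finite_induct) (auto intro: C_par_add C_par_const_0)

text \<open>\<open>b \<noteq> c\<close> is the exclusive or, with True for odd: odd times odd is
  even, odd times even is odd. In the product rule each summand flips the parity of exactly one
  factor, hence that of the product.\<close>

lemma C_par_mult:
  "C_par (Some b) k L f \<Longrightarrow> C_par (Some c) k L g \<Longrightarrow> C_par (Some (b \<noteq> c)) k L (\<lambda>x. f x * g x)"
proof (induction k arbitrary: f g b c)
  case 0
  then show ?case by (auto intro: continuous_intros)
next
  case (Suc k)
  have D: "deriv_within {0..L} (\<lambda>x. f x * g x) x = deriv_within {0..L} f x * g x + f x * deriv_within {0..L} g x" if "x \<in> {0..L}" for x
  proof -
    have "((\<lambda>x. f x * g x) has_real_derivative deriv_within {0..L} f x * g x + deriv_within {0..L} g x * f x) (at x within {0..L})"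
      using Suc.prems that by (intro DERIV_mult deriv_within_works) auto
    then show ?thesis
      using that L by (intro deriv_within_eqI) (auto simp: mult.commute)
  qed
  have h: "C_par (Some (\<not> b)) k L (deriv_within {0..L} f)" "C_par (Some b) k L f"
    "C_par (Some (\<not> c)) k L (deriv_within {0..L} g)" "C_par (Some c) k L g"
    using Suc.prems Suc.prems[THEN C_par_Suc_D] by simp_all
  have "C_par (Some ((\<not> b) \<noteq> c)) k L (\<lambda>x. deriv_within {0..L} f x * g x)"
    by (rule Suc.IH[OF h(1) h(4)])
  moreover have "C_par (Some (b \<noteq> (\<not> c))) k L (\<lambda>x. f x * deriv_within {0..L} g x)"
    by (rule Suc.IH[OF h(2) h(3)])
  ultimately have "C_par (Some (\<not> (b \<noteq> c))) k L (\<lambda>x. deriv_within {0..L} f x * g x + f x * deriv_within {0..L} g x)"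
    using C_par_add by simp
  then have "C_par (Some (\<not> (b \<noteq> c))) k L (deriv_within {0..L} (\<lambda>x. f x * g x))"
    using D by (subst C_par_cong) auto
  then show ?case
    using Suc.prems by (auto intro!: differentiable_on_mult)
qed

text \<open>Read backwards, the recurrence gives the second derivative of W n as (W (n + 2) - F
  n)/\<nu>^2. So the conditions W n = 0 at the end points, which concern time derivatives, become
  conditions on the even space derivatives of the data.\<close>

lemma C_par_recurrence:
  fixes W F :: "nat \<Rightarrow> real \<Rightarrow> real"
  assumes \<nu>: "\<nu> \<noteq> 0"
    and rec: "\<And>n x. x \<in> {0..L} \<Longrightarrow> W (Suc (Suc n)) x = \<nu>\<^sup>2 * deriv_within {0..L} (deriv_within {0..L} (W n)) x + F n x"
    and W01: "C_on K {0..L} (W 0)" "C_on (K - 1) {0..L} (W (Suc 0))"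
    and zero: "\<And>n. n \<le> K \<Longrightarrow> W n 0 = 0 \<and> W n L = 0"
    and F: "\<And>n. Suc (Suc n) \<le> K \<Longrightarrow> (\<And>j. j \<le> n \<Longrightarrow> C_par None (K - j) L (W j)) \<Longrightarrow> C_par (Some True) (K - Suc (Suc n)) L (F n)"
    and n: "n \<le> K"
  shows "C_par (Some True) (K - n) L (W n)"
proof -
  \<comment> \<open>Plain regularity is obtained upwards in n: each step from n to n + 2 costs two
    derivatives.\<close>
  have N: "C_par None (K - n) L (W n)" if "n \<le> K" for n
    using that
  proof (induction n rule: less_induct)
    case (less n)
    consider "n = 0" | "n = Suc 0" | j where "n = Suc (Suc j)"
      by (metis not0_implies_Suc)
    then show ?case
    proof cases
      case 3
      then have K: "K - j = Suc (Suc (K - n))"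
        using less.prems by simp
      have "C_par None (K - j) L (W j)"
        using less 3 by simp
      then have "C_par None (K - n) L (deriv_within {0..L} (deriv_within {0..L} (W j)))"
        unfolding K by simp
      moreover have "C_par None (K - n) L (F j)"
        using F[of j] less 3 C_par_weaken by auto
      ultimately have "C_par None (K - n) L (\<lambda>x. \<nu>\<^sup>2 * deriv_within {0..L} (deriv_within {0..L} (W j)) x + F j x)"
        by (intro C_par_add C_par_cmult)
      then show ?thesis
        using rec 3 by (subst C_par_cong) auto
    qed (use W01 in \<open>auto simp: C_par_None\<close>)
  qed
  \<comment> \<open>Parity is obtained downwards from n = K, by induction on K - n: the second
    derivative inherits it from W (n + 2) and F n, and the value at the end points is the
    compatibility condition. In the cases K - n = 0 and K - n = 1 only that value is
    concerned.\<close>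
  show ?thesis
    using n
  proof (induction "K - n" arbitrary: n rule: less_induct)
    case less
    note Nn = N[OF less.prems] and z = zero[OF less.prems]
    consider "K - n = 0" | "K - n = Suc 0" | j where "K - n = Suc (Suc j)"
      by (metis not0_implies_Suc)
    then show ?case
    proof cases
      case 3
      then have j: "Suc (Suc n) \<le> K" "K - Suc (Suc n) = j"
        by auto
      have "C_par (Some True) j L (W (Suc (Suc n)))"
        using less.hyps[of "Suc (Suc n)"] j 3 by simp
      moreover have "C_par (Some True) j L (F n)"
        using F[of n] j N by auto
      ultimately have "C_par (Some True) j L (\<lambda>x. 1 / \<nu>\<^sup>2 * (W (Suc (Suc n)) x + (-1) * F n x))"
        by (intro C_par_add C_par_cmult)
      moreover have "1 / \<nu>\<^sup>2 * (W (Suc (Suc n)) x + (-1) * F n x) = deriv_within {0..L} (deriv_within {0..L} (W n)) x" if "x \<in> {0..L}" for x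
        using rec[OF that, of n] \<nu> by simp
      ultimately have "C_par (Some True) j L (deriv_within {0..L} (deriv_within {0..L} (W n)))"
        by (subst C_par_cong[of _ "\<lambda>x. 1 / \<nu>\<^sup>2 * (W (Suc (Suc n)) x + (-1) * F n x)"]) auto
      then show ?thesis
        using Nn z 3 by simp
    qed (use Nn z in auto)
  qed
qed

end

section \<open>Formal time derivatives of the cubic source\<close>

lemma higher_deriv_poly: "(deriv ^^ n) (\<lambda>s. poly P s) = (\<lambda>s. poly ((pderiv ^^ n) P) s)" for P :: "real poly"
proof (induction n)
  case (Suc n)
  then show ?case
    by (auto intro!: ext DERIV_imp_deriv poly_DERIV)
qed simp

lemma source_deriv_f1: "source_deriv f1 m U V x = 0"
proof -
  have "(deriv ^^ m) (\<lambda>s::real. 0 :: real) = (\<lambda>s. 0)"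
    by (induction m) auto
  then show ?thesis
    by (simp add: source_deriv_def f1_def)
qed

text \<open>The argument is a polynomial in s, so its n-th derivative at 0 is n! times its n-th
  coefficient: Leibniz's rule for three factors. Every term is a triple product of the U, which
  keeps odd parity.\<close>

lemma source_deriv_f2:
  "source_deriv f2 n U V x = (\<Sum>i\<le>n. \<Sum>j\<le>n - i.
     (fact n / (fact i * fact j * fact (n - i - j))) * (U i x * (U j x * U (n - i - j) x)))"
proof -
  define P where "P = (\<Sum>j\<le>n. monom (U j x / fact j) j)"
  have "f2 (\<Sum>j\<le>n. U j x * s ^ j / fact j) y = poly (P * (P * P)) s" for s y
    by (simp add: P_def poly_sum poly_monom f2_def power3_eq_cube)
  then have "source_deriv f2 n U V x = poly ((pderiv ^^ n) (P * (P * P))) 0"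
    unfolding source_deriv_def by (simp add: higher_deriv_poly del: poly_mult)
  also have "\<dots> = fact n * coeff (P * (P * P)) n"
    by (simp add: poly_0_coeff_0 coeff_higher_pderiv pochhammer_fact)
  also have "\<dots> = (\<Sum>i\<le>n. \<Sum>j\<le>n - i. fact n * (coeff P i * (coeff P j * coeff P (n - i - j))))"
    by (simp add: coeff_mult sum_distrib_left)
  also have "coeff P i = U i x / fact i" if "i \<le> n" for i
    using that by (simp add: P_def coeff_sum)
  then have "(\<Sum>i\<le>n. \<Sum>j\<le>n - i. fact n * (coeff P i * (coeff P j * coeff P (n - i - j)))) =
     (\<Sum>i\<le>n. \<Sum>j\<le>n - i. (fact n / (fact i * fact j * fact (n - i - j))) * (U i x * (U j x * U (n - i - j) x)))"
    by (intro sum.cong) auto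
  finally show ?thesis .
qed

text \<open>The formal system is triangular. The recurrence of U has no source, so parity of all U n
  is available when the source of V, a sum of triple products of the U, is examined.\<close>

lemma compatible_C_par:
  assumes L: "0 < L" and \<nu>: "\<nu>1 \<noteq> 0" "\<nu>2 \<noteq> 0" and comp: "compatible (Suc k) L \<nu>1 \<nu>2 u0 u1 v0 v1"
    and C: "C_on (Suc k) {0..L} u0" "C_on k {0..L} u1" "C_on (Suc k) {0..L} v0" "C_on k {0..L} v1"
  shows "C_par (Some True) (Suc k) L u0" "C_par (Some True) k L u1" "C_par (Some True) (Suc k) L v0" "C_par (Some True) k L v1"
proof -
  define U where "U = formal_U {0..L} \<nu>1 \<nu>2 u0 u1 v0 v1"
  define V where "V = formal_V {0..L} \<nu>1 \<nu>2 u0 u1 v0 v1"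
  have z: "U n 0 = 0 \<and> U n L = 0" "V n 0 = 0 \<and> V n L = 0" if "n \<le> Suc k" for n
    using comp that by (auto simp: compatible_def U_def V_def)
  have U01: "U 0 = u0" "U (Suc 0) = u1" "V 0 = v0" "V (Suc 0) = v1"
    by (simp_all add: U_def V_def)
  have recU: "U (Suc (Suc n)) x = \<nu>1\<^sup>2 * deriv_within {0..L} (deriv_within {0..L} (U n)) x + 0" for n x
    by (simp add: U_def source_deriv_f1 numeral_2_eq_2)
  have recV: "V (Suc (Suc n)) x = \<nu>2\<^sup>2 * deriv_within {0..L} (deriv_within {0..L} (V n)) x + source_deriv f2 n U V x" for n x
    by (simp add: U_def V_def numeral_2_eq_2)
  have PU: "C_par (Some True) (Suc k - n) L (U n)" if "n \<le> Suc k" for n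
  proof (rule C_par_recurrence[where W = U and K = "Suc k" and F = "\<lambda>n x. 0", OF L \<nu>(1) recU _ _ _ C_par_const_0[OF L] that])
    show "C_on (Suc k) {0..L} (U 0)" "C_on (Suc k - 1) {0..L} (U (Suc 0))"
      unfolding U01 diff_Suc_1 by (fact C)+
  qed (fact z)
  have PF: "C_par (Some True) (Suc k - Suc (Suc n)) L (\<lambda>x. source_deriv f2 n U V x)" if "Suc (Suc n) \<le> Suc k" for n
    unfolding source_deriv_f2
  proof (intro C_par_sum[OF L] C_par_cmult[OF L])
    fix i j assume ij: "i \<in> {..n}" "j \<in> {..n - i}"
    have *: "C_par (Some True) (Suc k - Suc (Suc n)) L (U l)" if "l \<le> n" for l
      by (rule C_par_mono[OF L PU]) (use \<open>Suc (Suc n) \<le> Suc k\<close> that in auto)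
    have "i \<le> n" "j \<le> n" "n - i - j \<le> n"
      using ij by auto
    from C_par_mult[OF L *[OF this(1)] C_par_mult[OF L *[OF this(2)] *[OF this(3)]]]
    show "C_par (Some True) (Suc k - Suc (Suc n)) L (\<lambda>x. U i x * (U j x * U (n - i - j) x))"
      by (simp only: simp_thms)
  qed
  have PV: "C_par (Some True) (Suc k - n) L (V n)" if "n \<le> Suc k" for n
  proof (rule C_par_recurrence[where W = V and K = "Suc k" and F = "\<lambda>n x. source_deriv f2 n U V x", OF L \<nu>(2) recV _ _ _ PF that])
    show "C_on (Suc k) {0..L} (V 0)" "C_on (Suc k - 1) {0..L} (V (Suc 0))"
      unfolding U01 diff_Suc_1 by (fact C)+
  qed (fact z)
  show "C_par (Some True) (Suc k) L u0" "C_par (Some True) k L u1" "C_par (Some True) (Suc k) L v0" "C_par (Some True) k L v1"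
    using PU[of 0] PU[of "Suc 0"] PV[of 0] PV[of "Suc 0"] by (simp_all only: U01 diff_zero diff_Suc_Suc le0 Suc_le_mono)
qed

section \<open>Odd periodic extension\<close>

text \<open>The cell number is an argument of its own because at a common end point the formulas of
  two neighbouring cells have to be compared.\<close>

definition refl_ext_piece :: "bool \<Rightarrow> real \<Rightarrow> (real \<Rightarrow> real) \<Rightarrow> int \<Rightarrow> real \<Rightarrow> real" where
  "refl_ext_piece b L f n x = (if even n then f (x - L * of_int n) else (if b then - 1 else 1) * f (L * of_int (n + 1) - x))"

definition refl_ext :: "bool \<Rightarrow> real \<Rightarrow> (real \<Rightarrow> real) \<Rightarrow> real \<Rightarrow> real" where
  "refl_ext b L f x = refl_ext_piece b L f \<lfloor>x / L\<rfloor> x"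

context
  fixes L :: real
  assumes L: "0 < L"
begin

lemma floor_cell: "L * of_int \<lfloor>x / L\<rfloor> \<le> x" "x < L * of_int (\<lfloor>x / L\<rfloor> + 1)"
  using mult_left_mono[OF of_int_floor_le[of "x / L"], of L] real_of_int_floor_add_one_gt[of "x / L"] L
  by (simp_all add: field_simps)

text \<open>The closed cells containing x cover a neighbourhood of it, so limits within the cells
  combine to a full limit. Applied to values it yields continuity, applied to difference quotients
  differentiability.\<close>

lemma tendsto_glue:
  fixes g :: "real \<Rightarrow> real"
  assumes "\<And>n :: int. x \<in> {L * of_int n..L * of_int (n + 1)} \<Longrightarrow>
     (g \<longlongrightarrow> l) (at x within {L * of_int n..L * of_int (n + 1)})"
  shows "(g \<longlongrightarrow> l) (at x)"
proof -
  define n where "n = \<lfloor>x / L\<rfloor>"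
  have n: "L * of_int n \<le> x" "x < L * of_int (n + 1)"
    using floor_cell[of x] by (simp_all add: n_def)
  have 1: "(g \<longlongrightarrow> l) (at x within {L * of_int n..L * of_int (n + 1)})"
    using n by (intro assms) auto
  show ?thesis
  proof (cases "x = L * of_int n")
    case True
    have "(g \<longlongrightarrow> l) (at x within {L * of_int (n - 1)..L * of_int (n - 1 + 1)})"
      using True L by (intro assms) auto
    then have "(g \<longlongrightarrow> l) (at x within {L * of_int (n - 1)..L * of_int n} \<union> {L * of_int n..L * of_int (n + 1)})"
      using 1 by (simp add: Lim_within_Un)
    moreover have "{L * of_int (n - 1)..L * of_int n} \<union> {L * of_int n..L * of_int (n + 1)} = {L * of_int (n - 1)..L * of_int (n + 1)}"
      using L by (intro ivl_disj_un_two_touch) auto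
    ultimately show ?thesis
      using at_within_Icc_at[of "L * of_int (n - 1)" x "L * of_int (n + 1)"] True L by simp
  next
    case False
    then show ?thesis
      using 1 n at_within_Icc_at[of "L * of_int n" x "L * of_int (n + 1)"] by auto
  qed
qed

text \<open>At a common end point the formulas of both cells agree: by symmetry for the even
  extension, and because f vanishes at 0 and L for the odd one.\<close>

lemma refl_ext_eq_piece:
  assumes "C_par (Some b) k L f" "x \<in> {L * of_int n..L * of_int (n + 1)}"
  shows "refl_ext b L f x = refl_ext_piece b L f n x"
proof (cases "x = L * of_int (n + 1)")
  case True
  then have "\<lfloor>x / L\<rfloor> = n + 1"
    using L by simp
  moreover have "b \<Longrightarrow> f 0 = 0 \<and> f L = 0"
    using assms(1) C_par_zero by auto
  ultimately show ?thesis
    by (cases b) (auto simp: refl_ext_def refl_ext_piece_def True algebra_simps)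
next
  case False
  then have "\<lfloor>x / L\<rfloor> = n"
    using assms(2) L by (simp add: floor_eq_iff field_simps)
  then show ?thesis
    by (simp add: refl_ext_def)
qed

lemma refl_ext_bounded:
  assumes "\<And>x. x \<in> {0..L} \<Longrightarrow> \<bar>f x\<bar> \<le> M"
  shows "\<bar>refl_ext b L f x\<bar> \<le> M"
proof -
  define n where "n = \<lfloor>x / L\<rfloor>"
  have n: "L * of_int n \<le> x" "x \<le> L * of_int (n + 1)"
    using floor_cell[of x] by (simp_all add: n_def)
  then have "x - L * of_int n \<in> {0..L}" "L * of_int (n + 1) - x \<in> {0..L}"
    by (auto simp: algebra_simps)
  then show ?thesis
    using assms by (auto simp: refl_ext_def refl_ext_piece_def n_def[symmetric] abs_mult)
qed

lemma refl_ext_continuous: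
  assumes "C_par (Some b) k L f"
  shows "continuous_on UNIV (refl_ext b L f)"
proof -
  have c: "continuous_on {0..L} f"
    using assms C_par_mono[OF L, of "Some b" k f 0] by simp
  have "(refl_ext b L f \<longlongrightarrow> refl_ext b L f x) (at x)" for x
  proof (rule tendsto_glue)
    fix n :: int assume x: "x \<in> {L * of_int n..L * of_int (n + 1)}"
    have "continuous_on {L * of_int n..L * of_int (n + 1)} (refl_ext_piece b L f n)"
      unfolding refl_ext_piece_def
      by (cases "even n") (auto intro!: continuous_intros continuous_on_compose2[OF c] simp: algebra_simps)
    then have "continuous_on {L * of_int n..L * of_int (n + 1)} (refl_ext b L f)"
      using refl_ext_eq_piece[OF assms] by (subst continuous_on_cong[OF refl]) auto
    then show "(refl_ext b L f \<longlongrightarrow> refl_ext b L f x) (at x within {L * of_int n..L * of_int (n + 1)})"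
      using x by (simp add: continuous_on_def)
  qed
  then show ?thesis
    by (simp add: continuous_on_def)
qed

text \<open>Differentiating a mirrored piece produces a sign, so odd and even extensions are
  exchanged. The derivative of the extension is found within each closed cell and glued.\<close>

lemma refl_ext_has_derivative:
  assumes p: "C_par (Some b) (Suc k) L f"
  shows "(refl_ext b L f has_real_derivative refl_ext (\<not> b) L (deriv_within {0..L} f) x) (at x)"
  unfolding has_field_derivative_iff
proof (rule tendsto_glue)
  fix n :: int
  let ?I = "{L * of_int n..L * of_int (n + 1)}"
  assume x: "x \<in> ?I"
  have pD: "C_par (Some (\<not> b)) k L (deriv_within {0..L} f)" and d: "f differentiable_on {0..L}"
    using p by auto
  have "(refl_ext_piece b L f n has_real_derivative refl_ext_piece (\<not> b) L (deriv_within {0..L} f) n x) (at x within ?I)"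
  proof (cases "even n")
    case True
    have im: "(\<lambda>x. x - L * of_int n) ` ?I \<subseteq> {0..L}"
      by (auto simp: algebra_simps)
    have "(f has_real_derivative deriv_within {0..L} f (x - L * of_int n)) (at (x - L * of_int n) within (\<lambda>x. x - L * of_int n) ` ?I)"
      by (rule DERIV_subset[OF deriv_within_works[OF d subsetD[OF im imageI[OF x]]] im])
    moreover have "((\<lambda>x. x - L * of_int n) has_real_derivative 1) (at x within ?I)"
      by (auto intro!: derivative_eq_intros)
    ultimately show ?thesis
      using True DERIV_image_chain[of f _ "\<lambda>x. x - L * of_int n" x ?I 1] by (simp add: refl_ext_piece_def[abs_def] o_def)
  next
    case False
    have im: "(\<lambda>x. L * of_int (n + 1) - x) ` ?I \<subseteq> {0..L}"
      by (auto simp: algebra_simps)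
    have "(f has_real_derivative deriv_within {0..L} f (L * of_int (n + 1) - x)) (at (L * of_int (n + 1) - x) within (\<lambda>x. L * of_int (n + 1) - x) ` ?I)"
      by (rule DERIV_subset[OF deriv_within_works[OF d subsetD[OF im imageI[OF x]]] im])
    moreover have "((\<lambda>x. L * of_int (n + 1) - x) has_real_derivative - 1) (at x within ?I)"
      by (auto intro!: derivative_eq_intros)
    ultimately have "((\<lambda>x. f (L * of_int (n + 1) - x)) has_real_derivative - deriv_within {0..L} f (L * of_int (n + 1) - x)) (at x within ?I)"
      using DERIV_image_chain[of f _ "\<lambda>x. L * of_int (n + 1) - x" x ?I "- 1"] by (simp add: o_def)
    from DERIV_cmult[OF this, of "if b then - 1 else 1"] show ?thesis
      using False by (cases b) (simp_all add: refl_ext_piece_def[abs_def])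
  qed
  moreover have "refl_ext_piece (\<not> b) L (deriv_within {0..L} f) n x = refl_ext (\<not> b) L (deriv_within {0..L} f) x"
    by (rule refl_ext_eq_piece[OF pD x, symmetric])
  ultimately have "(refl_ext b L f has_real_derivative refl_ext (\<not> b) L (deriv_within {0..L} f) x) (at x within ?I)"
    using has_derivative_transform[OF x refl_ext_eq_piece[OF p]] unfolding has_field_derivative_def by simp
  then show "((\<lambda>y. (refl_ext b L f y - refl_ext b L f x) / (y - x)) \<longlongrightarrow> refl_ext (\<not> b) L (deriv_within {0..L} f) x) (at x within ?I)"
    by (simp add: has_field_derivative_iff)
qed

text \<open>Every derivative of the extension is an extension of a derivative, so bounds on [0, L]
  hold on the whole line.\<close>

lemma CF_refl_ext:
  assumes "\<And>i. i \<in> I \<Longrightarrow> C_par (Some b) k L (f i)"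
    "\<And>n. n \<le> k \<Longrightarrow> \<exists>M. \<forall>i\<in>I. \<forall>x\<in>{0..L}. \<bar>(deriv_within {0..L} ^^ n) (f i) x\<bar> \<le> M"
  shows "CF k I (\<lambda>i. refl_ext b L (f i))"
  using assms
proof (induction k arbitrary: f b)
  have lb: "locally_bdd I (\<lambda>i. refl_ext b L (f i))"
    if "\<And>n. n \<le> k \<Longrightarrow> \<exists>M. \<forall>i\<in>I. \<forall>x\<in>{0..L}. \<bar>(deriv_within {0..L} ^^ n) (f i) x\<bar> \<le> M" for f b k
  proof -
    have "\<exists>M. \<forall>i\<in>I. \<forall>x\<in>{0..L}. \<bar>f i x\<bar> \<le> M"
      using that[of 0] by simp
    then obtain M where M: "\<forall>i\<in>I. \<forall>x\<in>{0..L}. \<bar>f i x\<bar> \<le> M" ..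
    then have "\<bar>refl_ext b L (f i) x\<bar> \<le> M" if "i \<in> I" for i x
      using that by (intro refl_ext_bounded) auto
    then show ?thesis
      unfolding locally_bdd_def by blast
  qed
  {
    case 0
    have "locally_bdd I (\<lambda>i. refl_ext b L (f i))"
      by (rule lb, rule 0(2))
    then show ?case
      using refl_ext_continuous[OF 0(1)] by simp
  next
    case (Suc k)
    show ?case
    proof (rule CF_real_SucI)
      show "locally_bdd I (\<lambda>i. refl_ext b L (f i))"
        using Suc.prems(2) by (rule lb)
      show "(refl_ext b L (f i) has_real_derivative refl_ext (\<not> b) L (deriv_within {0..L} (f i)) x) (at x)" if "i \<in> I" for i x
        by (rule refl_ext_has_derivative[OF Suc.prems(1)[OF that]])
      show "CF k I (\<lambda>i. refl_ext (\<not> b) L (deriv_within {0..L} (f i)))"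
      proof (rule Suc.IH)
        show "C_par (Some (\<not> b)) k L (deriv_within {0..L} (f i))" if "i \<in> I" for i
          using Suc.prems(1)[OF that] by simp
        show "\<exists>M. \<forall>i\<in>I. \<forall>x\<in>{0..L}. \<bar>(deriv_within {0..L} ^^ n) (deriv_within {0..L} (f i)) x\<bar> \<le> M" if "n \<le> k" for n
          using Suc.prems(2)[of "Suc n"] that by (simp add: funpow_swap1)
      qed
    qed
  }
qed

lemma refl_ext_eq: "C_par (Some True) k L f \<Longrightarrow> x \<in> {0..L} \<Longrightarrow> refl_ext True L f x = f x"
  using refl_ext_eq_piece[of True k f x 0] by (simp add: refl_ext_piece_def)

lemma refl_ext_odd_refl:
  assumes "C_par (Some True) k L f" shows "odd_refl L (refl_ext True L f)"
proof -
  have per: "refl_ext True L f (x + 2 * L) = refl_ext True L f x" for x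
  proof -
    have "\<lfloor>(x + 2 * L) / L\<rfloor> = \<lfloor>x / L\<rfloor> + 2"
      using L by (simp add: add_divide_distrib)
    then show ?thesis
      by (simp add: refl_ext_def refl_ext_piece_def algebra_simps)
  qed
  have odd: "refl_ext True L f (- x) = - refl_ext True L f x" for x
  proof -
    define n where "n = \<lfloor>x / L\<rfloor>"
    have n: "L * of_int n \<le> x" "x \<le> L * of_int (n + 1)"
      using floor_cell[of x] by (simp_all add: n_def)
    then have "refl_ext True L f x = refl_ext_piece True L f n x"
      by (intro refl_ext_eq_piece[OF assms]) auto
    moreover have "refl_ext True L f (- x) = refl_ext_piece True L f (- n - 1) (- x)"
      using n by (intro refl_ext_eq_piece[OF assms]) (auto simp: algebra_simps)
    moreover have "refl_ext_piece True L f (- n - 1) (- x) = - refl_ext_piece True L f n x"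
      by (auto simp: refl_ext_piece_def algebra_simps)
    ultimately show ?thesis by simp
  qed
  show ?thesis
    unfolding odd_refl_def using odd per[of "- x" for x] by (simp add: algebra_simps)
qed

end

text \<open>The suprema in \<open>C_norm\<close> have their meaning only for sets that are bounded
  above; continuity on a compact interval provides this.\<close>

lemma C_on_bdd_above:
  assumes "C_on k {a..b} f" "n \<le> k"
  shows "bdd_above ((\<lambda>x. \<bar>(deriv_within {a..b} ^^ n) f x\<bar>) ` {a..b})"
proof -
  have "continuous_on {a..b} ((deriv_within {a..b} ^^ n) f)"
    using assms
  proof (induction n arbitrary: f k)
    case 0
    then show ?case
      by (cases k) (auto simp: differentiable_imp_continuous_on)
  next
    case (Suc n)
    then obtain k' where "k = Suc k'" "n \<le> k'"
      by (cases k) auto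
    then show ?case
      using Suc.IH[of k' "deriv_within {a..b} f"] Suc.prems by (simp add: funpow_swap1)
  qed
  then have "continuous_on {a..b} (\<lambda>x. \<bar>(deriv_within {a..b} ^^ n) f x\<bar>)"
    by (intro continuous_intros)
  from compact_continuous_image[OF this] show ?thesis
    by (auto dest: compact_imp_bounded intro: bounded_imp_bdd_above)
qed

lemma C_norm_ge:
  assumes "C_on k {a..b} f" "n \<le> k" "x \<in> {a..b}"
  shows "\<bar>(deriv_within {a..b} ^^ n) f x\<bar> \<le> C_norm k {a..b} f"
proof -
  have "\<bar>(deriv_within {a..b} ^^ n) f x\<bar> \<le> (SUP x\<in>{a..b}. \<bar>(deriv_within {a..b} ^^ n) f x\<bar>)"
    by (rule cSUP_upper[OF assms(3) C_on_bdd_above[OF assms(1,2)]])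
  also have "\<dots> \<le> C_norm k {a..b} f"
    unfolding C_norm_def
  proof (rule member_le_sum)
    fix m assume "m \<in> {..k} - {n}"
    then have "\<bar>(deriv_within {a..b} ^^ m) f x\<bar> \<le> (SUP x\<in>{a..b}. \<bar>(deriv_within {a..b} ^^ m) f x\<bar>)"
      by (intro cSUP_upper[OF assms(3) C_on_bdd_above[OF assms(1)]]) auto
    then show "0 \<le> (SUP x\<in>{a..b}. \<bar>(deriv_within {a..b} ^^ m) f x\<bar>)"
      by linarith
  qed (use assms in auto)
  finally show ?thesis .
qed

section \<open>Functions on the rectangle\<close>

lemma dt_cong:
  assumes "\<And>t x. t \<in> I \<Longrightarrow> x \<in> S \<Longrightarrow> w t x = z t x" "t \<in> I" "x \<in> S"
  shows "dt I w t x = dt I z t x"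
  unfolding dt_def by (rule deriv_within_cong) (use assms in auto)

lemma dx_cong:
  assumes "\<And>t x. t \<in> I \<Longrightarrow> x \<in> S \<Longrightarrow> w t x = z t x" "t \<in> I" "x \<in> S"
  shows "dx S w t x = dx S z t x"
  unfolding dx_def by (rule deriv_within_cong) (use assms in auto)

lemma C_on_rect_cong:
  "(\<And>t x. t \<in> I \<Longrightarrow> x \<in> S \<Longrightarrow> w t x = z t x) \<Longrightarrow> C_on_rect k I S w = C_on_rect k I S z"
proof (induction k arbitrary: w z)
  case 0
  show ?case
    unfolding C_on_rect.simps by (rule continuous_on_cong) (auto simp: 0)
next
  case (Suc k)
  have c: "continuous_on (I \<times> S) (\<lambda>(t, x). w t x) = continuous_on (I \<times> S) (\<lambda>(t, x). z t x)"
    by (rule continuous_on_cong) (auto simp: Suc.prems)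
  have d1: "(\<lambda>t. w t x) differentiable_on I \<longleftrightarrow> (\<lambda>t. z t x) differentiable_on I" if "x \<in> S" for x
    using Suc.prems that by (intro differentiable_on_cong) auto
  have d2: "w t differentiable_on S \<longleftrightarrow> z t differentiable_on S" if "t \<in> I" for t
    using Suc.prems that by (intro differentiable_on_cong) auto
  have "C_on_rect k I S (dt I w) = C_on_rect k I S (dt I z)"
    by (rule Suc.IH, rule dt_cong) (use Suc.prems in auto)
  moreover have "C_on_rect k I S (dx S w) = C_on_rect k I S (dx S z)"
    by (rule Suc.IH, rule dx_cong) (use Suc.prems in auto)
  ultimately show ?case
    by (simp add: c d1 d2)
qed

lemma C_on_rect_partials:
  assumes "C_on_rect (Suc k) I S w" "t \<in> I" "x \<in> S"
  shows "((\<lambda>t. w t x) has_real_derivative dt I w t x) (at t within I)"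
    "(w t has_real_derivative dx S w t x) (at x within S)"
  using assms unfolding dt_def dx_def by (auto intro!: deriv_within_works)

lemma C_on_rect_continuous: "C_on_rect k I S w \<Longrightarrow> continuous_on (I \<times> S) (\<lambda>(t, x). w t x)"
  by (cases k) auto

context
  fixes a b c d :: real
  assumes ab: "a < b" and cd: "c < d"
begin

lemma dt_eq:
  assumes "\<And>t x. t \<in> {a..b} \<Longrightarrow> x \<in> {c..d} \<Longrightarrow> w t x = W (t, x)"
    "\<And>t x. ((\<lambda>r. W (r, x)) has_real_derivative Wt (t, x)) (at t)" "t \<in> {a..b}" "x \<in> {c..d}"
  shows "dt {a..b} w t x = Wt (t, x)"
proof -
  have "dt {a..b} w t x = dt {a..b} (\<lambda>t x. W (t, x)) t x"
    by (rule dt_cong[where S = "{c..d}"]) (use assms in auto)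
  also have "\<dots> = Wt (t, x)"
    unfolding dt_def using assms ab by (intro deriv_within_eqI) (auto intro: has_field_derivative_at_within)
  finally show ?thesis .
qed

lemma dx_eq:
  assumes "\<And>t x. t \<in> {a..b} \<Longrightarrow> x \<in> {c..d} \<Longrightarrow> w t x = W (t, x)"
    "\<And>t x. ((\<lambda>r. W (t, r)) has_real_derivative Wx (t, x)) (at x)" "t \<in> {a..b}" "x \<in> {c..d}"
  shows "dx {c..d} w t x = Wx (t, x)"
proof -
  have "dx {c..d} w t x = dx {c..d} (\<lambda>t x. W (t, x)) t x"
    by (rule dx_cong[where I = "{a..b}"]) (use assms in auto)
  also have "\<dots> = Wx (t, x)"
    unfolding dx_def using assms cd by (intro deriv_within_eqI) (auto intro: has_field_derivative_at_within)
  finally show ?thesis .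
qed

text \<open>On nondegenerate intervals the one-sided partial derivatives are those of the function
  on the plane.\<close>

lemma CF_C_on_rect:
  fixes W :: "'i \<Rightarrow> real \<times> real \<Rightarrow> real"
  assumes "CF k J W" "i \<in> J"
  shows "C_on_rect k {a..b} {c..d} (\<lambda>t x. W i (t, x))"
  using assms(1)
proof (induction k arbitrary: W)
  case 0
  show ?case
    using CF_continuous[OF 0 assms(2)] by (simp add: case_prod_eta)
next
  case (Suc k)
  obtain Wt Wx where
    W: "\<And>i t x. i \<in> J \<Longrightarrow> ((\<lambda>r. W i (r, x)) has_real_derivative Wt i (t, x)) (at t)"
      "\<And>i t x. i \<in> J \<Longrightarrow> ((\<lambda>r. W i (t, r)) has_real_derivative Wx i (t, x)) (at x)"
      "CF k J Wt" "CF k J Wx"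
    using Suc.prems by (rule CF_prod_SucE) blast
  have "C_on_rect k {a..b} {c..d} (dt {a..b} (\<lambda>t x. W i (t, x)))"
  proof -
    have "C_on_rect k {a..b} {c..d} (dt {a..b} (\<lambda>t x. W i (t, x))) = C_on_rect k {a..b} {c..d} (\<lambda>t x. Wt i (t, x))"
      by (rule C_on_rect_cong, rule dt_eq[OF refl W(1)[OF assms(2)]])
    then show ?thesis
      using Suc.IH[OF W(3)] by simp
  qed
  moreover have "C_on_rect k {a..b} {c..d} (dx {c..d} (\<lambda>t x. W i (t, x)))"
  proof -
    have "C_on_rect k {a..b} {c..d} (dx {c..d} (\<lambda>t x. W i (t, x))) = C_on_rect k {a..b} {c..d} (\<lambda>t x. Wx i (t, x))"
      by (rule C_on_rect_cong, rule dx_eq[OF refl W(2)[OF assms(2)]])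
    then show ?thesis
      using Suc.IH[OF W(4)] by simp
  qed
  moreover have "continuous_on ({a..b} \<times> {c..d}) (W i)"
    by (rule CF_continuous[OF Suc.prems assms(2)])
  moreover have "(\<lambda>t. W i (t, x)) differentiable_on {a..b}" "(\<lambda>x. W i (t, x)) differentiable_on {c..d}" for t x
    unfolding differentiable_on_def real_differentiable_def
    using has_field_derivative_at_within[OF W(1)[OF assms(2)]] has_field_derivative_at_within[OF W(2)[OF assms(2)]]
    by blast+
  ultimately show ?case
    by (simp add: case_prod_eta)
qed

text \<open>The factor \<open>c\<close> is carried along because the final estimate is obtained by rescaling.\<close>

lemma CF_iterate_partials:
  fixes W :: "'i \<Rightarrow> real \<times> real \<Rightarrow> real"
  assumes "CF (n + k) J W" "\<And>c' i t x. i \<in> J \<Longrightarrow> t \<in> {a..b} \<Longrightarrow> x \<in> {c..d} \<Longrightarrow> w c' i t x = c' * W i (t, x)"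
  shows "\<exists>W'. CF k J W' \<and> (\<forall>c'. \<forall>i\<in>J. \<forall>t\<in>{a..b}. \<forall>x\<in>{c..d}. (dt {a..b} ^^ n) (w c' i) t x = c' * W' i (t, x))"
    "\<exists>W'. CF k J W' \<and> (\<forall>c'. \<forall>i\<in>J. \<forall>t\<in>{a..b}. \<forall>x\<in>{c..d}. (dx {c..d} ^^ n) (w c' i) t x = c' * W' i (t, x))"
proof -
  show "\<exists>W'. CF k J W' \<and> (\<forall>c'. \<forall>i\<in>J. \<forall>t\<in>{a..b}. \<forall>x\<in>{c..d}. (dt {a..b} ^^ n) (w c' i) t x = c' * W' i (t, x))"
    using assms
  proof (induction n arbitrary: k)
    case (Suc n)
    obtain V where V: "CF (Suc k) J V" "\<And>c' i t x. i \<in> J \<Longrightarrow> t \<in> {a..b} \<Longrightarrow> x \<in> {c..d} \<Longrightarrow> (dt {a..b} ^^ n) (w c' i) t x = c' * V i (t, x)"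
      using Suc.IH[OF Suc.prems[unfolded add_Suc add_Suc_right[symmetric]]] by blast
    obtain Vt Vx where Vt: "\<And>i t x. i \<in> J \<Longrightarrow> ((\<lambda>r. V i (r, x)) has_real_derivative Vt i (t, x)) (at t)" "CF k J Vt"
      using V(1) by (rule CF_prod_SucE) blast
    have "(dt {a..b} ^^ Suc n) (w c' i) t x = c' * Vt i (t, x)" if "i \<in> J" "t \<in> {a..b}" "x \<in> {c..d}" for c' i t x
      using dt_eq[where W = "\<lambda>p. c' * V i p" and Wt = "\<lambda>p. c' * Vt i p", OF V(2)[OF that(1)] DERIV_cmult[OF Vt(1)[OF that(1)]] that(2,3)] by simp
    then show ?case
      using Vt(2) by blast
  qed auto
  show "\<exists>W'. CF k J W' \<and> (\<forall>c'. \<forall>i\<in>J. \<forall>t\<in>{a..b}. \<forall>x\<in>{c..d}. (dx {c..d} ^^ n) (w c' i) t x = c' * W' i (t, x))"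
    using assms
  proof (induction n arbitrary: k)
    case (Suc n)
    obtain V where V: "CF (Suc k) J V" "\<And>c' i t x. i \<in> J \<Longrightarrow> t \<in> {a..b} \<Longrightarrow> x \<in> {c..d} \<Longrightarrow> (dx {c..d} ^^ n) (w c' i) t x = c' * V i (t, x)"
      using Suc.IH[OF Suc.prems[unfolded add_Suc add_Suc_right[symmetric]]] by blast
    obtain Vt Vx where Vx: "\<And>i t x. i \<in> J \<Longrightarrow> ((\<lambda>r. V i (t, r)) has_real_derivative Vx i (t, x)) (at x)" "CF k J Vx"
      using V(1) by (rule CF_prod_SucE) blast
    have "(dx {c..d} ^^ Suc n) (w c' i) t x = c' * Vx i (t, x)" if "i \<in> J" "t \<in> {a..b}" "x \<in> {c..d}" for c' i t x
      using dx_eq[where W = "\<lambda>p. c' * V i p" and Wx = "\<lambda>p. c' * Vx i p", OF V(2)[OF that(1)] DERIV_cmult[OF Vx(1)[OF that(1)]] that(2,3)] by simp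
    then show ?case
      using Vx(2) by blast
  qed auto
qed

text \<open>The rectangle lies in one ball, so the local bounds of the family give one constant for
  all members and all scalings.\<close>

lemma CF_C_norm_rect_bounded:
  fixes W :: "'i \<Rightarrow> real \<times> real \<Rightarrow> real"
  assumes W: "CF k J W"
  shows "\<exists>C. \<forall>i\<in>J. \<forall>c'. C_norm_rect k {a..b} {c..d} (\<lambda>t x. c' * W i (t, x)) \<le> \<bar>c'\<bar> * C"
proof -
  let ?N = "\<lambda>m n c' i. SUP (t, x) \<in> {a..b} \<times> {c..d}. \<bar>((dt {a..b} ^^ m) ((dx {c..d} ^^ n) (\<lambda>t x. c' * W i (t, x)))) t x\<bar>"
  have "\<exists>M. \<forall>i\<in>J. \<forall>c'. ?N m n c' i \<le> \<bar>c'\<bar> * M" if "m + n \<le> k" for m n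
  proof -
    have "CF (n + m) J W"
      using CF_mono[OF W] that by simp
    from CF_iterate_partials(2)[OF this, of "\<lambda>c' i t x. c' * W i (t, x)"]
    obtain W1 where W1: "CF m J W1" "\<And>c' i t x. i \<in> J \<Longrightarrow> t \<in> {a..b} \<Longrightarrow> x \<in> {c..d} \<Longrightarrow> (dx {c..d} ^^ n) (\<lambda>t x. c' * W i (t, x)) t x = c' * W1 i (t, x)"
      by blast
    have "CF (m + 0) J W1"
      using W1(1) by simp
    from CF_iterate_partials(1)[OF this, of "\<lambda>c' i. (dx {c..d} ^^ n) (\<lambda>t x. c' * W i (t, x))"] W1(2)
    obtain W2 where W2: "CF 0 J W2" "\<And>c' i t x. i \<in> J \<Longrightarrow> t \<in> {a..b} \<Longrightarrow> x \<in> {c..d} \<Longrightarrow>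
        (dt {a..b} ^^ m) ((dx {c..d} ^^ n) (\<lambda>t x. c' * W i (t, x))) t x = c' * W2 i (t, x)"
      by blast
    have "bounded ({a..b} \<times> {c..d})"
      by (intro bounded_Times) auto
    then obtain R where R: "\<And>p. p \<in> {a..b} \<times> {c..d} \<Longrightarrow> norm p \<le> R"
      unfolding bounded_iff by blast
    obtain M where M: "\<And>i p. i \<in> J \<Longrightarrow> norm p \<le> R \<Longrightarrow> \<bar>W2 i p\<bar> \<le> M"
      by (rule locally_bddD[OF CF_locally_bdd[OF W2(1)], of R]) blast
    have "?N m n c' i \<le> \<bar>c'\<bar> * M" if "i \<in> J" for c' i
    proof (rule cSUP_least)
      show "{a..b} \<times> {c..d} \<noteq> {}"
        using ab cd by auto
      fix p assume p: "p \<in> {a..b} \<times> {c..d}"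
      then show "(case p of (t, x) \<Rightarrow> \<bar>((dt {a..b} ^^ m) ((dx {c..d} ^^ n) (\<lambda>t x. c' * W i (t, x)))) t x\<bar>) \<le> \<bar>c'\<bar> * M"
        using W2(2)[OF that] M[OF that R[OF p]] by (cases p) (auto simp: abs_mult intro: mult_left_mono)
    qed
    then show ?thesis by blast
  qed
  then have "\<forall>mn. \<exists>M. fst mn + snd mn \<le> k \<longrightarrow> (\<forall>i\<in>J. \<forall>c'. ?N (fst mn) (snd mn) c' i \<le> \<bar>c'\<bar> * M)"
    by blast
  from choice[OF this] obtain M where M: "\<And>m n i c'. m + n \<le> k \<Longrightarrow> i \<in> J \<Longrightarrow> ?N m n c' i \<le> \<bar>c'\<bar> * M (m, n)"
    by (metis fst_conv snd_conv)
  have "C_norm_rect k {a..b} {c..d} (\<lambda>t x. c' * W i (t, x)) \<le> \<bar>c'\<bar> * (\<Sum>p\<in>{(i, j). i + j \<le> k}. M p)" if "i \<in> J" for c' i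
    unfolding C_norm_rect_def sum_distrib_left by (rule sum_mono) (use M that in auto)
  then show ?thesis by blast
qed

end

section \<open>Uniqueness\<close>

lemma DERIV_within_Icc_unique:
  fixes f :: "real \<Rightarrow> real"
  assumes "(f has_real_derivative d) (at x within {a..b})" "(f has_real_derivative d') (at x within {a..b})"
    "x \<in> {a..b}" "a < b"
  shows "d = d'"
  using deriv_within_eqI[OF assms(1,3,4)] deriv_within_eqI[OF assms(2,3,4)] by simp

text \<open>Energy method: the integral of w_t^2 + \<nu>^2 w_x^2 changes only through the flux at
  the ends, which vanishes together with w_t, and it is 0 at the start.\<close>

lemma wave_energy_zero:
  fixes w wt wx wtt wxx wtx wxt :: "real \<Rightarrow> real \<Rightarrow> real"
  assumes T: "0 < T" and L: "0 < L"
    and w: "\<And>t x. t \<in> {0..T} \<Longrightarrow> x \<in> {0..L} \<Longrightarrow> ((\<lambda>t. w t x) has_real_derivative wt t x) (at t within {0..T})"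
      "\<And>t x. t \<in> {0..T} \<Longrightarrow> x \<in> {0..L} \<Longrightarrow> (w t has_real_derivative wx t x) (at x within {0..L})"
      "\<And>t x. t \<in> {0..T} \<Longrightarrow> x \<in> {0..L} \<Longrightarrow> ((\<lambda>t. wt t x) has_real_derivative wtt t x) (at t within {0..T})"
      "\<And>t x. t \<in> {0..T} \<Longrightarrow> x \<in> {0..L} \<Longrightarrow> (wt t has_real_derivative wtx t x) (at x within {0..L})"
      "\<And>t x. t \<in> {0..T} \<Longrightarrow> x \<in> {0..L} \<Longrightarrow> ((\<lambda>t. wx t x) has_real_derivative wxt t x) (at t within {0..T})"
      "\<And>t x. t \<in> {0..T} \<Longrightarrow> x \<in> {0..L} \<Longrightarrow> (wx t has_real_derivative wxx t x) (at x within {0..L})"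
    and c: "continuous_on ({0..T} \<times> {0..L}) (\<lambda>(t, x). wt t x)" "continuous_on ({0..T} \<times> {0..L}) (\<lambda>(t, x). wx t x)"
      "continuous_on ({0..T} \<times> {0..L}) (\<lambda>(t, x). wtt t x)" "continuous_on ({0..T} \<times> {0..L}) (\<lambda>(t, x). wxt t x)"
    and eq: "\<And>t x. t \<in> {0..T} \<Longrightarrow> x \<in> {0..L} \<Longrightarrow> wtt t x = \<nu>\<^sup>2 * wxx t x"
    and bd: "\<And>t. t \<in> {0..T} \<Longrightarrow> w t 0 = 0 \<and> w t L = 0"
    and init: "\<And>x. x \<in> {0..L} \<Longrightarrow> w 0 x = 0 \<and> wt 0 x = 0"
    and tx: "t \<in> {0..T}" "x \<in> {0..L}"
  shows "w t x = 0"
proof -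
  have slice: "continuous_on {0..L} (f t)" if "continuous_on ({0..T} \<times> {0..L}) (\<lambda>(t, x). f t x)" "t \<in> {0..T}"
    for f :: "real \<Rightarrow> real \<Rightarrow> real" and t
  proof -
    have "continuous_on {0..L} (\<lambda>x. case (t, x) of (t, x) \<Rightarrow> f t x)"
      by (rule continuous_on_compose2[OF that(1)]) (use that(2) in \<open>auto intro!: continuous_intros\<close>)
    then show ?thesis by simp
  qed
  note cwx = slice[OF c(2)] slice[OF c(4)] slice[OF c(1)]
  \<comment> \<open>The two mixed derivatives arise as separate functions. Writing w(t, y) as w(t,
    0) plus the integral of w_x and differentiating under the integral sign gives w_t; its
    derivative in y is then \<open>wxt\<close>.\<close>
  have mixed: "wtx t x = wxt t x" if t: "t \<in> {0..T}" and x: "x \<in> {0..L}" for t x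
  proof -
    have wt: "wt t y = wt t 0 + integral {0..y} (wxt t)" if y: "y \<in> {0..L}" for y
    proof (rule DERIV_within_Icc_unique[OF w(1)[OF t y] _ t T])
      have "((\<lambda>t. integral (cbox 0 y) (wx t)) has_real_derivative integral (cbox 0 y) (wxt t)) (at t within {0..T})"
      proof (rule leibniz_rule_field_derivative)
        show "((\<lambda>t. wx t z) has_real_derivative wxt t z) (at t within {0..T})" if "t \<in> {0..T}" "z \<in> cbox 0 y" for t z
          using that y by (intro w(5)) auto
        show "wx t integrable_on cbox 0 y" if "t \<in> {0..T}" for t
          using continuous_on_subset[OF cwx(1)[OF that], of "{0..y}"] y by (intro integrable_continuous) auto
        show "continuous_on ({0..T} \<times> cbox 0 y) (\<lambda>(t, z). wxt t z)"
          by (rule continuous_on_subset[OF c(4)]) (use y in auto)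
      qed (use t in auto)
      then have "((\<lambda>t. w t 0 + integral {0..y} (wx t)) has_real_derivative wt t 0 + integral {0..y} (wxt t)) (at t within {0..T})"
        using L by (intro DERIV_add w(1) t) auto
      moreover have "w t y = w t 0 + integral {0..y} (wx t)" if t: "t \<in> {0..T}" for t
      proof -
        have "(wx t has_integral w t y - w t 0) {0..y}"
        proof (rule fundamental_theorem_of_calculus)
          fix z assume z: "z \<in> {0..y}"
          have "(w t has_real_derivative wx t z) (at z within {0..y})"
            by (rule DERIV_subset[OF w(2)[OF t]]) (use z y in auto)
          then show "(w t has_vector_derivative wx t z) (at z within {0..y})"
            by (simp add: has_real_derivative_iff_has_vector_derivative)
        qed (use y in auto)
        then show ?thesis
          by (simp add: integral_unique)
      qed
      ultimately show "((\<lambda>t. w t y) has_real_derivative wt t 0 + integral {0..y} (wxt t)) (at t within {0..T})"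
        unfolding has_field_derivative_def by (rule has_derivative_transform[OF t, rotated])
    qed
    have "((\<lambda>y. wt t 0 + integral {0..y} (wxt t)) has_real_derivative 0 + wxt t x) (at x within {0..L})"
      by (intro DERIV_add DERIV_const integral_has_real_derivative cwx t x)
    then have "(wt t has_real_derivative wxt t x) (at x within {0..L})"
      unfolding has_field_derivative_def
      by (intro has_derivative_transform[OF x wt]) auto
    then show ?thesis
      using DERIV_within_Icc_unique[OF w(4)[OF t x]] x L by blast
  qed
  have wtb: "wt t 0 = 0" "wt t L = 0" if t: "t \<in> {0..T}" for t
  proof -
    have "((\<lambda>t. w t x) has_real_derivative 0) (at t within {0..T})" if "x = 0 \<or> x = L" for x
    proof -
      have "((\<lambda>t. 0) has_real_derivative 0) (at t within {0..T})" by simp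
      then show ?thesis
        unfolding has_field_derivative_def
        by (rule has_derivative_transform[OF t, rotated]) (use bd that in auto)
    qed
    then show "wt t 0 = 0" "wt t L = 0"
      using DERIV_within_Icc_unique[OF w(1)[OF t]] t T L by force+
  qed
  define E where "E = (\<lambda>t. integral (cbox 0 L) (\<lambda>x. wt t x ^ 2 + \<nu>\<^sup>2 * wx t x ^ 2))"
  have "(E has_real_derivative 0) (at t within {0..T})" if t: "t \<in> {0..T}" for t
  proof -
    have "(E has_real_derivative integral (cbox 0 L) (\<lambda>x. 2 * wt t x * wtt t x + \<nu>\<^sup>2 * (2 * wx t x * wxt t x))) (at t within {0..T})"
      unfolding E_def
    proof (rule leibniz_rule_field_derivative)
      show "((\<lambda>t. wt t x ^ 2 + \<nu>\<^sup>2 * wx t x ^ 2) has_real_derivative 2 * wt t x * wtt t x + \<nu>\<^sup>2 * (2 * wx t x * wxt t x)) (at t within {0..T})"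
        if "t \<in> {0..T}" "x \<in> cbox 0 L" for t x
      proof -
        have x: "x \<in> {0..L}" using that by simp
        show ?thesis
          using DERIV_add[OF DERIV_power[OF w(3)[OF that(1) x], of 2] DERIV_cmult[OF DERIV_power[OF w(5)[OF that(1) x], of 2], of "\<nu>\<^sup>2"]]
          by (simp add: algebra_simps)
      qed
      show "(\<lambda>x. wt t x ^ 2 + \<nu>\<^sup>2 * wx t x ^ 2) integrable_on cbox 0 L" if "t \<in> {0..T}" for t
        by (intro integrable_continuous continuous_intros) (use cwx[OF that] in auto)
      show "continuous_on ({0..T} \<times> cbox 0 L) (\<lambda>(t, x). 2 * wt t x * wtt t x + \<nu>\<^sup>2 * (2 * wx t x * wxt t x))"
        using c unfolding split_beta by (auto intro!: continuous_intros)
    qed (use t in auto)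
    moreover have "integral (cbox 0 L) (\<lambda>x. 2 * wt t x * wtt t x + \<nu>\<^sup>2 * (2 * wx t x * wxt t x)) = 0"
    proof -
      \<comment> \<open>By the equation and the equality of mixed derivatives, the integrand of the
        derivative of E is the x-derivative of 2\<nu>^2 w_t w_x.\<close>
      have energy_flux: "((\<lambda>x. 2 * \<nu>\<^sup>2 * (wt t x * wxx t x + wtx t x * wx t x)) has_integral
          2 * \<nu>\<^sup>2 * (wt t L * wx t L) - 2 * \<nu>\<^sup>2 * (wt t 0 * wx t 0)) {0..L}"
      proof (rule fundamental_theorem_of_calculus)
        fix x assume x: "x \<in> {0..L}"
        have "((\<lambda>x. 2 * \<nu>\<^sup>2 * (wt t x * wx t x)) has_real_derivative 2 * \<nu>\<^sup>2 * (wtx t x * wx t x + wxx t x * wt t x)) (at x within {0..L})"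
          by (intro DERIV_cmult DERIV_mult w t x)
        then show "((\<lambda>x. 2 * \<nu>\<^sup>2 * (wt t x * wx t x)) has_vector_derivative 2 * \<nu>\<^sup>2 * (wt t x * wxx t x + wtx t x * wx t x)) (at x within {0..L})"
          by (simp add: has_real_derivative_iff_has_vector_derivative algebra_simps)
      qed (use L in auto)
      have "integral {0..L} (\<lambda>x. 2 * \<nu>\<^sup>2 * (wt t x * wxx t x + wtx t x * wx t x)) = 0"
        unfolding integral_unique[OF energy_flux] using wtb[OF t] by simp
      moreover have "2 * wt t x * wtt t x + \<nu>\<^sup>2 * (2 * wx t x * wxt t x) = 2 * \<nu>\<^sup>2 * (wt t x * wxx t x + wtx t x * wx t x)"
        if "x \<in> {0..L}" for x
        using eq[OF t that] mixed[OF t that] by (simp add: algebra_simps)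
      then have "integral {0..L} (\<lambda>x. 2 * wt t x * wtt t x + \<nu>\<^sup>2 * (2 * wx t x * wxt t x)) =
          integral {0..L} (\<lambda>x. 2 * \<nu>\<^sup>2 * (wt t x * wxx t x + wtx t x * wx t x))"
        by (rule integral_cong)
      ultimately show ?thesis
        by simp
    qed
    ultimately show ?thesis by simp
  qed
  then obtain C where C: "\<And>t. t \<in> {0..T} \<Longrightarrow> E t = C"
    using has_field_derivative_zero_constant[of "{0..T}" E] by blast
  have wx0: "wx 0 x = 0" if x: "x \<in> {0..L}" for x
  proof (rule DERIV_within_Icc_unique[OF w(2)[OF _ x] _ x L])
    have "((\<lambda>x. 0) has_real_derivative 0) (at x within {0..L})" by simp
    then show "(w 0 has_real_derivative 0) (at x within {0..L})"
      unfolding has_field_derivative_def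
      by (rule has_derivative_transform[OF x, rotated]) (use init in auto)
  qed (use T in auto)
  have "E 0 = integral {0..L} (\<lambda>x. 0)"
    unfolding E_def cbox_interval by (rule integral_cong) (simp add: init wx0)
  then have "C = 0"
    using C[of 0] T by simp
  have "wt t x = 0" if t: "t \<in> {0..T}" and x: "x \<in> {0..L}" for t x
  proof -
    have "integral {0..L} (\<lambda>x. wt t x ^ 2 + \<nu>\<^sup>2 * wx t x ^ 2) = 0"
      using C[OF t] \<open>C = 0\<close> by (simp add: E_def)
    moreover have "continuous_on {0..L} (\<lambda>x. wt t x ^ 2 + \<nu>\<^sup>2 * wx t x ^ 2)"
      by (intro continuous_intros cwx t)
    ultimately have "wt t x ^ 2 + \<nu>\<^sup>2 * wx t x ^ 2 = 0"
      using integral_eq_0_iff[of 0 L "\<lambda>x. wt t x ^ 2 + \<nu>\<^sup>2 * wx t x ^ 2"] L x by auto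
    then show ?thesis
      by (smt (verit) mult_nonneg_nonneg zero_eq_power2 zero_le_power2)
  qed
  then have "((\<lambda>t. w t x) has_real_derivative 0) (at t within {0..T})" if "t \<in> {0..T}" for t
    using w(1)[OF that tx(2)] that tx(2) by simp
  then obtain C' where "\<And>t. t \<in> {0..T} \<Longrightarrow> w t x = C'"
    using has_field_derivative_zero_constant[of "{0..T}" "\<lambda>t. w t x"] by blast
  then show ?thesis
    using init[OF tx(2)] tx(1) T by (metis atLeastAtMost_iff less_imp_le order_refl)
qed

lemma wave_unique:
  assumes T: "0 < T" and L: "0 < L"
    and C: "C_on_rect (Suc (Suc k)) {0..T} {0..L} u" "C_on_rect (Suc (Suc k)) {0..T} {0..L} v"
    and eq: "\<And>t x. t \<in> {0..T} \<Longrightarrow> x \<in> {0..L} \<Longrightarrow>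
      (dt {0..T} ^^ 2) u t x - \<nu>\<^sup>2 * (dx {0..L} ^^ 2) u t x = (dt {0..T} ^^ 2) v t x - \<nu>\<^sup>2 * (dx {0..L} ^^ 2) v t x"
    and bd: "\<And>t. t \<in> {0..T} \<Longrightarrow> u t 0 = v t 0 \<and> u t L = v t L"
    and init: "\<And>x. x \<in> {0..L} \<Longrightarrow> u 0 x = v 0 x \<and> dt {0..T} u 0 x = dt {0..T} v 0 x"
    and tx: "t \<in> {0..T}" "x \<in> {0..L}"
  shows "u t x = v t x"
proof -
  let ?t = "dt {0..T}" and ?x = "dx {0..L}"
  have C1: "C_on_rect (Suc k) {0..T} {0..L} (?t u)" "C_on_rect (Suc k) {0..T} {0..L} (?x u)"
    "C_on_rect (Suc k) {0..T} {0..L} (?t v)" "C_on_rect (Suc k) {0..T} {0..L} (?x v)"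
    using C by simp_all
  then have C2: "C_on_rect k {0..T} {0..L} (?t (?t u))" "C_on_rect k {0..T} {0..L} (?t (?x u))"
    "C_on_rect k {0..T} {0..L} (?t (?t v))" "C_on_rect k {0..T} {0..L} (?t (?x v))"
    by simp_all
  note p = C_on_rect_partials
  have cd: "continuous_on ({0..T} \<times> {0..L}) (\<lambda>(t, x). f t x - g t x)"
    if "C_on_rect n {0..T} {0..L} f" "C_on_rect n {0..T} {0..L} g" for f g n
    using continuous_on_diff[OF C_on_rect_continuous[OF that(1)] C_on_rect_continuous[OF that(2)]]
    by (simp add: split_beta)
  have "u t x - v t x = 0"
  proof (rule wave_energy_zero[OF T L, where w = "\<lambda>t x. u t x - v t x" and wt = "\<lambda>t x. ?t u t x - ?t v t x"
        and wx = "\<lambda>t x. ?x u t x - ?x v t x" and wtt = "\<lambda>t x. ?t (?t u) t x - ?t (?t v) t x"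
        and wtx = "\<lambda>t x. ?x (?t u) t x - ?x (?t v) t x" and wxt = "\<lambda>t x. ?t (?x u) t x - ?t (?x v) t x"
        and wxx = "\<lambda>t x. ?x (?x u) t x - ?x (?x v) t x" and \<nu> = \<nu>])
    fix t x assume tx: "t \<in> {0..T}" "x \<in> {0..L}"
    show "((\<lambda>t. u t x - v t x) has_real_derivative ?t u t x - ?t v t x) (at t within {0..T})"
      by (rule DERIV_diff[OF p(1)[OF C(1) tx] p(1)[OF C(2) tx]])
    show "((\<lambda>x. u t x - v t x) has_real_derivative ?x u t x - ?x v t x) (at x within {0..L})"
      by (rule DERIV_diff[OF p(2)[OF C(1) tx] p(2)[OF C(2) tx]])
    show "((\<lambda>t. ?t u t x - ?t v t x) has_real_derivative ?t (?t u) t x - ?t (?t v) t x) (at t within {0..T})"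
      by (rule DERIV_diff[OF p(1)[OF C1(1) tx] p(1)[OF C1(3) tx]])
    show "((\<lambda>x. ?t u t x - ?t v t x) has_real_derivative ?x (?t u) t x - ?x (?t v) t x) (at x within {0..L})"
      by (rule DERIV_diff[OF p(2)[OF C1(1) tx] p(2)[OF C1(3) tx]])
    show "((\<lambda>t. ?x u t x - ?x v t x) has_real_derivative ?t (?x u) t x - ?t (?x v) t x) (at t within {0..T})"
      by (rule DERIV_diff[OF p(1)[OF C1(2) tx] p(1)[OF C1(4) tx]])
    show "((\<lambda>x. ?x u t x - ?x v t x) has_real_derivative ?x (?x u) t x - ?x (?x v) t x) (at x within {0..L})"
      by (rule DERIV_diff[OF p(2)[OF C1(2) tx] p(2)[OF C1(4) tx]])
    show "?t (?t u) t x - ?t (?t v) t x = \<nu>\<^sup>2 * (?x (?x u) t x - ?x (?x v) t x)"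
      using eq[OF tx] by (simp add: numeral_2_eq_2 algebra_simps)
  qed (use cd[OF C1(1,3)] cd[OF C1(2,4)] cd[OF C2(1,3)] cd[OF C2(2,4)] bd init tx in auto)
  then show ?thesis by simp
qed

section \<open>The theorem\<close>

lemma funpow_deriv_within_cong:
  assumes "\<And>x. x \<in> S \<Longrightarrow> f x = g x" "x \<in> S"
  shows "(deriv_within S ^^ n) f x = (deriv_within S ^^ n) g x"
  using assms(2)
proof (induction n arbitrary: x)
  case (Suc n)
  then show ?case
    using deriv_within_cong[of S "(deriv_within S ^^ n) f" "(deriv_within S ^^ n) g" x] by simp
qed (use assms in auto)

lemma funpow_deriv_within_cmult:
  assumes "a < b" "C_on k {a..b} f" "n \<le> k" "x \<in> {a..b}"
  shows "(deriv_within {a..b} ^^ n) (\<lambda>x. c * f x) x = c * (deriv_within {a..b} ^^ n) f x"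
  using assms(2-4)
proof (induction n arbitrary: f k x)
  case (Suc n)
  then obtain k' where k: "k = Suc k'" "n \<le> k'"
    by (cases k) auto
  have f: "f differentiable_on {a..b}" "C_on k' {a..b} (deriv_within {a..b} f)"
    using Suc.prems k by auto
  have "(deriv_within {a..b} ^^ Suc n) (\<lambda>x. c * f x) x = (deriv_within {a..b} ^^ n) (deriv_within {a..b} (\<lambda>x. c * f x)) x"
    by (simp add: funpow_swap1)
  also have "\<dots> = (deriv_within {a..b} ^^ n) (\<lambda>x. c * deriv_within {a..b} f x) x"
    by (rule funpow_deriv_within_cong[OF _ Suc.prems(3)])
      (intro deriv_within_eqI DERIV_cmult deriv_within_works f(1) assms(1))
  also have "\<dots> = c * (deriv_within {a..b} ^^ n) (deriv_within {a..b} f) x"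
    by (rule Suc.IH[OF f(2) k(2) Suc.prems(3)])
  finally show ?case
    by (simp add: funpow_swap1)
qed simp

section \<open>Normalised data and rescaling\<close>

text \<open>Normalised data: entries 0 to 3 stand for \<open>u0, u1, u0f, u1f\<close>, entries 4 to 7 for \<open>v0, v1, v0f, v1f\<close>.\<close>

definition unit_data :: "real \<Rightarrow> (nat \<Rightarrow> real \<Rightarrow> real) set" where
  "unit_data L = {d. \<forall>j. let k = (if even j then 11 else 10) in C_par (Some True) k L (d j) \<and>
     (\<forall>n\<le>k. \<forall>x\<in>{0..L}. \<bar>(deriv_within {0..L} ^^ n) (d j) x\<bar> \<le> 1)}"

lemma unit_dataD:
  assumes "d \<in> unit_data L"
  shows "C_par (Some True) (if even j then 11 else 10) L (d j)"
    "n \<le> (if even j then 11 else 10) \<Longrightarrow> x \<in> {0..L} \<Longrightarrow> \<bar>(deriv_within {0..L} ^^ n) (d j) x\<bar> \<le> 1"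
  using assms unfolding unit_data_def Let_def by blast+

lemma unit_data_extension:
  assumes L: "0 < L"
  shows "CF (if even j then 11 else 10) (unit_data L) (\<lambda>d. refl_ext True L (d j))"
    "d \<in> unit_data L \<Longrightarrow> odd_refl L (refl_ext True L (d j))"
    "d \<in> unit_data L \<Longrightarrow> 0 \<le> x \<Longrightarrow> x \<le> L \<Longrightarrow> refl_ext True L (d j) x = d j x"
proof -
  show "CF (if even j then 11 else 10) (unit_data L) (\<lambda>d. refl_ext True L (d j))"
    by (rule CF_refl_ext[OF L]) (intro exI[of _ 1] ballI unit_dataD; assumption)+
  show "odd_refl L (refl_ext True L (d j))" if "d \<in> unit_data L"
    by (rule refl_ext_odd_refl[OF L unit_dataD(1)[OF that]])
  show "refl_ext True L (d j) x = d j x" if "d \<in> unit_data L" "0 \<le> x" "x \<le> L"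
    by (rule refl_ext_eq[OF L unit_dataD(1)[OF that(1)]]) (use that in auto)
qed

text \<open>The construction runs once with all normalised data as index set, so the bounds inside
  \<open>CF\<close> are uniform over them; the constant of the estimate originates here. The
  equations contain only the squares of \<nu>1 and \<nu>2, hence positive speeds may be
  taken.\<close>

lemma controlled_unit_data:
  fixes L \<nu>1 \<nu>2 a b T :: real
  assumes L: "L > 0" and \<nu>: "\<nu>1 \<noteq> 0" "\<nu>2 \<noteq> 0" and ab: "0 \<le> a" "a < b" "b \<le> L" and T0: "T > 0"
    and T: "T > 2 * (L - b) * max (1 / \<bar>\<nu>1\<bar>) (1 / \<bar>\<nu>2\<bar>)" "T > 2 * a * max (1 / \<bar>\<nu>1\<bar>) (1 / \<bar>\<nu>2\<bar>)"
  obtains u v ut utt ux uxx vt vtt vx vxx :: "(nat \<Rightarrow> real \<Rightarrow> real) \<Rightarrow> real \<times> real \<Rightarrow> real" where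
    "CF 10 (unit_data L) u" "CF 10 (unit_data L) v" "CF 8 (unit_data L) utt" "CF 8 (unit_data L) uxx"
    "\<And>d t x. d \<in> unit_data L \<Longrightarrow> ((\<lambda>r. u d (r, x)) has_real_derivative ut d (t, x)) (at t)"
    "\<And>d t x. d \<in> unit_data L \<Longrightarrow> ((\<lambda>r. ut d (r, x)) has_real_derivative utt d (t, x)) (at t)"
    "\<And>d t x. d \<in> unit_data L \<Longrightarrow> ((\<lambda>r. u d (t, r)) has_real_derivative ux d (t, x)) (at x)"
    "\<And>d t x. d \<in> unit_data L \<Longrightarrow> ((\<lambda>r. ux d (t, r)) has_real_derivative uxx d (t, x)) (at x)"
    "\<And>d t x. d \<in> unit_data L \<Longrightarrow> ((\<lambda>r. v d (r, x)) has_real_derivative vt d (t, x)) (at t)"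
    "\<And>d t x. d \<in> unit_data L \<Longrightarrow> ((\<lambda>r. vt d (r, x)) has_real_derivative vtt d (t, x)) (at t)"
    "\<And>d t x. d \<in> unit_data L \<Longrightarrow> ((\<lambda>r. v d (t, r)) has_real_derivative vx d (t, x)) (at x)"
    "\<And>d t x. d \<in> unit_data L \<Longrightarrow> ((\<lambda>r. vx d (t, r)) has_real_derivative vxx d (t, x)) (at x)"
    "\<And>d t x. d \<in> unit_data L \<Longrightarrow> 0 \<le> x \<Longrightarrow> x \<le> L \<Longrightarrow> x \<notin> {a..b} \<Longrightarrow> utt d (t, x) - \<nu>1\<^sup>2 * uxx d (t, x) = 0"
    "\<And>d t x. d \<in> unit_data L \<Longrightarrow> vtt d (t, x) - \<nu>2\<^sup>2 * vxx d (t, x) = u d (t, x) ^ 3"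
    "\<And>d t. d \<in> unit_data L \<Longrightarrow> u d (t, 0) = 0 \<and> u d (t, L) = 0 \<and> v d (t, 0) = 0 \<and> v d (t, L) = 0"
    "\<And>d x. d \<in> unit_data L \<Longrightarrow> 0 \<le> x \<Longrightarrow> x \<le> L \<Longrightarrow>
       u d (0, x) = d 0 x \<and> ut d (0, x) = d 1 x \<and> u d (T, x) = d 2 x \<and> ut d (T, x) = d 3 x \<and>
       v d (0, x) = d 4 x \<and> vt d (0, x) = d 5 x \<and> v d (T, x) = d 6 x \<and> vt d (T, x) = d 7 x"
proof -
  have T1: "\<bar>\<nu>\<bar> * T > 2 * y" if "\<nu> = \<nu>1 \<or> \<nu> = \<nu>2" "T > 2 * y * max (1 / \<bar>\<nu>1\<bar>) (1 / \<bar>\<nu>2\<bar>)" "y \<ge> 0" for \<nu> y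
  proof -
    have n: "\<bar>\<nu>\<bar> > 0" using that(1) \<nu> by auto
    have "2 * y * (1 / \<bar>\<nu>\<bar>) \<le> 2 * y * max (1 / \<bar>\<nu>1\<bar>) (1 / \<bar>\<nu>2\<bar>)"
      using that(1,3) by (intro mult_left_mono) auto
    then have "2 * y / \<bar>\<nu>\<bar> < T" using that(2) by simp
    then show ?thesis using n by (simp add: field_simps)
  qed
  have pos: "\<bar>\<nu>1\<bar> > 0" "\<bar>\<nu>2\<bar> > 0" using \<nu> by auto
  have TT: "\<bar>\<nu>1\<bar> * T > 2 * a" "\<bar>\<nu>1\<bar> * T > 2 * (L - b)" "\<bar>\<nu>2\<bar> * T > 2 * a" "\<bar>\<nu>2\<bar> * T > 2 * (L - b)"
  proof -
    have Lb: "0 \<le> L - b" using ab by simp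
    show "\<bar>\<nu>1\<bar> * T > 2 * a" "\<bar>\<nu>1\<bar> * T > 2 * (L - b)"
      by (rule T1[OF disjI1[OF refl] T(2) ab(1)], rule T1[OF disjI1[OF refl] T(1) Lb])
    show "\<bar>\<nu>2\<bar> * T > 2 * a" "\<bar>\<nu>2\<bar> * T > 2 * (L - b)"
      by (rule T1[OF disjI2[OF refl] T(2) ab(1)], rule T1[OF disjI2[OF refl] T(1) Lb])
  qed
  obtain \<beta> S :: "real \<Rightarrow> real" where "step_function \<beta> S 10"
  proof (rule ex_smooth_step[of "Suc 10"], goal_cases)
    case (1 \<beta> S)
    show ?case by (rule that[of \<beta> S], unfold_locales) (fact 1)+
  qed
  then interpret step_function \<beta> S 10 .
  let ?I = "unit_data L"
  let ?d = "\<lambda>j d. refl_ext True L (d j)"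
  note ue = unit_data_extension[OF L]
  have CF11: "CF (Suc 10) ?I (?d j)" if "even j" for j
    using ue(1)[of j] that by simp
  have CF10: "CF 10 ?I (?d j)" if "odd j" for j
    using ue(1)[of j] that by simp
  obtain u v where uv: "CF 10 ?I u" "CF 10 ?I v"
    "\<And>i x. i \<in> ?I \<Longrightarrow> 0 \<le> x \<Longrightarrow> x \<le> L \<Longrightarrow> u i (0, x) = ?d 0 i x"
    "\<And>i x. i \<in> ?I \<Longrightarrow> 0 \<le> x \<Longrightarrow> x \<le> L \<Longrightarrow> ((\<lambda>t. u i (t, x)) has_real_derivative ?d 1 i x) (at 0)"
    "\<And>i x. i \<in> ?I \<Longrightarrow> 0 \<le> x \<Longrightarrow> x \<le> L \<Longrightarrow> u i (T, x) = ?d 2 i x"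
    "\<And>i x. i \<in> ?I \<Longrightarrow> 0 \<le> x \<Longrightarrow> x \<le> L \<Longrightarrow> ((\<lambda>t. u i (t, x)) has_real_derivative ?d 3 i x) (at T)"
    "\<And>i x. i \<in> ?I \<Longrightarrow> 0 \<le> x \<Longrightarrow> x \<le> L \<Longrightarrow> v i (0, x) = ?d 4 i x"
    "\<And>i x. i \<in> ?I \<Longrightarrow> 0 \<le> x \<Longrightarrow> x \<le> L \<Longrightarrow> ((\<lambda>t. v i (t, x)) has_real_derivative ?d 5 i x) (at 0)"
    "\<And>i x. i \<in> ?I \<Longrightarrow> 0 \<le> x \<Longrightarrow> x \<le> L \<Longrightarrow> v i (T, x) = ?d 6 i x"
    "\<And>i x. i \<in> ?I \<Longrightarrow> 0 \<le> x \<Longrightarrow> x \<le> L \<Longrightarrow> ((\<lambda>t. v i (t, x)) has_real_derivative ?d 7 i x) (at T)"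
    "\<And>i t. i \<in> ?I \<Longrightarrow> u i (t, 0) = 0" "\<And>i t. i \<in> ?I \<Longrightarrow> u i (t, L) = 0"
    "\<And>i t. i \<in> ?I \<Longrightarrow> v i (t, 0) = 0" "\<And>i t. i \<in> ?I \<Longrightarrow> v i (t, L) = 0"
    "\<And>i. i \<in> ?I \<Longrightarrow> has_box UNIV \<bar>\<nu>2\<bar> (v i) (\<lambda>p. u i p ^ 3)"
    "\<And>i. i \<in> ?I \<Longrightarrow> has_box (UNIV \<times> {-a<..<a}) \<bar>\<nu>1\<bar> (u i) (\<lambda>p. 0)"
    "\<And>i. i \<in> ?I \<Longrightarrow> has_box (UNIV \<times> {b<..<2 * L - b}) \<bar>\<nu>1\<bar> (u i) (\<lambda>p. 0)"
  proof (rule controlled_system[where k' = 9 and I = ?I and ?u0.0 = "?d 0" and ?u1.0 = "?d 1" and u0f = "?d 2" and u1f = "?d 3"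
        and ?v0.0 = "?d 4" and ?v1.0 = "?d 5" and v0f = "?d 6" and v1f = "?d 7", OF L pos ab TT], goal_cases)
    case (18 u v)
    show ?case by (rule that[of u v]) (fact 18)+
  qed ((rule CF11 CF10, simp) | (rule ue(2), assumption) | simp)+
  have "CF (Suc (Suc 8)) ?I u" "CF (Suc (Suc 8)) ?I v"
    using uv(1,2) by simp_all
  obtain ut ux where u1: "\<And>d t x. d \<in> ?I \<Longrightarrow> ((\<lambda>r. u d (r, x)) has_real_derivative ut d (t, x)) (at t)"
      "\<And>d t x. d \<in> ?I \<Longrightarrow> ((\<lambda>r. u d (t, r)) has_real_derivative ux d (t, x)) (at x)"
      "CF (Suc 8) ?I ut" "CF (Suc 8) ?I ux"
    by (rule CF_prod_SucE[OF \<open>CF (Suc (Suc 8)) ?I u\<close>]) blast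
  obtain utt where u2: "\<And>d t x. d \<in> ?I \<Longrightarrow> ((\<lambda>r. ut d (r, x)) has_real_derivative utt d (t, x)) (at t)" "CF 8 ?I utt"
    by (rule CF_prod_SucE[OF u1(3)]) blast
  obtain uxx where u3: "\<And>d t x. d \<in> ?I \<Longrightarrow> ((\<lambda>r. ux d (t, r)) has_real_derivative uxx d (t, x)) (at x)" "CF 8 ?I uxx"
    by (rule CF_prod_SucE[OF u1(4)]) blast
  obtain vt vx where v1: "\<And>d t x. d \<in> ?I \<Longrightarrow> ((\<lambda>r. v d (r, x)) has_real_derivative vt d (t, x)) (at t)"
      "\<And>d t x. d \<in> ?I \<Longrightarrow> ((\<lambda>r. v d (t, r)) has_real_derivative vx d (t, x)) (at x)"
      "CF (Suc 8) ?I vt" "CF (Suc 8) ?I vx"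
    by (rule CF_prod_SucE[OF \<open>CF (Suc (Suc 8)) ?I v\<close>]) blast
  obtain vtt where v2: "\<And>d t x. d \<in> ?I \<Longrightarrow> ((\<lambda>r. vt d (r, x)) has_real_derivative vtt d (t, x)) (at t)" "CF 8 ?I vtt"
    by (rule CF_prod_SucE[OF v1(3)]) blast
  obtain vxx where v3: "\<And>d t x. d \<in> ?I \<Longrightarrow> ((\<lambda>r. vx d (t, r)) has_real_derivative vxx d (t, x)) (at x)" "CF 8 ?I vxx"
    by (rule CF_prod_SucE[OF v1(4)]) blast
  \<comment> \<open>The strips on which u is free extend beyond 0 and L, so the end points of [0, L]
    are interior points when they lie outside [a, b].\<close>
  have wu: "utt d (t, x) - \<nu>1\<^sup>2 * uxx d (t, x) = 0" if d: "d \<in> ?I" and x: "0 \<le> x" "x \<le> L" "x \<notin> {a..b}" for d t x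
  proof (cases "x < a")
    case True
    show ?thesis
      using has_box_local[OF uv(16)[OF d] _ refl u1(1)[OF d] u2(1)[OF d] u1(2)[OF d] u3(1)[OF d], of t x] True x
      by (simp add: open_Times)
  next
    case False
    show ?thesis
      using has_box_local[OF uv(17)[OF d] _ refl u1(1)[OF d] u2(1)[OF d] u1(2)[OF d] u3(1)[OF d], of t x] False x
      by (simp add: open_Times)
  qed
  have wv: "vtt d (t, x) - \<nu>2\<^sup>2 * vxx d (t, x) = u d (t, x) ^ 3" if d: "d \<in> ?I" for d t x
    using has_box_local[OF uv(15)[OF d] _ refl v1(1)[OF d] v2(1)[OF d] v1(2)[OF d] v3(1)[OF d], of t x]
    by simp
  show ?thesis
  proof (rule that[of u v utt uxx ut ux vt vtt vx vxx])
    fix d x assume d: "d \<in> ?I" and x: "0 \<le> x" "x \<le> L"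
    show "u d (0, x) = d 0 x \<and> ut d (0, x) = d 1 x \<and> u d (T, x) = d 2 x \<and> ut d (T, x) = d 3 x \<and>
       v d (0, x) = d 4 x \<and> vt d (0, x) = d 5 x \<and> v d (T, x) = d 6 x \<and> vt d (T, x) = d 7 x"
      using uv(3,5,7,9)[OF d x] DERIV_unique[OF u1(1)[OF d] uv(4)[OF d x]] DERIV_unique[OF u1(1)[OF d] uv(6)[OF d x]]
        DERIV_unique[OF v1(1)[OF d] uv(8)[OF d x]] DERIV_unique[OF v1(1)[OF d] uv(10)[OF d x]]
      by (simp only: ue(3)[OF d x] simp_thms)
  next
    fix d t assume d: "d \<in> ?I"
    show "u d (t, 0) = 0 \<and> u d (t, L) = 0 \<and> v d (t, 0) = 0 \<and> v d (t, L) = 0"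
      by (intro conjI uv(11-14) d)
  qed (fact uv(1) uv(2) u2(2) u3(2) u1(1) u2(1) u1(2) u3(1) v1(1) v2(1) v1(2) v3(1) wu wv)+
qed

lemma C_norm_nonneg: "C_on k {a..b} f \<Longrightarrow> a \<le> b \<Longrightarrow> 0 \<le> C_norm k {a..b} f"
  using C_norm_ge[of k a b f 0 a] by auto

lemma zero_unit_data:
  assumes L: "0 < L" shows "(\<lambda>j x. 0) \<in> unit_data L"
proof -
  have "(deriv_within {0..L} ^^ n) (\<lambda>x. 0) x = 0" if "x \<in> {0..L}" for n x
    using funpow_deriv_within_cmult[of 0 L n "\<lambda>x. 0" n x 0] C_par_const_0[OF L, of None n] that L
    by (simp add: C_par_None)
  then show ?thesis
    by (auto simp: unit_data_def Let_def C_par_const_0[OF L] simp del: C_par.simps funpow.simps)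
qed

lemma normalized_unit_data:
  fixes D :: "nat \<Rightarrow> real \<Rightarrow> real"
  assumes L: "0 < L"
    and D: "\<And>j. C_par (Some True) (if even j then 11 else 10) L (D j)"
      "\<And>j. C_norm (if even j then 11 else 10) {0..L} (D j) \<le> s j" "\<And>j. s j > 0"
  shows "(\<lambda>j x. 1 / s j * D j x) \<in> unit_data L"
  unfolding unit_data_def Let_def
proof (intro CollectI allI conjI ballI impI)
  fix j
  show "C_par (Some True) (if even j then 11 else 10) L (\<lambda>x. 1 / s j * D j x)"
    by (rule C_par_cmult[OF L D(1)])
  fix n x assume n: "n \<le> (if even j then 11 else 10 :: nat)" and x: "x \<in> {0..L}"
  have C: "C_on (if even j then 11 else 10) {0..L} (D j)"
    using C_par_weaken[OF D(1)[of j]] by (simp only: C_par_None)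
  have "\<bar>(deriv_within {0..L} ^^ n) (\<lambda>x. 1 / s j * D j x) x\<bar> = 1 / s j * \<bar>(deriv_within {0..L} ^^ n) (D j) x\<bar>"
    using D(3)[of j] by (simp only: funpow_deriv_within_cmult[OF L C n x] abs_mult) simp
  also have "\<dots> \<le> 1 / s j * s j"
    using C_norm_ge[OF C n x] D(2)[of j] D(3)[of j] by (intro mult_left_mono) auto
  finally show "\<bar>(deriv_within {0..L} ^^ n) (\<lambda>x. 1 / s j * D j x) x\<bar> \<le> 1"
    using D(3)[of j] by simp
qed

text \<open>The weights M and M^3 follow the invariance of the system, and
  \<open>j mod 8 < 4\<close> selects the data of u. For M = 0 division is impossible, but then all
  data vanish on [0, L] and the zero data serve.\<close>

lemma scaled_unit_data:
  fixes D :: "nat \<Rightarrow> real \<Rightarrow> real"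
  assumes L: "0 < L"
    and D: "\<And>j. C_par (Some True) (if even j then 11 else 10) L (D j)"
      "\<And>j. C_norm (if even j then 11 else 10) {0..L} (D j) \<le> (if j mod 8 < 4 then M else M ^ 3)"
    and M: "M \<ge> 0"
  obtains d where "d \<in> unit_data L"
    "\<And>j x. x \<in> {0..L} \<Longrightarrow> D j x = (if j mod 8 < 4 then M else M ^ 3) * d j x"
proof (cases "M = 0")
  case True
  show ?thesis
  proof (rule that[OF zero_unit_data[OF L]])
    fix j x assume x: "x \<in> {0..L}"
    have "C_on (if even j then 11 else 10) {0..L} (D j)"
      using C_par_weaken[OF D(1)[of j]] by (simp only: C_par_None)
    from C_norm_ge[OF this _ x, of 0] D(2)[of j] show "D j x = (if j mod 8 < 4 then M else M ^ 3) * 0"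
      using True by (simp split: if_splits)
  qed
next
  case False
  let ?s = "\<lambda>j::nat. if j mod 8 < 4 then M else M ^ 3"
  have s: "?s j > 0" for j
    using M False by simp
  show ?thesis
  proof (rule that)
    show "(\<lambda>j x. 1 / ?s j * D j x) \<in> unit_data L"
      by (rule normalized_unit_data[OF L D s])
    show "D j x = ?s j * (1 / ?s j * D j x)" for j x
      using s[of j] by simp
  qed
qed

lemma is_solutionD:
  assumes "is_solution L T \<nu>1 \<nu>2 h u0 u1 v0 v1 u v"
  shows "C_on_rect (Suc (Suc 4)) {0..T} {0..L} u" "C_on_rect (Suc (Suc 4)) {0..T} {0..L} v"
    "t \<in> {0..T} \<Longrightarrow> x \<in> {0..L} \<Longrightarrow> (dt {0..T} ^^ 2) u t x - \<nu>1\<^sup>2 * (dx {0..L} ^^ 2) u t x = h t x"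
    "t \<in> {0..T} \<Longrightarrow> x \<in> {0..L} \<Longrightarrow> (dt {0..T} ^^ 2) v t x - \<nu>2\<^sup>2 * (dx {0..L} ^^ 2) v t x = u t x ^ 3"
    "t \<in> {0..T} \<Longrightarrow> u t 0 = 0 \<and> u t L = 0" "t \<in> {0..T} \<Longrightarrow> v t 0 = 0 \<and> v t L = 0"
    "x \<in> {0..L} \<Longrightarrow> u 0 x = u0 x \<and> dt {0..T} u 0 x = u1 x"
    "x \<in> {0..L} \<Longrightarrow> v 0 x = v0 x \<and> dt {0..T} v 0 x = v1 x"
proof -
  have "Suc (Suc 4) = 6" by simp
  then show "C_on_rect (Suc (Suc 4)) {0..T} {0..L} u" "C_on_rect (Suc (Suc 4)) {0..T} {0..L} v"
    using assms unfolding is_solution_def by (simp_all only:)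
qed (use assms in \<open>unfold is_solution_def, blast+\<close>)

text \<open>The system is triangular: both u solve a linear equation with the same source h, and
  once they agree the two v share the source u^3.\<close>

lemma is_solution_unique:
  assumes T: "0 < T" and L: "0 < L"
    and s: "is_solution L T \<nu>1 \<nu>2 h u0 u1 v0 v1 u v" and s': "is_solution L T \<nu>1 \<nu>2 h u0 u1 v0 v1 u' v'"
    and tx: "t \<in> {0..T}" "x \<in> {0..L}"
  shows "u' t x = u t x" "v' t x = v t x"
proof -
  note d = is_solutionD[OF s] and d' = is_solutionD[OF s']
  have u: "u' t x = u t x" if "t \<in> {0..T}" "x \<in> {0..L}" for t x
  proof (rule wave_unique[OF T L d'(1) d(1) _ _ _ that])
    fix t x assume tx: "t \<in> {0..T}" "x \<in> {0..L}"
    show "(dt {0..T} ^^ 2) u' t x - \<nu>1\<^sup>2 * (dx {0..L} ^^ 2) u' t x = (dt {0..T} ^^ 2) u t x - \<nu>1\<^sup>2 * (dx {0..L} ^^ 2) u t x"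
      by (simp only: d(3)[OF tx] d'(3)[OF tx])
  next
    fix t assume "t \<in> {0..T}"
    from d(5)[OF this] d'(5)[OF this] show "u' t 0 = u t 0 \<and> u' t L = u t L" by simp
  next
    fix x assume "x \<in> {0..L}"
    from d(7)[OF this] d'(7)[OF this] show "u' 0 x = u 0 x \<and> dt {0..T} u' 0 x = dt {0..T} u 0 x" by simp
  qed
  show "u' t x = u t x"
    by (rule u[OF tx])
  show "v' t x = v t x"
  proof (rule wave_unique[OF T L d'(2) d(2) _ _ _ tx])
    fix t x assume tx: "t \<in> {0..T}" "x \<in> {0..L}"
    show "(dt {0..T} ^^ 2) v' t x - \<nu>2\<^sup>2 * (dx {0..L} ^^ 2) v' t x = (dt {0..T} ^^ 2) v t x - \<nu>2\<^sup>2 * (dx {0..L} ^^ 2) v t x"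
      by (simp only: d(4)[OF tx] d'(4)[OF tx] u[OF tx])
  next
    fix t assume "t \<in> {0..T}"
    from d(6)[OF this] d'(6)[OF this] show "v' t 0 = v t 0 \<and> v' t L = v t L" by simp
  next
    fix x assume "x \<in> {0..L}"
    from d(8)[OF this] d'(8)[OF this] show "v' 0 x = v 0 x \<and> dt {0..T} v' 0 x = dt {0..T} v 0 x" by simp
  qed
qed

theorem theorem1p2:
  fixes L \<nu>1 \<nu>2 a b T :: real
  assumes "L > 0" and "\<nu>1 \<noteq> 0" and "\<nu>2 \<noteq> 0"
    and "0 \<le> a" and "a < b" and "b \<le> L" and "T > 0"
    and "T > 2 * (L - b) * max (1 / \<bar>\<nu>1\<bar>) (1 / \<bar>\<nu>2\<bar>)"
    and "T > 2 * a * max (1 / \<bar>\<nu>1\<bar>) (1 / \<bar>\<nu>2\<bar>)"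
  shows "\<exists>C>0. \<forall>u0 u1 v0 v1 u0f u1f v0f v1f.
    (\<forall>w \<in> {u0, v0, u0f, v0f}. C_on 11 {0..L} w) \<longrightarrow>
    (\<forall>w \<in> {u1, v1, u1f, v1f}. C_on 10 {0..L} w) \<longrightarrow>
    compatible 11 L \<nu>1 \<nu>2 u0 u1 v0 v1 \<longrightarrow>
    compatible 11 L \<nu>1 \<nu>2 u0f u1f v0f v1f \<longrightarrow>
    (\<exists>h. C_on_rect 6 {0..T} {0..L} h \<and>
         supp_rect {0..T} {0..L} h \<subseteq> {0..T} \<times> {a..b} \<and>
         (\<exists>u v. is_solution L T \<nu>1 \<nu>2 h u0 u1 v0 v1 u v \<and>
            (\<forall>u' v'. is_solution L T \<nu>1 \<nu>2 h u0 u1 v0 v1 u' v' \<longrightarrow>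
               (\<forall>t\<in>{0..T}. \<forall>x\<in>{0..L}. u' t x = u t x \<and> v' t x = v t x)) \<and>
            (\<forall>x\<in>{0..L}. u T x = u0f x \<and> dt {0..T} u T x = u1f x \<and>
                         v T x = v0f x \<and> dt {0..T} v T x = v1f x)) \<and>
         C_norm_rect 6 {0..T} {0..L} h \<le>
           C * ((C_norm 11 {0..L} u0 + C_norm 10 {0..L} u1 +
                 C_norm 11 {0..L} u0f + C_norm 10 {0..L} u1f) +
                root 3 (C_norm 11 {0..L} v0 + C_norm 10 {0..L} v1 +
                        C_norm 11 {0..L} v0f + C_norm 10 {0..L} v1f)))"
proof -
  note L = assms(1) and \<nu> = assms(2,3) and T = assms(7)
  let ?I = "unit_data L"
  obtain u v ut utt ux uxx vt vtt vx vxx :: "(nat \<Rightarrow> real \<Rightarrow> real) \<Rightarrow> real \<times> real \<Rightarrow> real" where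
    CFs: "CF 10 ?I u" "CF 10 ?I v" "CF 8 ?I utt" "CF 8 ?I uxx"
    and du: "\<And>d t x. d \<in> ?I \<Longrightarrow> ((\<lambda>r. u d (r, x)) has_real_derivative ut d (t, x)) (at t)"
    "\<And>d t x. d \<in> ?I \<Longrightarrow> ((\<lambda>r. ut d (r, x)) has_real_derivative utt d (t, x)) (at t)"
    "\<And>d t x. d \<in> ?I \<Longrightarrow> ((\<lambda>r. u d (t, r)) has_real_derivative ux d (t, x)) (at x)"
    "\<And>d t x. d \<in> ?I \<Longrightarrow> ((\<lambda>r. ux d (t, r)) has_real_derivative uxx d (t, x)) (at x)"
    and dv: "\<And>d t x. d \<in> ?I \<Longrightarrow> ((\<lambda>r. v d (r, x)) has_real_derivative vt d (t, x)) (at t)"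
    "\<And>d t x. d \<in> ?I \<Longrightarrow> ((\<lambda>r. vt d (r, x)) has_real_derivative vtt d (t, x)) (at t)"
    "\<And>d t x. d \<in> ?I \<Longrightarrow> ((\<lambda>r. v d (t, r)) has_real_derivative vx d (t, x)) (at x)"
    "\<And>d t x. d \<in> ?I \<Longrightarrow> ((\<lambda>r. vx d (t, r)) has_real_derivative vxx d (t, x)) (at x)"
    and off: "\<And>d t x. d \<in> ?I \<Longrightarrow> 0 \<le> x \<Longrightarrow> x \<le> L \<Longrightarrow> x \<notin> {a..b} \<Longrightarrow> utt d (t, x) - \<nu>1\<^sup>2 * uxx d (t, x) = 0"
    and wv: "\<And>d t x. d \<in> ?I \<Longrightarrow> vtt d (t, x) - \<nu>2\<^sup>2 * vxx d (t, x) = u d (t, x) ^ 3"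
    and bd: "\<And>d t. d \<in> ?I \<Longrightarrow> u d (t, 0) = 0 \<and> u d (t, L) = 0 \<and> v d (t, 0) = 0 \<and> v d (t, L) = 0"
    and init: "\<And>d x. d \<in> ?I \<Longrightarrow> 0 \<le> x \<Longrightarrow> x \<le> L \<Longrightarrow>
       u d (0, x) = d 0 x \<and> ut d (0, x) = d 1 x \<and> u d (T, x) = d 2 x \<and> ut d (T, x) = d 3 x \<and>
       v d (0, x) = d 4 x \<and> vt d (0, x) = d 5 x \<and> v d (T, x) = d 6 x \<and> vt d (T, x) = d 7 x"
  proof (rule controlled_unit_data[OF assms], goal_cases)
    case (1 u v ut utt ux uxx vt vtt vx vxx)
    show ?case by (rule that[of u v utt uxx ut ux vt vtt vx vxx]) (fact 1)+
  qed
  define h where "h = (\<lambda>d p. utt d p - \<nu>1\<^sup>2 * uxx d p)"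
  have CFh: "CF 6 ?I h"
    unfolding h_def by (rule CF_mono[of 8]) (intro CF_diff CF_cmult CFs, simp)
  have CFu: "CF 6 ?I u" "CF 6 ?I v"
    by (rule CF_mono[OF CFs(1)], simp) (rule CF_mono[OF CFs(2)], simp)
  obtain C0 where C0: "\<And>d c. d \<in> ?I \<Longrightarrow> C_norm_rect 6 {0..T} {0..L} (\<lambda>t x. c * h d (t, x)) \<le> \<bar>c\<bar> * C0"
    using CF_C_norm_rect_bounded[OF T L CFh] by blast
  show ?thesis
  \<comment> \<open>The absolute value and the added 1 ensure a positive constant.\<close>
  proof (intro exI[of _ "\<bar>C0\<bar> + 1"] conjI allI impI)
    fix u0 u1 v0 v1 u0f u1f v0f v1f
    assume C11: "\<forall>w \<in> {u0, v0, u0f, v0f}. C_on 11 {0..L} w"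
      and C10: "\<forall>w \<in> {u1, v1, u1f, v1f}. C_on 10 {0..L} w"
      and comp: "compatible 11 L \<nu>1 \<nu>2 u0 u1 v0 v1" "compatible 11 L \<nu>1 \<nu>2 u0f u1f v0f v1f"
    define Nu where "Nu = C_norm 11 {0..L} u0 + C_norm 10 {0..L} u1 + C_norm 11 {0..L} u0f + C_norm 10 {0..L} u1f"
    define Nv where "Nv = C_norm 11 {0..L} v0 + C_norm 10 {0..L} v1 + C_norm 11 {0..L} v0f + C_norm 10 {0..L} v1f"
    \<comment> \<open>With this M both Nu \<le> M and Nv \<le> M^3 hold, so the two groups of data
      are normalised at once, and M is exactly the bracket in the estimate.\<close>
    define M where "M = Nu + root 3 Nv"
    have nn: "0 \<le> C_norm 11 {0..L} u0" "0 \<le> C_norm 10 {0..L} u1" "0 \<le> C_norm 11 {0..L} u0f" "0 \<le> C_norm 10 {0..L} u1f"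
      "0 \<le> C_norm 11 {0..L} v0" "0 \<le> C_norm 10 {0..L} v1" "0 \<le> C_norm 11 {0..L} v0f" "0 \<le> C_norm 10 {0..L} v1f"
      using C11 C10 L by (auto intro!: C_norm_nonneg)
    then have N: "0 \<le> Nu" "0 \<le> Nv"
      by (auto simp: Nu_def Nv_def)
    have M: "M \<ge> 0" "Nu \<le> M"
      using N by (auto simp: M_def)
    have "Nv = root 3 Nv ^ 3"
      using odd_real_root_pow[of 3 Nv] by simp
    also have "\<dots> \<le> M ^ 3"
      using N by (intro power_mono) (auto simp: M_def)
    finally have M3: "Nv \<le> M ^ 3" .
    have par1: "C_par (Some True) 11 L u0" "C_par (Some True) 10 L u1" "C_par (Some True) 11 L v0" "C_par (Some True) 10 L v1"
      using compatible_C_par[OF L \<nu>, of 10 u0 u1 v0 v1] comp(1) C11 C10 by (simp_all del: C_par.simps C_on.simps)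
    have par2: "C_par (Some True) 11 L u0f" "C_par (Some True) 10 L u1f" "C_par (Some True) 11 L v0f" "C_par (Some True) 10 L v1f"
      using compatible_C_par[OF L \<nu>, of 10 u0f u1f v0f v1f] comp(2) C11 C10 by (simp_all del: C_par.simps C_on.simps)
    \<comment> \<open>\<open>unit_data\<close> constrains all indices, so the eight functions are
      repeated periodically. As 8 is even, the parity of the index still decides between the orders
      11 and 10.\<close>
    define D where "D = (\<lambda>j. [u0, u1, u0f, u1f, v0, v1, v0f, v1f] ! (j mod 8))"
    have Dj: "D 0 = u0" "D 1 = u1" "D 2 = u0f" "D 3 = u1f" "D 4 = v0" "D 5 = v1" "D 6 = v0f" "D 7 = v1f"
      by (simp_all add: D_def)
    have le: "C_norm 11 {0..L} u0 \<le> M"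
      "C_norm 10 {0..L} u1 \<le> M"
      "C_norm 11 {0..L} u0f \<le> M"
      "C_norm 10 {0..L} u1f \<le> M"
      "C_norm 11 {0..L} v0 \<le> M ^ 3"
      "C_norm 10 {0..L} v1 \<le> M ^ 3"
      "C_norm 11 {0..L} v0f \<le> M ^ 3"
      "C_norm 10 {0..L} v1f \<le> M ^ 3"
      using nn M(2) M3 unfolding Nu_def Nv_def by - linarith+
    have D: "C_par (Some True) (if even j then 11 else 10) L (D j) \<and>
      C_norm (if even j then 11 else 10) {0..L} (D j) \<le> (if j mod 8 < 4 then M else M ^ 3)" for j
    proof -
      define m where "m = j mod 8"
      have "even j \<longleftrightarrow> even m" "D j = D m" "m < 8"
        unfolding m_def D_def by (presburger, simp, simp)
      moreover from \<open>m < 8\<close> consider "m = 0" | "m = 1" | "m = 2" | "m = 3" | "m = 4" | "m = 5" | "m = 6" | "m = 7"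
        by linarith
      then have "C_par (Some True) (if even m then 11 else 10) L (D m) \<and>
        C_norm (if even m then 11 else 10) {0..L} (D m) \<le> (if m < 4 then M else M ^ 3)"
        by cases (simp_all only: Dj, simp_all add: par1 par2 le del: C_par.simps One_nat_def)
      ultimately show ?thesis
        by (simp only: m_def)
    qed
    obtain d where d: "d \<in> ?I" and Dd: "\<And>j x. x \<in> {0..L} \<Longrightarrow> D j x = (if j mod 8 < 4 then M else M ^ 3) * d j x"
      by (rule scaled_unit_data[OF L conjunct1[OF D] conjunct2[OF D] M(1)]) blast
    have data: "D j x = M * d j x" if "j < 4" "x \<in> {0..L}" for j x
      using Dd[OF that(2), of j] that(1) by simp
    have data': "D j x = M ^ 3 * d j x" if "4 \<le> j" "j < 8" "x \<in> {0..L}" for j x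
      using Dd[OF that(3), of j] that(1,2) by simp
    have data: "u0 x = M * d 0 x" "u1 x = M * d 1 x" "u0f x = M * d 2 x" "u1f x = M * d 3 x"
      "v0 x = M ^ 3 * d 4 x" "v1 x = M ^ 3 * d 5 x" "v0f x = M ^ 3 * d 6 x" "v1f x = M ^ 3 * d 7 x" if "x \<in> {0..L}" for x
      unfolding Dj[symmetric] by ((rule data[OF _ that], simp) | (rule data'[OF _ _ that], simp, simp))+
    let ?u = "\<lambda>t x. M * u d (t, x)" and ?v = "\<lambda>t x. M ^ 3 * v d (t, x)" and ?h = "\<lambda>t x. M * h d (t, x)"
    have Ch: "C_on_rect 6 {0..T} {0..L} ?h" and Cu: "C_on_rect 6 {0..T} {0..L} ?u" and Cv: "C_on_rect 6 {0..T} {0..L} ?v"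
      by (rule CF_C_on_rect[OF T L CF_cmult[OF CFh] d] CF_C_on_rect[OF T L CF_cmult[OF CFu(1)] d]
          CF_C_on_rect[OF T L CF_cmult[OF CFu(2)] d])+
    have t1: "dt {0..T} ?u t x = M * ut d (t, x)" "dt {0..T} ?v t x = M ^ 3 * vt d (t, x)"
      "dx {0..L} ?u t x = M * ux d (t, x)" "dx {0..L} ?v t x = M ^ 3 * vx d (t, x)"
      if "t \<in> {0..T}" "x \<in> {0..L}" for t x
      using dt_eq[OF T L, where W = "\<lambda>p. M * u d p" and Wt = "\<lambda>p. M * ut d p", OF refl DERIV_cmult[OF du(1)[OF d]] that]
        dt_eq[OF T L, where W = "\<lambda>p. M ^ 3 * v d p" and Wt = "\<lambda>p. M ^ 3 * vt d p", OF refl DERIV_cmult[OF dv(1)[OF d]] that]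
        dx_eq[OF T L, where W = "\<lambda>p. M * u d p" and Wx = "\<lambda>p. M * ux d p", OF refl DERIV_cmult[OF du(3)[OF d]] that]
        dx_eq[OF T L, where W = "\<lambda>p. M ^ 3 * v d p" and Wx = "\<lambda>p. M ^ 3 * vx d p", OF refl DERIV_cmult[OF dv(3)[OF d]] that]
      by auto
    have t2: "(dt {0..T} ^^ 2) ?u t x = M * utt d (t, x)" "(dt {0..T} ^^ 2) ?v t x = M ^ 3 * vtt d (t, x)"
      "(dx {0..L} ^^ 2) ?u t x = M * uxx d (t, x)" "(dx {0..L} ^^ 2) ?v t x = M ^ 3 * vxx d (t, x)"
      if "t \<in> {0..T}" "x \<in> {0..L}" for t x
      using dt_eq[OF T L, where W = "\<lambda>p. M * ut d p" and Wt = "\<lambda>p. M * utt d p", OF t1(1) DERIV_cmult[OF du(2)[OF d]] that]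
        dt_eq[OF T L, where W = "\<lambda>p. M ^ 3 * vt d p" and Wt = "\<lambda>p. M ^ 3 * vtt d p", OF t1(2) DERIV_cmult[OF dv(2)[OF d]] that]
        dx_eq[OF T L, where W = "\<lambda>p. M * ux d p" and Wx = "\<lambda>p. M * uxx d p", OF t1(3) DERIV_cmult[OF du(4)[OF d]] that]
        dx_eq[OF T L, where W = "\<lambda>p. M ^ 3 * vx d p" and Wx = "\<lambda>p. M ^ 3 * vxx d p", OF t1(4) DERIV_cmult[OF dv(4)[OF d]] that]
      by (simp_all add: numeral_2_eq_2)
    have T0: "0 \<in> {0..T}" "T \<in> {0..T}"
      using T by auto
    have sol: "is_solution L T \<nu>1 \<nu>2 ?h u0 u1 v0 v1 ?u ?v"
      unfolding is_solution_def
    proof (intro conjI ballI Cu Cv)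
      fix t x assume tx: "t \<in> {0..T}" "x \<in> {0..L}"
      show "(dt {0..T} ^^ 2) ?u t x - \<nu>1\<^sup>2 * (dx {0..L} ^^ 2) ?u t x = ?h t x"
        unfolding t2[OF tx] by (simp add: h_def algebra_simps)
      have "M ^ 3 * (vtt d (t, x) - \<nu>2\<^sup>2 * vxx d (t, x)) = ?u t x ^ 3"
        unfolding wv[OF d] by (simp add: power_mult_distrib)
      then show "(dt {0..T} ^^ 2) ?v t x - \<nu>2\<^sup>2 * (dx {0..L} ^^ 2) ?v t x = ?u t x ^ 3"
        unfolding t2[OF tx] by (simp add: algebra_simps)
    next
      fix t x assume "x \<in> {0, L}"
      then show "?u t x = 0" "?v t x = 0"
        using bd[OF d, of t] by auto
    next
      fix x assume x: "x \<in> {0..L}"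
      show "?u 0 x = u0 x" "dt {0..T} ?u 0 x = u1 x" "?v 0 x = v0 x" "dt {0..T} ?v 0 x = v1 x"
        using init[OF d, of x] x unfolding t1[OF T0(1) x] data[OF x] by auto
    qed
    show "\<exists>h. C_on_rect 6 {0..T} {0..L} h \<and>
         supp_rect {0..T} {0..L} h \<subseteq> {0..T} \<times> {a..b} \<and>
         (\<exists>u v. is_solution L T \<nu>1 \<nu>2 h u0 u1 v0 v1 u v \<and>
            (\<forall>u' v'. is_solution L T \<nu>1 \<nu>2 h u0 u1 v0 v1 u' v' \<longrightarrow>
               (\<forall>t\<in>{0..T}. \<forall>x\<in>{0..L}. u' t x = u t x \<and> v' t x = v t x)) \<and>
            (\<forall>x\<in>{0..L}. u T x = u0f x \<and> dt {0..T} u T x = u1f x \<and>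
                         v T x = v0f x \<and> dt {0..T} v T x = v1f x)) \<and>
         C_norm_rect 6 {0..T} {0..L} h \<le>
           (\<bar>C0\<bar> + 1) * ((C_norm 11 {0..L} u0 + C_norm 10 {0..L} u1 +
                 C_norm 11 {0..L} u0f + C_norm 10 {0..L} u1f) +
                root 3 (C_norm 11 {0..L} v0 + C_norm 10 {0..L} v1 +
                        C_norm 11 {0..L} v0f + C_norm 10 {0..L} v1f))"
      unfolding Nu_def[symmetric] Nv_def[symmetric] M_def[symmetric]
    proof (rule exI[of _ ?h], intro conjI Ch)
      \<comment> \<open>The residual vanishes off [a, b], and the target is closed, so taking the
        closure adds nothing outside it.\<close>
      have "{(t, x). t \<in> {0..T} \<and> x \<in> {0..L} \<and> ?h t x \<noteq> 0} \<subseteq> {0..T} \<times> {a..b}"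
        using off[OF d] by (fastforce simp: h_def)
      then show "supp_rect {0..T} {0..L} ?h \<subseteq> {0..T} \<times> {a..b}"
        unfolding supp_rect_def by (rule closure_minimal) (intro closed_Times closed_atLeastAtMost)
      show "C_norm_rect 6 {0..T} {0..L} ?h \<le> (\<bar>C0\<bar> + 1) * M"
      proof -
        have "C_norm_rect 6 {0..T} {0..L} ?h \<le> M * C0"
          using C0[OF d, of M] M(1) by simp
        also have "\<dots> \<le> M * (\<bar>C0\<bar> + 1)"
          using M(1) by (intro mult_left_mono) auto
        finally show ?thesis by (simp add: mult.commute)
      qed
      show "\<exists>u v. is_solution L T \<nu>1 \<nu>2 ?h u0 u1 v0 v1 u v \<and>
            (\<forall>u' v'. is_solution L T \<nu>1 \<nu>2 ?h u0 u1 v0 v1 u' v' \<longrightarrow>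
               (\<forall>t\<in>{0..T}. \<forall>x\<in>{0..L}. u' t x = u t x \<and> v' t x = v t x)) \<and>
            (\<forall>x\<in>{0..L}. u T x = u0f x \<and> dt {0..T} u T x = u1f x \<and>
                         v T x = v0f x \<and> dt {0..T} v T x = v1f x)"
      proof (rule exI[of _ ?u], rule exI[of _ ?v], intro conjI allI impI ballI sol)
        fix x assume x: "x \<in> {0..L}"
        show "?u T x = u0f x" "dt {0..T} ?u T x = u1f x" "?v T x = v0f x" "dt {0..T} ?v T x = v1f x"
          using init[OF d, of x] x unfolding t1[OF T0(2) x] data[OF x] by auto
      next
        fix u' v' t x
        assume "is_solution L T \<nu>1 \<nu>2 ?h u0 u1 v0 v1 u' v'" "t \<in> {0..T}" "x \<in> {0..L}"
        then show "u' t x = ?u t x" "v' t x = ?v t x"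
          by (rule is_solution_unique[OF T L sol])+
      qed
    qed
  qed simp
qed

end
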